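(* Let $N\ge 3$, let $\Omega\subset\mathbb{R}^N$ be a bounded domain, let $\rho^\ast\in P(\partial\Omega)$ be an equilibrium measure for $\mathcal{E}$, and set $\lambda^\ast:=\langle\rho^\ast,\phi_{\rho^\ast}\rangle$. Then $\phi_{\rho^\ast}(x)=\lambda^\ast$ for every $x\in\overline{\Omega}$.
   Context: $P(\partial\Omega)$ is the set of positive Borel measures $\rho$ on $\mathbb{R}^N$ supported on $\partial\Omega$ with $\rho(\partial\Omega)=1$. $D^{1,2}(\mathbb{R}^N)$ is the completion of $C_c^\infty(\mathbb{R}^N)$ with respect to $\|\nabla\cdot\|_{L^2}$. Set $\mathcal{X}=D^{1,2}(\mathbb{R}^N)\cap\{\phi\in C^{0,1}(\mathbb{R}^N):\|\nabla\phi\|_\infty\le 1\}$; functions in $\mathcal X$ are bounded, continuous and tend to $0$ at infinity. For $\rho\in P(\partial\Omega)$ let $$\mathcal{I}_\rho(\phi)=\int_{\mathbb{R}^N}\left(1-\sqrt{1-|\nabla\phi|^2}\right)dx-\langle\rho,\phi\rangle,\quad \phi\in\mathcal{X},\qquad \langle\rho,\phi\rangle=\int_{\partial\Omega}\phi\,d\rho .$$ It is known that $\mathcal{I}_\rho$ has a unique minimizer on $\mathcal{X}$, denoted $\phi_\rho$. The electrostatic energy is $\mathcal{E}(\phi_\rho):=-\mathcal{I}_\rho(\phi_\rho)$. A measure $\rho^\ast\in P(\partial\Omega)$ is an equilibrium measure for $\mathcal{E}$ if $\mathcal{E}(\phi_{\rho^\ast})=\inf_{\rho\in P(\partial\Omega)}\mathcal{E}(\phi_\rho)$.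 *)

theory Defs
  imports "HOL-Analysis.Analysis"
begin

definition gradient :: "('a::euclidean_space \<Rightarrow> real) \<Rightarrow> 'a \<Rightarrow> 'a" where
  "gradient f x = (SOME D. GDERIV f x :> D)"

text \<open>The predicate \<open>Ck k f\<close> says that f is of class $C^k$ on the whole space.\<close>

primrec Ck :: "nat \<Rightarrow> ('a::euclidean_space \<Rightarrow> real) \<Rightarrow> bool" where
  "Ck 0 f \<longleftrightarrow> continuous_on UNIV f"
| "Ck (Suc k) f \<longleftrightarrow>
     (\<forall>x. f differentiable (at x)) \<and> (\<forall>b\<in>Basis. Ck k (\<lambda>x. gradient f x \<bullet> b))"

definition test_functions :: "('a::euclidean_space \<Rightarrow> real) set" where
  "test_functions = {f. (\<forall>k. Ck k f) \<and> compact (closure {x. f x \<noteq> 0})}"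

definition dirichlet_norm :: "('a::euclidean_space \<Rightarrow> real) \<Rightarrow> real" where
  "dirichlet_norm f = sqrt (LINT x|lborel. (norm (gradient f x))\<^sup>2)"

text \<open>
  The completion $D^{1,2}$ of the test functions with respect to \<open>dirichlet_norm\<close>, realised as a
  space of functions. In dimension at least 3, by Sobolev's inequality, a sequence of test functions
  that is Cauchy for \<open>dirichlet_norm\<close> converges in $L^{2N/(N-2)}$, hence in $L^1_{loc}$, and its
  limit vanishes almost everywhere exactly if the sequence tends to 0 in \<open>dirichlet_norm\<close>. So
  an element of the completion (a class of Cauchy sequences) is the same thing as the limit function
  of the sequence, up to equality almost everywhere. In dimensions 1 and 2 there is no such
  identification, and the set below is not meant to be used there.
\<close>

definition D12 :: "('a::euclidean_space \<Rightarrow> real) set" where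
  "D12 = {\<phi>. \<phi> \<in> borel_measurable lborel \<and>
     (\<exists>\<psi>::nat \<Rightarrow> 'a \<Rightarrow> real.
        (\<forall>n. \<psi> n \<in> test_functions) \<and>
        (\<forall>e>0. \<exists>M. \<forall>m\<ge>M. \<forall>n\<ge>M. dirichlet_norm (\<lambda>x. \<psi> m x - \<psi> n x) < e) \<and>
        (\<forall>R. (\<lambda>n. \<integral>\<^sup>+x\<in>cball 0 R. ennreal \<bar>\<psi> n x - \<phi> x\<bar> \<partial>lborel) \<longlonglongrightarrow> 0))}"

text \<open>
  The gradient of a function in $D^{1,2}$ or of a Lipschitz function is the weak (distributional) one;
  it is determined up to equality almost everywhere, and \<open>weak_grad\<close> picks a representative.
\<close>

definition is_weak_grad :: "('a::euclidean_space \<Rightarrow> real) \<Rightarrow> ('a \<Rightarrow> 'a) \<Rightarrow> bool" where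
  "is_weak_grad \<phi> g \<longleftrightarrow>
     (\<forall>K. compact K \<longrightarrow> set_integrable lborel K \<phi> \<and> set_integrable lborel K g) \<and>
     (\<forall>\<psi>\<in>test_functions. \<forall>b\<in>Basis.
        (LINT x|lborel. \<phi> x * (gradient \<psi> x \<bullet> b)) = - (LINT x|lborel. (g x \<bullet> b) * \<psi> x))"

definition weak_grad :: "('a::euclidean_space \<Rightarrow> real) \<Rightarrow> 'a \<Rightarrow> 'a" where
  "weak_grad \<phi> = (SOME g. is_weak_grad \<phi> g)"

definition X_space :: "('a::euclidean_space \<Rightarrow> real) set" where
  "X_space = D12 \<inter>
     {\<phi>. (\<exists>L. L-lipschitz_on UNIV \<phi>) \<and> (AE x in lborel. norm (weak_grad \<phi> x) \<le> 1)}"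

text \<open>Since the frontier is closed, being supported on it means that its complement is a null set.\<close>

definition prob_on_frontier :: "'a::euclidean_space set \<Rightarrow> 'a measure set" where
  "prob_on_frontier \<Omega> = {\<rho>. sets \<rho> = sets borel \<and>
     emeasure \<rho> (- frontier \<Omega>) = 0 \<and> emeasure \<rho> (frontier \<Omega>) = 1}"

definition pairing :: "'a::euclidean_space set \<Rightarrow> 'a measure \<Rightarrow> ('a \<Rightarrow> real) \<Rightarrow> real" where
  "pairing \<Omega> \<rho> \<phi> = (LINT x:frontier \<Omega>|\<rho>. \<phi> x)"

definition BI_functional :: "'a::euclidean_space set \<Rightarrow> 'a measure \<Rightarrow> ('a \<Rightarrow> real) \<Rightarrow> real" where
  "BI_functional \<Omega> \<rho> \<phi> =
     (LINT x|lborel. 1 - sqrt (1 - (norm (weak_grad \<phi> x))\<^sup>2)) - pairing \<Omega> \<rho> \<phi>"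

text \<open>
  The definite description is justified by the existence and uniqueness of the minimizer for
  \<open>\<rho> \<in> prob_on_frontier \<Omega>\<close>, \<open>\<Omega>\<close> bounded, in dimension at least 3. Uniqueness holds pointwise
  and not just almost everywhere, because members of \<open>X_space\<close> are continuous.
\<close>

definition potential :: "'a::euclidean_space set \<Rightarrow> 'a measure \<Rightarrow> 'a \<Rightarrow> real" where
  "potential \<Omega> \<rho> = (THE \<phi>. is_arg_min (BI_functional \<Omega> \<rho>) (\<lambda>\<phi>. \<phi> \<in> X_space) \<phi>)"

definition energy :: "'a::euclidean_space set \<Rightarrow> 'a measure \<Rightarrow> real" where
  "energy \<Omega> \<rho> = - BI_functional \<Omega> \<rho> (potential \<Omega> \<rho>)"

text \<open>Energies are nonnegative (compare with the zero function), so the real infimum is a genuine one.\<close>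

definition equilibrium_measure :: "'a::euclidean_space set \<Rightarrow> 'a measure \<Rightarrow> bool" where
  "equilibrium_measure \<Omega> \<rho> \<longleftrightarrow>
     \<rho> \<in> prob_on_frontier \<Omega> \<and> energy \<Omega> \<rho> = (INF \<sigma>\<in>prob_on_frontier \<Omega>. energy \<Omega> \<sigma>)"

end

theory Submission
  imports Defs
begin

text \<open>
  The density $1 - \sqrt{1 - |p|^2}$ is uniformly convex on the unit ball, so minimizing sequences
  are Cauchy in $D^{1,2}$, and so are the potentials of converging measures. For 1-Lipschitz
  functions Hardy's inequality turns this into uniform convergence, because a large value of $u$ at
  a point forces $|u|$ to be large on a ball. Hence $\phi_\rho$ exists and is unique.
  Perturbing $\rho^*$ by a point mass at $x \in \partial\Omega$ then gives
  $\phi_{\rho^*}(x) \ge \lambda^*$ on $\partial\Omega$. Consequently the function that equals $\lambda^*$ on $\Omega$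
  and $\min(\phi_{\rho^*}, \lambda^*)$ elsewhere is admissible; it has the same pairing with $\rho^*$ and no larger
  gradient, so it is the minimizer too, and $\phi_{\rho^*} = \lambda^*$ on $\Omega$.
\<close>

section \<open>Test functions\<close>

text \<open>Both \<open>D12\<close> and \<open>weak_grad\<close> hide their data behind existential
  quantifiers and choice, so the argument runs on pairs of a function and an explicit gradient
  (\<open>D12g\<close>, \<open>Xg\<close>). The boundary inequality is obtained without
  differentiating the energy: optimality gives it exactly for the potential of the perturbed
  measure, and that potential tends uniformly to the original one as the weight of the point mass
  tends to 0. The inequality makes the truncation continuous: let A be the set where the potential
  is changed; on the frontier of A the potential equals the level, so the removed part, extended by
  0, has no jump. A is bounded only because the level is positive (a small bump beats the zero
  function, so the minimum is negative) while the potential decays at infinity. The removed part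
  then has compact support, and mollifying it shows that it lies in $D^{1,2}$. Since A is merely
  open, the weak gradient of the removed part is found through difference quotients, whose mismatch
  lives on a symmetric difference of A and a translate of A.\<close>

lemma GDERIV_gradient:
  assumes "GDERIV f x :> D" shows "gradient f x = D"
proof -
  have "GDERIV f x :> gradient f x"
    unfolding gradient_def using assms by (rule someI)
  then have "(\<lambda>h. h \<bullet> gradient f x) = (\<lambda>h. h \<bullet> D)"
    using assms has_derivative_unique unfolding gderiv_def by blast
  then show ?thesis
    by (metis inner_commute vector_eq_rdot)
qed

text \<open>\<open>gradient\<close> is a choice operator. Assembling the values of the derivative on
  the basis into a vector shows that there is something to choose; \<open>GDERIV_gradient\<close>
  shows that there is no freedom.\<close>

lemma differentiable_GDERIV:
  fixes f :: "'a::euclidean_space \<Rightarrow> real"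
  assumes "f differentiable (at x)" shows "GDERIV f x :> gradient f x"
proof -
  obtain D where D: "(f has_derivative D) (at x)" using assms differentiable_def by blast
  then interpret D: bounded_linear D by (rule has_derivative_bounded_linear)
  have "D h = h \<bullet> (\<Sum>b\<in>Basis. D b *\<^sub>R b)" for h
  proof -
    have "D h = D (\<Sum>b\<in>Basis. (h \<bullet> b) *\<^sub>R b)" by (simp add: euclidean_representation)
    also have "\<dots> = (\<Sum>b\<in>Basis. (h \<bullet> b) * D b)" by (simp add: D.sum D.scaleR)
    finally show ?thesis by (simp add: inner_sum_right mult.commute)
  qed
  then have "D = (\<lambda>h. h \<bullet> (\<Sum>b\<in>Basis. D b *\<^sub>R b))" by blast
  then have "GDERIV f x :> (\<Sum>b\<in>Basis. D b *\<^sub>R b)"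
    unfolding gderiv_def using D by simp
  then show ?thesis using GDERIV_gradient by metis
qed

lemma GDERIV_differentiable: "GDERIV f x :> D \<Longrightarrow> f differentiable (at x)"
  unfolding gderiv_def differentiable_def by blast

lemma GDERIV_continuous: "GDERIV f x :> D \<Longrightarrow> isCont f x"
  unfolding gderiv_def by (rule has_derivative_continuous)

lemma GDERIV_shift: "GDERIV f (x - a) :> D \<Longrightarrow> GDERIV (\<lambda>x. f (x - a)) x :> D"
  unfolding gderiv_def
  by (rule has_derivative_compose[of "\<lambda>x. x - a" "\<lambda>x. x", simplified]) (auto intro!: derivative_eq_intros)

section \<open>Calculus of functions of class $C^k$\<close>

lemma Ck_imp_continuous: "Ck k f \<Longrightarrow> continuous_on UNIV f"
  by (cases k) (simp_all add: continuous_on_eq_continuous_at differentiable_imp_continuous_within)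

text \<open>Lets an explicit gradient D stand in for the chosen \<open>gradient\<close>, which is
  how the closure properties below are derived.\<close>

lemma Ck_SucI:
  assumes "\<And>x. GDERIV f x :> D x" "\<And>b. b \<in> Basis \<Longrightarrow> Ck k (\<lambda>x. D x \<bullet> b)"
  shows "Ck (Suc k) f"
proof -
  have "gradient f = D" using assms(1) by (auto intro: GDERIV_gradient)
  moreover have "f differentiable (at x)" for x using assms(1) GDERIV_differentiable by blast
  ultimately show ?thesis using assms(2) by simp
qed

lemma Ck_SucD:
  assumes "Ck (Suc k) f" shows "GDERIV f x :> gradient f x" "b \<in> Basis \<Longrightarrow> Ck k (\<lambda>x. gradient f x \<bullet> b)"
  using assms by (auto intro: differentiable_GDERIV)

lemma Ck_Suc: "Ck (Suc k) f \<Longrightarrow> Ck k f"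
proof (induction k arbitrary: f)
  case 0 then show ?case using Ck_imp_continuous[OF 0] by (simp only: Ck.simps(1))
next
  case (Suc k)
  show ?case
    by (rule Ck_SucI) (use Suc.IH Suc.prems Ck_SucD in blast)+
qed

lemma Ck_const: "Ck k (\<lambda>x. c)"
proof (induction k arbitrary: c)
  case (Suc k) show ?case by (rule Ck_SucI[OF GDERIV_const]) (use Suc in simp)
qed simp

lemma Ck_inner: "Ck k (\<lambda>x. x \<bullet> b)"
proof (cases k)
  case (Suc k)
  have "GDERIV (\<lambda>x. x \<bullet> b) x :> b" for x
    unfolding gderiv_def by (auto intro!: derivative_eq_intros)
  then show ?thesis unfolding Suc by (rule Ck_SucI) (rule Ck_const)
qed (auto intro!: continuous_intros)

lemma Ck_add: "Ck k f \<Longrightarrow> Ck k g \<Longrightarrow> Ck k (\<lambda>x. f x + g x)"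
proof (induction k arbitrary: f g)
  case (Suc k)
  show ?case
    by (rule Ck_SucI[OF GDERIV_add[OF Ck_SucD(1)[OF Suc.prems(1)] Ck_SucD(1)[OF Suc.prems(2)]]])
      (simp add: inner_add_left Suc.IH Ck_SucD(2)[OF Suc.prems(1)] Ck_SucD(2)[OF Suc.prems(2)])
qed (auto intro: continuous_intros)

lemma Ck_mult: "Ck k f \<Longrightarrow> Ck k g \<Longrightarrow> Ck k (\<lambda>x. f x * g x)"
proof (induction k arbitrary: f g)
  case (Suc k)
  show ?case
    by (rule Ck_SucI[OF GDERIV_mult[OF Ck_SucD(1)[OF Suc.prems(1)] Ck_SucD(1)[OF Suc.prems(2)]]])
      (auto simp add: inner_add_left intro!: Ck_add Suc.IH Suc.prems[THEN Ck_Suc] Ck_SucD(2)[OF Suc.prems(1)] Ck_SucD(2)[OF Suc.prems(2)])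
qed (auto intro: continuous_intros)

lemma Ck_sum: "finite I \<Longrightarrow> (\<And>i. i \<in> I \<Longrightarrow> Ck k (f i)) \<Longrightarrow> Ck k (\<lambda>x. \<Sum>i\<in>I. f i x)"
  by (induction I rule: finite_induct) (auto intro: Ck_const Ck_add)

lemma Ck_shift: "Ck k f \<Longrightarrow> Ck k (\<lambda>x. f (x - a))"
proof (induction k arbitrary: f)
  case 0
  then show ?case by (auto intro!: continuous_on_compose2[of UNIV f] continuous_intros)
next
  case (Suc k)
  show ?case
    by (rule Ck_SucI[OF GDERIV_shift[OF Ck_SucD(1)[OF Suc.prems(1)]]])
      (use Suc.IH Ck_SucD(2)[OF Suc.prems(1)] in blast)
qed

section \<open>Operations on test functions\<close>

lemma test_functions_iff:
  "f \<in> test_functions \<longleftrightarrow> (\<forall>k. Ck k f) \<and> (\<exists>R. \<forall>x. R < norm x \<longrightarrow> f x = 0)"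
proof -
  have "compact (closure {x. f x \<noteq> 0}) \<longleftrightarrow> (\<exists>R. \<forall>x. R < norm x \<longrightarrow> f x = 0)"
    unfolding compact_closure bounded_iff by (auto simp: not_le[symmetric])
  then show ?thesis unfolding test_functions_def by simp
qed

lemma test_GDERIV: "f \<in> test_functions \<Longrightarrow> GDERIV f x :> gradient f x"
  using Ck_SucD(1) unfolding test_functions_iff by blast

lemma test_continuous: "f \<in> test_functions \<Longrightarrow> continuous_on UNIV f"
  using Ck_imp_continuous unfolding test_functions_iff by blast

lemma test_add: "f \<in> test_functions \<Longrightarrow> g \<in> test_functions \<Longrightarrow> (\<lambda>x. f x + g x) \<in> test_functions"
  unfolding test_functions_iff
proof safe
  fix R S assume "\<forall>x. R < norm x \<longrightarrow> f x = 0" "\<forall>x. S < norm x \<longrightarrow> g x = 0"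
  then show "\<exists>R. \<forall>x. R < norm x \<longrightarrow> f x + g x = 0" by (intro exI[of _ "max R S"]) auto
qed (auto intro: Ck_add)

lemma test_cmult: "f \<in> test_functions \<Longrightarrow> (\<lambda>x. c * f x) \<in> test_functions"
  unfolding test_functions_iff by (auto intro: Ck_mult Ck_const)

lemma test_diff: "f \<in> test_functions \<Longrightarrow> g \<in> test_functions \<Longrightarrow> (\<lambda>x. f x - g x) \<in> test_functions"
  using test_add[of f "\<lambda>x. (-1) * g x"] test_cmult[of g "-1"] by simp

lemma test_zero: "(\<lambda>x. 0) \<in> test_functions"
  unfolding test_functions_iff by (auto intro: Ck_const)

lemma test_shift: "f \<in> test_functions \<Longrightarrow> (\<lambda>x. f (x - a)) \<in> test_functions"
  unfolding test_functions_iff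
proof safe
  fix R assume R: "\<forall>x. R < norm x \<longrightarrow> f x = 0"
  show "\<exists>R. \<forall>x. R < norm x \<longrightarrow> f (x - a) = 0"
  proof (intro exI[of _ "R + norm a"] allI impI)
    fix x :: 'a assume "R + norm a < norm x"
    then have "R < norm (x - a)" using norm_triangle_ineq2[of x a] by linarith
    then show "f (x - a) = 0" using R by blast
  qed
qed (auto intro: Ck_shift)

lemma gradient_outside:
  assumes "\<forall>x. R < norm x \<longrightarrow> f x = 0" "R < norm x" shows "gradient f x = 0"
proof -
  have "open {x::'a. R < norm x}" by (simp add: open_Collect_less continuous_intros)
  have 0: "((\<lambda>x. 0) has_derivative (\<lambda>h. h \<bullet> 0)) (at x)" by simp
  have "GDERIV f x :> 0"
    unfolding gderiv_def
    by (rule has_derivative_transform_within_open[OF 0 \<open>open _\<close>]) (use assms in auto)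
  then show ?thesis by (rule GDERIV_gradient)
qed

lemma test_partial: "f \<in> test_functions \<Longrightarrow> b \<in> Basis \<Longrightarrow> (\<lambda>x. gradient f x \<bullet> b) \<in> test_functions"
  unfolding test_functions_iff
proof safe
  fix R assume "\<forall>x. R < norm x \<longrightarrow> f x = 0"
  then show "\<exists>R. \<forall>x. R < norm x \<longrightarrow> gradient f x \<bullet> b = 0"
    using gradient_outside by (metis inner_zero_left)
qed (use Ck_SucD in blast)

lemma gradient_add: "f \<in> test_functions \<Longrightarrow> g \<in> test_functions \<Longrightarrow>
    gradient (\<lambda>x. f x + g x) x = gradient f x + gradient g x"
  by (intro GDERIV_gradient GDERIV_add test_GDERIV)

lemma gradient_diff: "f \<in> test_functions \<Longrightarrow> g \<in> test_functions \<Longrightarrow>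
    gradient (\<lambda>x. f x - g x) x = gradient f x - gradient g x"
  by (intro GDERIV_gradient GDERIV_diff test_GDERIV)

lemma gradient_cmult: "f \<in> test_functions \<Longrightarrow> gradient (\<lambda>x. c * f x) x = c *\<^sub>R gradient f x"
  using GDERIV_mult[OF GDERIV_const test_GDERIV, of f c x] by (intro GDERIV_gradient) simp

lemma gradient_shift: "f \<in> test_functions \<Longrightarrow> gradient (\<lambda>x. f (x - a)) x = gradient f (x - a)"
  by (intro GDERIV_gradient GDERIV_shift test_GDERIV)

lemma continuous_gradient: "f \<in> test_functions \<Longrightarrow> continuous_on UNIV (gradient f)"
proof (subst continuous_on_componentwise, safe)
  fix b :: 'a assume "f \<in> test_functions" "b \<in> Basis"
  then show "continuous_on UNIV (\<lambda>x. gradient f x \<bullet> b)"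
    by (intro test_continuous test_partial)
qed

text \<open>The family \<open>s\<^sup>-\<^sup>j exp (-1/s)\<close>, extended by 0, is closed under differentiation up to linear
  combinations.\<close>

definition flat :: "nat \<Rightarrow> real \<Rightarrow> real" where
  "flat j s = (if s > 0 then exp (- inverse s) * inverse s ^ j else 0)"

lemma flat_nonneg: "0 \<le> flat j s"
  by (simp add: flat_def)

lemma DERIV_flat: "DERIV (flat j) s :> flat (j + 2) s - real j * flat (j + 1) s"
proof -
  consider "s > 0" | "s < 0" | "s = 0" by linarith
  then show ?thesis
  proof cases
    case 1
    have "DERIV (\<lambda>s. exp (- inverse s) * inverse s ^ j) s :> flat (j + 2) s - real j * flat (j + 1) s"
      using 1 apply (auto intro!: derivative_eq_intros simp: flat_def power_add[symmetric])
      by (cases j) (auto simp: algebra_simps power2_eq_square)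
    then show ?thesis
      by (rule has_field_derivative_transform_within_open[of _ _ _ "{0<..}"]) (use 1 in \<open>auto simp: flat_def\<close>)
  next
    case 2
    have "DERIV (\<lambda>s. 0) s :> flat (j + 2) s - real j * flat (j + 1) s"
      using 2 by (auto simp: flat_def)
    then show ?thesis
      by (rule has_field_derivative_transform_within_open[of _ _ _ "{..<0}"]) (use 2 in \<open>auto simp: flat_def\<close>)
  next
    case 3
    \<comment> \<open>At 0 the difference quotient from the right is \<open>flat (Suc j)\<close>,
      and the exponential beats every power of \<open>inverse s\<close>; from the left it is
      constantly 0.\<close>
    have lim: "((\<lambda>s::real. exp (- inverse s) * inverse s ^ Suc j) \<longlongrightarrow> 0) (at_right 0)"
      using filterlim_compose[OF tendsto_power_div_exp_0[of "Suc j"] filterlim_inverse_at_top_right]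
      by (simp add: exp_minus divide_inverse mult.commute del: power_Suc)
    have "((\<lambda>s. flat j s / s) \<longlongrightarrow> 0) (at_right 0)"
      by (rule Lim_transform_eventually[OF lim])
        (auto simp: eventually_at_filter flat_def field_simps)
    moreover have "((\<lambda>s. flat j s / s) \<longlongrightarrow> 0) (at_left 0)"
      by (rule Lim_transform_eventually[OF tendsto_const])
        (auto simp: eventually_at_filter flat_def field_simps)
    ultimately have "((\<lambda>s. flat j s / s) \<longlongrightarrow> 0) (at 0)"
      by (simp add: filterlim_at_split)
    then show ?thesis unfolding 3 DERIV_def by (simp add: flat_def)
  qed
qed

lemma Ck_flat: "Ck k (\<lambda>x::'a::euclidean_space. flat j (c - x \<bullet> x))"
proof (induction k arbitrary: j)
  case 0
  have "continuous_on UNIV (flat j)"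
    using DERIV_flat by (auto simp: continuous_on_eq_continuous_at intro: DERIV_isCont)
  then show ?case by (auto intro!: continuous_on_compose2[of UNIV "flat j"] continuous_intros)
next
  case (Suc k)
  let ?d = "\<lambda>x::'a. flat (j + 2) (c - x \<bullet> x) - real j * flat (j + 1) (c - x \<bullet> x)"
  have "GDERIV (\<lambda>x. c - x \<bullet> x) x :> (- 2) *\<^sub>R x" for x :: 'a
    unfolding gderiv_def by (auto intro!: derivative_eq_intros simp: inner_commute)
  then have "GDERIV (\<lambda>x. flat j (c - x \<bullet> x)) x :> ?d x *\<^sub>R ((- 2) *\<^sub>R x)" for x :: 'a
    by (rule GDERIV_DERIV_compose) (rule DERIV_flat)
  then show ?case
  proof (rule Ck_SucI)
    fix b :: 'a
    have "Ck k (\<lambda>x. (flat (j + 2) (c - x \<bullet> x) + (- real j) * flat (j + 1) (c - x \<bullet> x)) * ((- 2) * (x \<bullet> b)))"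
      by (intro Ck_mult Ck_add Ck_const Ck_inner Suc)
    then show "Ck k (\<lambda>x. (?d x *\<^sub>R ((- 2) *\<^sub>R x)) \<bullet> b)" by (simp add: algebra_simps)
  qed
qed

text \<open>Squaring radius and norm makes the argument of \<open>flat\<close> a polynomial in x, so
  smoothness is not lost at the origin.\<close>

definition bump :: "real \<Rightarrow> 'a::euclidean_space \<Rightarrow> real" where
  "bump r x = flat 0 (r\<^sup>2 - x \<bullet> x)"

lemma bump_nonneg: "0 \<le> bump r x"
  by (simp add: bump_def flat_nonneg)

lemma bump_pos: "norm x < r \<Longrightarrow> 0 < bump r x"
  using power_strict_mono[of "norm x" r 2] by (simp add: bump_def flat_def power2_norm_eq_inner)

lemma bump_zero: "r \<le> norm x \<Longrightarrow> 0 \<le> r \<Longrightarrow> bump r x = 0"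
  using power_mono[of r "norm x" 2] by (simp add: bump_def flat_def power2_norm_eq_inner)

lemma bump_test: "bump r \<in> test_functions"
proof -
  have "bump r x = 0" if "\<bar>r\<bar> < norm x" for x :: 'a
    using bump_zero[of "\<bar>r\<bar>" x] that by (simp add: bump_def)
  then show ?thesis
    unfolding test_functions_iff bump_def[abs_def] using Ck_flat by blast
qed

section \<open>Convolution with test functions\<close>

lemma nn_integral_shift:
  fixes a :: "'a::euclidean_space"
  assumes "f \<in> borel_measurable borel"
  shows "(\<integral>\<^sup>+x. f (x + a) \<partial>lborel) = (\<integral>\<^sup>+x. f x \<partial>lborel)"
  using assms
  by (subst (2) lborel_distr_plus[of a, symmetric]) (simp add: nn_integral_distr add.commute)

lemma integrable_shift:
  fixes f :: "'a::euclidean_space \<Rightarrow> 'b::{banach, second_countable_topology}"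
  assumes "integrable lborel f"
  shows "integrable lborel (\<lambda>x. f (x + a))"
proof -
  have "integrable (distr lborel borel ((+) a)) f" using assms by (simp add: lborel_distr_plus)
  then show ?thesis by (subst (asm) integrable_distr_eq) (use assms in \<open>auto simp: add.commute\<close>)
qed

lemma integral_shift:
  fixes f :: "'a::euclidean_space \<Rightarrow> 'b::{banach, second_countable_topology}"
  assumes "f \<in> borel_measurable borel"
  shows "(LINT x|lborel. f (x + a)) = (LINT x|lborel. f x)"
  using assms
  by (subst (2) lborel_distr_plus[of a, symmetric]) (simp add: integral_distr add.commute)

section \<open>Local integrability and products with test functions\<close>

definition loc_integrable :: "('a::euclidean_space \<Rightarrow> 'b::euclidean_space) \<Rightarrow> bool" where
  "loc_integrable f \<longleftrightarrow> (\<forall>K. compact K \<longrightarrow> set_integrable lborel K f)"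

lemma loc_integrable_measurable [measurable_dest]:
  fixes f :: "'a::euclidean_space \<Rightarrow> 'b::euclidean_space"
  assumes "loc_integrable f" shows "f \<in> borel_measurable borel"
proof -
  have "(\<lambda>x. indicator (cball 0 (real n)) x *\<^sub>R f x) \<in> borel_measurable borel" for n
    using assms unfolding loc_integrable_def set_integrable_def
    by (metis borel_measurable_integrable compact_cball measurable_lborel2)
  moreover have "(\<lambda>n. indicator (cball 0 (real n)) x *\<^sub>R f x) \<longlonglongrightarrow> f x" for x
  proof (rule tendsto_eventually)
    obtain N where "norm x \<le> real N" using real_arch_simple by blast
    then have "indicator (cball 0 (real n)) x *\<^sub>R f x = f x" if "n \<ge> N" for n
      using that by (auto simp: indicator_def)
    then show "\<forall>\<^sub>F n in sequentially. indicator (cball 0 (real n)) x *\<^sub>R f x = f x"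
      unfolding eventually_sequentially by blast
  qed
  ultimately show ?thesis by (rule borel_measurable_LIMSEQ_metric)
qed

lemma loc_integrable_inner:
  assumes "loc_integrable g" shows "loc_integrable (\<lambda>x. g x \<bullet> b)"
  unfolding loc_integrable_def set_integrable_def
proof safe
  fix K :: "'a set" assume "compact K"
  then have "integrable lborel (\<lambda>x. (indicator K x *\<^sub>R g x) \<bullet> b)"
    using assms unfolding loc_integrable_def set_integrable_def by (intro integrable_inner_left) auto
  then show "integrable lborel (\<lambda>x. indicator K x *\<^sub>R (g x \<bullet> b))" by simp
qed

lemma loc_integrable_diff: "loc_integrable f \<Longrightarrow> loc_integrable g \<Longrightarrow> loc_integrable (\<lambda>x. f x - g x)"
  unfolding loc_integrable_def by (auto intro: set_integral_diff)

lemma loc_integrable_continuous: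
  fixes f :: "'a::euclidean_space \<Rightarrow> 'b::euclidean_space"
  shows "continuous_on UNIV f \<Longrightarrow> loc_integrable f"
  unfolding loc_integrable_def set_integrable_def
  by (auto intro!: borel_integrable_compact intro: continuous_on_subset)

lemma loc_integrable_integrable:
  fixes f :: "'a::euclidean_space \<Rightarrow> 'b::euclidean_space"
  shows "integrable lborel f \<Longrightarrow> loc_integrable f"
  unfolding loc_integrable_def set_integrable_def
  by (auto intro!: integrable_mult_indicator borel_compact)

lemma loc_integrable_bounded:
  fixes f :: "'a::euclidean_space \<Rightarrow> 'b::euclidean_space"
  assumes "f \<in> borel_measurable borel" "\<And>x. norm (f x) \<le> B"
  shows "loc_integrable f"
  unfolding loc_integrable_def set_integrable_def
proof safe
  fix K :: "'a set" assume K: "compact K"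
  have [measurable]: "K \<in> sets borel" using K by (rule borel_compact)
  have "integrable lborel (\<lambda>x. B * indicator K x)"
    using K by (intro integrable_mult_right) (auto intro!: integrable_real_indicator emeasure_compact_finite[OF K])
  then show "integrable lborel (\<lambda>x. indicator K x *\<^sub>R f x)"
    by (rule Bochner_Integration.integrable_bound)
       (use assms in \<open>auto simp: indicator_def intro: order_trans[OF _ abs_ge_self]\<close>)
qed

lemma integrable_mult_support:
  fixes f \<psi> :: "'a::euclidean_space \<Rightarrow> real"
  assumes "loc_integrable f" "\<psi> \<in> borel_measurable borel" "\<And>x. \<bar>\<psi> x\<bar> \<le> B" "\<And>x. R < norm x \<Longrightarrow> \<psi> x = 0"
  shows "integrable lborel (\<lambda>x. f x * \<psi> x)"
proof -
  have [measurable]: "f \<in> borel_measurable borel" using assms(1) by (rule loc_integrable_measurable)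
  have "integrable lborel (\<lambda>x. indicator (cball 0 R) x *\<^sub>R f x)"
    using assms(1) unfolding loc_integrable_def set_integrable_def by auto
  then have "integrable lborel (\<lambda>x. B * (indicator (cball 0 R) x *\<^sub>R f x))" by (rule integrable_mult_right)
  then show ?thesis
  proof (rule Bochner_Integration.integrable_bound)
    have "\<bar>f x\<bar> * \<bar>\<psi> x\<bar> \<le> \<bar>B\<bar> * \<bar>f x\<bar>" for x
      using mult_left_mono[of "\<bar>\<psi> x\<bar>" "\<bar>B\<bar>" "\<bar>f x\<bar>"] assms(3)[of x] by (simp add: mult.commute)
    then show "AE x in lborel. norm (f x * \<psi> x) \<le> norm (B * (indicat_real (cball 0 R) x *\<^sub>R f x))"
      using assms(4) by (auto simp: indicator_def abs_mult not_le)
  qed (use assms(2) in measurable)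
qed

lemma test_supportE:
  assumes "f \<in> test_functions"
  obtains R where "R > 0" "\<And>x. R < norm x \<Longrightarrow> f x = 0" "\<And>x. R < norm x \<Longrightarrow> gradient f x = 0"
proof -
  obtain R where R: "\<forall>x. R < norm x \<longrightarrow> f x = 0" using assms unfolding test_functions_iff by blast
  show ?thesis by (rule that[of "max R 1"]) (use R gradient_outside[OF R] in auto)
qed

lemma bounded_support:
  fixes f :: "'a::euclidean_space \<Rightarrow> 'b::real_normed_vector"
  assumes "continuous_on UNIV f" "\<And>x. R < norm x \<Longrightarrow> f x = 0"
  obtains B where "B \<ge> 0" "\<And>x. norm (f x) \<le> B"
proof -
  have "compact (f ` cball 0 R)"
    using assms(1) by (intro compact_continuous_image) (auto intro: continuous_on_subset)
  then obtain B where B: "\<forall>y\<in>f ` cball 0 R. norm y \<le> B" using compact_imp_bounded bounded_iff by metis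
  show ?thesis
  proof
    fix x show "norm (f x) \<le> max B 0" using B assms(2)[of x] by (cases "norm x \<le> R") (auto simp: le_max_iff_disj)
  qed simp
qed

lemma test_bounded:
  assumes "f \<in> test_functions"
  obtains B where "B \<ge> 0" "\<And>x. \<bar>f x\<bar> \<le> B" "\<And>x. norm (gradient f x) \<le> B"
proof -
  obtain R where R: "\<And>x. R < norm x \<Longrightarrow> f x = 0" "\<And>x. R < norm x \<Longrightarrow> gradient f x = 0"
    by (rule test_supportE[OF assms]) (rule that)
  obtain B where B: "B \<ge> 0" "\<And>x. norm (f x) \<le> B"
    using bounded_support[OF test_continuous[OF assms] R(1)] by blast
  obtain C where C: "C \<ge> 0" "\<And>x. norm (gradient f x) \<le> C"
    using bounded_support[OF continuous_gradient[OF assms] R(2)] by blast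
  show ?thesis
  proof (rule that[of "max B C"])
    show "\<bar>f x\<bar> \<le> max B C" for x using B(2)[of x] by simp
    show "norm (gradient f x) \<le> max B C" for x using C(2)[of x] by simp
  qed (use B in simp)
qed

lemma test_measurable: "f \<in> test_functions \<Longrightarrow> f \<in> borel_measurable borel"
  by (rule borel_measurable_continuous_onI) (rule test_continuous)

lemma gradient_measurable: "f \<in> test_functions \<Longrightarrow> gradient f \<in> borel_measurable borel"
  by (rule borel_measurable_continuous_onI) (rule continuous_gradient)

lemma integrable_mult_test:
  assumes "loc_integrable f" "\<psi> \<in> test_functions"
  shows "integrable lborel (\<lambda>x. f x * \<psi> x)"
proof -
  obtain R where R: "\<And>x. R < norm x \<Longrightarrow> \<psi> x = 0"
    by (rule test_supportE[OF assms(2)]) (rule that)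
  obtain B where B: "\<And>x. \<bar>\<psi> x\<bar> \<le> B"
    by (rule test_bounded[OF assms(2)]) (rule that)
  show ?thesis
    by (rule integrable_mult_support[OF assms(1) test_measurable[OF assms(2)] B R])
qed

lemma loc_integrable_one: "loc_integrable (\<lambda>x. 1::real)"
  by (intro loc_integrable_continuous continuous_intros)

lemma integrable_test: "\<psi> \<in> test_functions \<Longrightarrow> integrable lborel \<psi>"
  using integrable_mult_test[OF loc_integrable_one] by simp

lemma test_lipschitz:
  fixes f :: "'a::euclidean_space \<Rightarrow> real"
  assumes "f \<in> test_functions"
  obtains L where "L-lipschitz_on UNIV f"
proof -
  obtain B where B: "B \<ge> 0" "\<And>x. norm (gradient f x) \<le> B"
    by (rule test_bounded[OF assms]) (rule that)
  have "B-lipschitz_on UNIV f"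
  proof (rule lipschitz_onI[OF _ B(1)])
    fix x y
    have "norm (f x - f y) \<le> B * norm (x - y)"
    proof (rule differentiable_bound[of UNIV f "\<lambda>x h. h \<bullet> gradient f x"])
      show "(f has_derivative (\<lambda>h. h \<bullet> gradient f x)) (at x within UNIV)" for x
        using test_GDERIV[OF assms] unfolding gderiv_def by simp
      show "onorm (\<lambda>h. h \<bullet> gradient f x) \<le> B" for x
        by (rule onorm_bound[OF B(1)])
          (use B(2)[of x] in \<open>auto intro: order_trans[OF Cauchy_Schwarz_ineq2] simp: mult.commute[of B] mult_left_mono\<close>)
    qed auto
    then show "dist (f x) (f y) \<le> B * dist x y" by (simp add: dist_norm)
  qed
  then show ?thesis by (rule that)
qed

text \<open>The components of the gradient are again test functions, hence Lipschitz, and so the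
  remainder is quadratic with a constant independent of x. This uniformity lets
  \<open>conv_GDERIV\<close> differentiate under the integral by a direct estimate.\<close>

lemma test_taylor:
  fixes f :: "'a::euclidean_space \<Rightarrow> real"
  assumes "f \<in> test_functions"
  obtains L where "L \<ge> 0" "\<And>x k. \<bar>f (x + k) - f x - k \<bullet> gradient f x\<bar> \<le> L * (norm k)\<^sup>2"
proof -
  have "\<forall>b\<in>Basis. \<exists>L. L-lipschitz_on UNIV (\<lambda>x. gradient f x \<bullet> b)"
    using test_lipschitz[OF test_partial[OF assms]] by blast
  then obtain L where L: "\<And>b. b \<in> Basis \<Longrightarrow> (L b)-lipschitz_on UNIV (\<lambda>x. gradient f x \<bullet> b)" by metis
  define M where "M = (\<Sum>b\<in>(Basis::'a set). L b)"
  have "M \<ge> 0" unfolding M_def using L by (intro sum_nonneg) (auto dest: lipschitz_on_nonneg)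
  have G: "norm (gradient f x - gradient f y) \<le> M * norm (x - y)" for x y
  proof -
    have "norm (gradient f x - gradient f y) \<le> (\<Sum>b\<in>Basis. \<bar>(gradient f x - gradient f y) \<bullet> b\<bar>)"
      by (rule norm_le_l1)
    also have "\<dots> \<le> (\<Sum>b\<in>Basis. L b * norm (x - y))"
    proof (rule sum_mono)
      fix b :: 'a assume "b \<in> Basis"
      then show "\<bar>(gradient f x - gradient f y) \<bullet> b\<bar> \<le> L b * norm (x - y)"
        using lipschitz_onD[OF L, of b x y] by (simp add: dist_norm inner_diff_left)
    qed
    finally show ?thesis by (simp add: M_def sum_distrib_right)
  qed
  have "\<bar>f (x + k) - f x - k \<bullet> gradient f x\<bar> \<le> M * (norm k)\<^sup>2" for x k
  proof -
    have "norm (f (x + k) - f x - ((x + k) - x) \<bullet> gradient f x) \<le> norm ((x + k) - x) * (M * norm k)"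
    proof (rule differentiable_bound_linearization[of x "x + k" "cball x (norm k)" f "\<lambda>x h. h \<bullet> gradient f x"])
      show "x + t *\<^sub>R (x + k - x) \<in> cball x (norm k)" if "t \<in> {0..1}" for t
        using that by (simp add: dist_norm mult_left_le_one_le)
      show "(f has_derivative (\<lambda>h. h \<bullet> gradient f y)) (at y within cball x (norm k))" for y
        by (rule has_derivative_at_withinI[OF test_GDERIV[OF assms, unfolded gderiv_def]])
      show "onorm ((\<lambda>i. i \<bullet> gradient f y) - (\<lambda>i. i \<bullet> gradient f x)) \<le> M * norm k"
        if "y \<in> cball x (norm k)" for y
        unfolding fun_diff_def
      proof (rule onorm_bound)
        show "0 \<le> M * norm k" using \<open>M \<ge> 0\<close> by simp
        fix i
        have "norm (i \<bullet> gradient f y - i \<bullet> gradient f x) \<le> norm i * norm (gradient f y - gradient f x)"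
          unfolding inner_diff_right[symmetric] real_norm_def by (rule Cauchy_Schwarz_ineq2)
        also have "\<dots> \<le> norm i * (M * norm (y - x))" using G by (intro mult_left_mono) auto
        also have "\<dots> \<le> norm i * (M * norm k)"
          using that \<open>M \<ge> 0\<close> by (intro mult_left_mono) (auto simp: dist_norm norm_minus_commute)
        finally show "norm (i \<bullet> gradient f y - i \<bullet> gradient f x) \<le> M * norm k * norm i" by (simp add: mult_ac)
      qed
    qed auto
    then show ?thesis by (simp add: power2_eq_square mult_ac)
  qed
  with \<open>M \<ge> 0\<close> show ?thesis by (rule that)
qed

text \<open>Correlation rather than convolution: this avoids the reflection of \<open>\<psi>\<close>, at the price of a sign
  in the gradient.\<close>

definition conv :: "('a::euclidean_space \<Rightarrow> real) \<Rightarrow> ('a \<Rightarrow> real) \<Rightarrow> 'a \<Rightarrow> real" where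
  "conv f \<psi> y = (LINT x|lborel. f x * \<psi> (x - y))"

lemma conv_GDERIV:
  fixes f :: "'a::euclidean_space \<Rightarrow> real"
  assumes f: "loc_integrable f" and \<psi>: "\<psi> \<in> test_functions"
  shows "GDERIV (conv f \<psi>) y :> - (\<Sum>b\<in>Basis. conv f (\<lambda>x. gradient \<psi> x \<bullet> b) y *\<^sub>R b)"
proof -
  define D where "D = - (\<Sum>b\<in>Basis. conv f (\<lambda>x. gradient \<psi> x \<bullet> b) y *\<^sub>R b)"
  obtain L where L: "L \<ge> 0" "\<And>x k. \<bar>\<psi> (x + k) - \<psi> x - k \<bullet> gradient \<psi> x\<bar> \<le> L * (norm k)\<^sup>2"
    by (rule test_taylor[OF \<psi>]) (rule that)
  obtain R where R: "R > 0" "\<And>x. R < norm x \<Longrightarrow> \<psi> x = 0" "\<And>x. R < norm x \<Longrightarrow> gradient \<psi> x = 0"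
    by (rule test_supportE[OF \<psi>]) (rule that)
  have int_partial: "integrable lborel (\<lambda>x. f x * (gradient \<psi> (x - y) \<bullet> b))" if "b \<in> Basis" for b y
    using integrable_mult_test[OF f test_shift[OF test_partial[OF \<psi> that]]] .
  have int: "integrable lborel (\<lambda>x. f x * \<psi> (x - y))" for y
    using integrable_mult_test[OF f test_shift[OF \<psi>]] .
  have expand: "k \<bullet> gradient \<psi> z = (\<Sum>b\<in>Basis. (k \<bullet> b) * (gradient \<psi> z \<bullet> b))" for k z
    by (rule euclidean_inner)
  have int_k: "integrable lborel (\<lambda>x. f x * (k \<bullet> gradient \<psi> (x - y)))" for k
  proof -
    have "integrable lborel (\<lambda>x. \<Sum>b\<in>Basis. (k \<bullet> b) * (f x * (gradient \<psi> (x - y) \<bullet> b)))"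
      by (intro Bochner_Integration.integrable_sum integrable_mult_right int_partial)
    then show ?thesis by (simp add: expand[of k] sum_distrib_left mult.left_commute)
  qed
  have D: "k \<bullet> D = - (LINT x|lborel. f x * (k \<bullet> gradient \<psi> (x - y)))" for k
  proof -
    have "k \<bullet> D = - (\<Sum>b\<in>Basis. (LINT x|lborel. (k \<bullet> b) * (f x * (gradient \<psi> (x - y) \<bullet> b))))"
      by (simp add: D_def inner_sum_right conv_def mult.commute)
    also have "(\<Sum>b\<in>Basis. (LINT x|lborel. (k \<bullet> b) * (f x * (gradient \<psi> (x - y) \<bullet> b))))
        = (LINT x|lborel. (\<Sum>b\<in>Basis. (k \<bullet> b) * (f x * (gradient \<psi> (x - y) \<bullet> b))))"
      by (rule Bochner_Integration.integral_sum[symmetric]) (intro integrable_mult_right int_partial)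
    also have "\<dots> = (LINT x|lborel. f x * (k \<bullet> gradient \<psi> (x - y)))"
      by (simp add: expand[of k] sum_distrib_left mult.left_commute)
    finally show ?thesis .
  qed
  \<comment> \<open>The radius leaves room for increments k of norm at most 1: for x outside S both
    x - y and x - (y + k) avoid the support of \<psi>, so the Taylor remainder vanishes and only the
    integral of |f| over S enters.\<close>
  define S where "S = cball (0::'a) (norm y + R + 1)"
  define I where "I = (LINT x|lborel. \<bar>indicator S x *\<^sub>R f x\<bar>)"
  have int_S: "integrable lborel (\<lambda>x. indicator S x *\<^sub>R f x)"
    using f unfolding loc_integrable_def set_integrable_def S_def by auto
  have "I \<ge> 0" unfolding I_def by simp
  have key: "\<bar>conv f \<psi> (y + k) - conv f \<psi> y - k \<bullet> D\<bar> \<le> L * I * (norm k)\<^sup>2" if k: "norm k \<le> 1" for k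
  proof -
    have split: "f x * (\<psi> ((x - y) + - k) - \<psi> (x - y) - (- k) \<bullet> gradient \<psi> (x - y)) =
        f x * \<psi> (x - (y + k)) - f x * \<psi> (x - y) + f x * (k \<bullet> gradient \<psi> (x - y))" for x
    proof -
      have "(x - y) + - k = x - (y + k)" by simp
      show ?thesis unfolding \<open>(x - y) + - k = x - (y + k)\<close> inner_minus_left
        by (simp only: right_diff_distrib distrib_left diff_minus_eq_add)
    qed
    have eq: "conv f \<psi> (y + k) - conv f \<psi> y - k \<bullet> D =
       (LINT x|lborel. f x * (\<psi> ((x - y) + - k) - \<psi> (x - y) - (- k) \<bullet> gradient \<psi> (x - y)))"
      unfolding conv_def D split
        Bochner_Integration.integral_add[OF Bochner_Integration.integrable_diff[OF int int] int_k]
        Bochner_Integration.integral_diff[OF int int]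
      by (simp only: diff_minus_eq_add)
    have "\<bar>conv f \<psi> (y + k) - conv f \<psi> y - k \<bullet> D\<bar> \<le> (LINT x|lborel. \<bar>f x * (\<psi> ((x - y) + - k) - \<psi> (x - y) - (- k) \<bullet> gradient \<psi> (x - y))\<bar>)"
      unfolding eq by (rule integral_abs_bound)
    also have "\<dots> \<le> (LINT x|lborel. (L * (norm k)\<^sup>2) * \<bar>indicator S x *\<^sub>R f x\<bar>)"
    proof (rule integral_mono)
      show "integrable lborel (\<lambda>x. \<bar>f x * (\<psi> ((x - y) + - k) - \<psi> (x - y) - (- k) \<bullet> gradient \<psi> (x - y))\<bar>)"
        unfolding split
        by (intro integrable_abs Bochner_Integration.integrable_add Bochner_Integration.integrable_diff int int_k)
      show "integrable lborel (\<lambda>x. (L * (norm k)\<^sup>2) * \<bar>indicator S x *\<^sub>R f x\<bar>)"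
        using int_S by (intro integrable_mult_right integrable_abs)
      fix x
      show "\<bar>f x * (\<psi> ((x - y) + - k) - \<psi> (x - y) - (- k) \<bullet> gradient \<psi> (x - y))\<bar>
          \<le> (L * (norm k)\<^sup>2) * \<bar>indicator S x *\<^sub>R f x\<bar>"
      proof (cases "x \<in> S")
        case True
        then show ?thesis using mult_left_mono[OF L(2)[of "x - y" "- k"], of "\<bar>f x\<bar>"]
          by (simp only: abs_mult indicator_simps scaleR_one mult_ac norm_minus_cancel abs_ge_zero)
      next
        case False
        then have "norm y + R + 1 < norm x" unfolding S_def by simp
        then have "R < norm (x - y)" "R < norm (x - y + - k)"
          using k norm_triangle_ineq2[of x y] norm_triangle_ineq2[of "x - y" k] by auto
        then show ?thesis using R L(1) by simp
      qed
    qed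
    also have "\<dots> = L * I * (norm k)\<^sup>2" unfolding I_def by simp
    finally show ?thesis .
  qed
  show ?thesis
    unfolding gderiv_def has_derivative_at_alt D_def[symmetric]
  proof (intro conjI allI impI bounded_linear_inner_left)
    fix e :: real assume "e > 0"
    \<comment> \<open>The summand 1 keeps the denominator positive, as L * I may be 0.\<close>
    define d where "d = min 1 (e / (L * I + 1))"
    have "L * I \<ge> 0" using L \<open>I \<ge> 0\<close> by simp
    have "d > 0" unfolding d_def using \<open>e > 0\<close> \<open>L * I \<ge> 0\<close> by simp
    moreover have "norm (conv f \<psi> z - conv f \<psi> y - (z - y) \<bullet> D) \<le> e * norm (z - y)" if "norm (z - y) < d" for z
    proof -
      have "norm (conv f \<psi> z - conv f \<psi> y - (z - y) \<bullet> D) \<le> (L * I * norm (z - y)) * norm (z - y)"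
        using key[of "z - y"] that unfolding d_def by (simp add: power2_eq_square)
      moreover have "L * I * norm (z - y) \<le> e"
      proof -
        have "L * I * norm (z - y) \<le> (L * I + 1) * (e / (L * I + 1))"
          using that \<open>L * I \<ge> 0\<close> unfolding d_def by (intro mult_mono) auto
        then show ?thesis using \<open>L * I \<ge> 0\<close> by simp
      qed
      ultimately show ?thesis
        using mult_right_mono[of "L * I * norm (z - y)" e "norm (z - y)"] by (metis norm_ge_zero order_trans)
    qed
    ultimately show "\<exists>d>0. \<forall>z. norm (z - y) < d \<longrightarrow>
        norm (conv f \<psi> z - conv f \<psi> y - (z - y) \<bullet> D) \<le> e * norm (z - y)" by blast
  qed
qed

lemma gradient_conv:
  assumes "loc_integrable f" "\<psi> \<in> test_functions" "b \<in> Basis"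
  shows "gradient (conv f \<psi>) y \<bullet> b = - conv f (\<lambda>x. gradient \<psi> x \<bullet> b) y"
  unfolding GDERIV_gradient[OF conv_GDERIV[OF assms(1,2)]]
  using assms(3) by (simp add: inner_sum_left inner_Basis if_distrib cong: if_cong)

text \<open>All derivatives fall on the test function, so local integrability of f suffices. The
  induction moves on to partial derivatives of \<psi> and therefore needs \<psi> arbitrary.\<close>

lemma Ck_conv: "loc_integrable f \<Longrightarrow> \<psi> \<in> test_functions \<Longrightarrow> Ck k (conv f \<psi>)"
proof (induction k arbitrary: \<psi>)
  case (0 \<psi>)
  then show ?case
    using conv_GDERIV[OF 0, THEN GDERIV_continuous] by (auto simp: continuous_on_eq_continuous_at)
next
  case (Suc k \<psi>)
  have G: "GDERIV (conv f \<psi>) y :> gradient (conv f \<psi>) y" for y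
    using conv_GDERIV[OF Suc.prems] GDERIV_gradient by metis
  have "Ck k (\<lambda>x. (- 1) * conv f (\<lambda>x. gradient \<psi> x \<bullet> b) x)" if "b \<in> Basis" for b
    by (intro Ck_mult Ck_const Suc.IH Suc.prems test_partial that)
  then show ?case by (intro Ck_SucI[OF G]) (simp add: gradient_conv[OF Suc.prems])
qed

lemma conv_test:
  assumes "loc_integrable f" "\<psi> \<in> test_functions" "\<And>x. R < norm x \<Longrightarrow> f x = 0"
  shows "conv f \<psi> \<in> test_functions"
proof -
  obtain S where S: "\<And>x. S < norm x \<Longrightarrow> \<psi> x = 0" by (rule test_supportE[OF assms(2)]) (rule that)
  have "conv f \<psi> y = 0" if "R + S < norm y" for y
  proof -
    have "f x * \<psi> (x - y) = 0" for x
    proof (cases "R < norm x")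
      case False
      then have "S < norm (x - y)" using that norm_triangle_ineq2[of y x] by (simp add: norm_minus_commute)
      then show ?thesis using S by simp
    qed (use assms in simp)
    then have "(\<lambda>x. f x * \<psi> (x - y)) = (\<lambda>x. 0)" by blast
    then show ?thesis unfolding conv_def by simp
  qed
  then show ?thesis unfolding test_functions_iff using Ck_conv[OF assms(1,2)] by blast
qed

text \<open>Correlating \<psi> with the constant 1 gives a constant, by translation invariance. Its
  gradient is 0, and \<open>gradient_conv\<close> identifies the components of that gradient with
  minus the integrals in question.\<close>

lemma integral_partial_zero:
  assumes "\<psi> \<in> test_functions" "b \<in> Basis"
  shows "(LINT x|lborel. gradient \<psi> x \<bullet> b) = 0"
proof -
  have [measurable]: "\<psi> \<in> borel_measurable borel" using assms(1) by (rule test_measurable)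
  have "conv (\<lambda>_. 1) \<psi> = (\<lambda>y. LINT x|lborel. \<psi> x)"
  proof
    fix y show "conv (\<lambda>_. 1) \<psi> y = (LINT x|lborel. \<psi> x)"
      unfolding conv_def using integral_shift[of \<psi> "- y"] by simp
  qed
  then have "gradient (conv (\<lambda>_. 1) \<psi>) 0 = 0"
    by (simp only: GDERIV_gradient[OF GDERIV_const])
  then show ?thesis using gradient_conv[OF loc_integrable_one assms, of 0] by (simp add: conv_def)
qed

lemma test_mult_Ck:
  assumes "f \<in> test_functions" "\<And>k. Ck k g" shows "(\<lambda>x. f x * g x) \<in> test_functions"
  using assms unfolding test_functions_iff by (auto intro: Ck_mult)

text \<open>The product u v is a test function, so its partial derivatives integrate to 0.\<close>

lemma test_integration_by_parts:
  assumes u: "u \<in> test_functions" and v: "v \<in> test_functions" and b: "b \<in> Basis"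
  shows "(LINT x|lborel. u x * (gradient v x \<bullet> b)) = - (LINT x|lborel. (gradient u x \<bullet> b) * v x)"
proof -
  have vk: "\<And>k. Ck k v" using v unfolding test_functions_iff by blast
  have g: "gradient (\<lambda>x. u x * v x) x = u x *\<^sub>R gradient v x + v x *\<^sub>R gradient u x" for x
    by (intro GDERIV_gradient GDERIV_mult test_GDERIV u v)
  have "(LINT x|lborel. gradient (\<lambda>x. u x * v x) x \<bullet> b) = 0"
    by (rule integral_partial_zero[OF test_mult_Ck[OF u vk] b])
  moreover have "integrable lborel (\<lambda>x. u x * (gradient v x \<bullet> b))"
    by (intro integrable_mult_test loc_integrable_continuous test_continuous test_partial u v b)
  moreover have "integrable lborel (\<lambda>x. (gradient u x \<bullet> b) * v x)"
    by (intro integrable_mult_test loc_integrable_continuous test_continuous test_partial u v b)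
  ultimately show ?thesis by (simp add: g inner_add_left mult.commute)
qed

section \<open>Mollification\<close>

lemma nn_integral_abs_triangle:
  fixes f g h :: "'a \<Rightarrow> real"
  assumes [measurable]: "f \<in> borel_measurable M" "g \<in> borel_measurable M" "h \<in> borel_measurable M"
  shows "(\<integral>\<^sup>+x. ennreal \<bar>f x - h x\<bar> \<partial>M) \<le> (\<integral>\<^sup>+x. ennreal \<bar>f x - g x\<bar> \<partial>M) + (\<integral>\<^sup>+x. ennreal \<bar>g x - h x\<bar> \<partial>M)"
proof -
  have "(\<integral>\<^sup>+x. ennreal \<bar>f x - h x\<bar> \<partial>M) \<le> (\<integral>\<^sup>+x. ennreal \<bar>f x - g x\<bar> + ennreal \<bar>g x - h x\<bar> \<partial>M)"
    by (intro nn_integral_mono) (auto simp flip: ennreal_plus intro!: ennreal_leI)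
  then show ?thesis by (subst (asm) nn_integral_add) auto
qed

lemma nn_integral_dominated_zero:
  fixes u :: "nat \<Rightarrow> 'a \<Rightarrow> real" and w :: "'a \<Rightarrow> real"
  assumes "\<And>n. u n \<in> borel_measurable M" "integrable M w"
    "\<And>n x. x \<in> space M \<Longrightarrow> \<bar>u n x\<bar> \<le> w x" "AE x in M. (\<lambda>n. u n x) \<longlonglongrightarrow> 0"
  shows "(\<lambda>n. \<integral>\<^sup>+x. ennreal \<bar>u n x\<bar> \<partial>M) \<longlonglongrightarrow> 0"
proof -
  have "(\<lambda>n. \<integral>\<^sup>+x. ennreal \<bar>u n x\<bar> \<partial>M) \<longlonglongrightarrow> (\<integral>\<^sup>+x. 0 \<partial>M)"
  proof (rule nn_integral_dominated_convergence[where w = "\<lambda>x. ennreal (w x)"])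
    show "(\<integral>\<^sup>+x. ennreal (w x) \<partial>M) < \<infinity>"
      using integrableD(2)[OF assms(2)] by (simp add: less_top)
    show "AE x in M. (\<lambda>n. ennreal \<bar>u n x\<bar>) \<longlonglongrightarrow> 0"
      using assms(4)
    proof eventually_elim
      case (elim x)
      from tendsto_ennrealI[OF tendsto_rabs_zero[OF elim]] show ?case by simp
    qed
  qed (use assms in \<open>auto intro!: AE_I2 ennreal_leI\<close>)
  then show ?thesis by simp
qed

text \<open>Dominated convergence handles the points of U whose shift leaves U, because openness
  keeps the shift of a fixed point of U eventually inside. The points whose shift enters U have the
  same measure by translation invariance, so the symmetric difference is just twice as
  large.\<close>

lemma translation_open:
  fixes U :: "'a::euclidean_space set"
  assumes U: "open U" "emeasure lborel U < \<infinity>" and y: "y \<longlonglongrightarrow> 0"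
  shows "(\<lambda>n. \<integral>\<^sup>+x. ennreal \<bar>indicator U (x + y n) - indicator U x\<bar> \<partial>lborel) \<longlonglongrightarrow> 0"
proof -
  have [measurable]: "U \<in> sets borel" using U by simp
  have int: "integrable lborel (indicat_real U)" using U by (simp add: integrable_real_indicator)
  have int': "integrable lborel (\<lambda>x. indicat_real U (x + a))" for a by (rule integrable_shift[OF int])
  define v where "v n x = indicat_real U x - indicat_real U x * indicat_real U (x + y n)" for n x
  have v: "(\<lambda>n. LINT x|lborel. \<bar>v n x\<bar>) \<longlonglongrightarrow> (LINT x|lborel. (\<lambda>x. 0::real) (x::'a))"
  proof (rule integral_dominated_convergence[where w = "indicat_real U"])
    have "(\<lambda>n. \<bar>v n x\<bar>) \<longlonglongrightarrow> 0" for x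
    proof (cases "x \<in> U")
      case True
      have "(\<lambda>n. x + y n) \<longlonglongrightarrow> x" using tendsto_add[OF tendsto_const y, of x] by simp
      then have "\<forall>\<^sub>F n in sequentially. x + y n \<in> U" using U(1) True by (rule topological_tendstoD)
      then have "\<forall>\<^sub>F n in sequentially. \<bar>v n x\<bar> = 0"
        by eventually_elim (simp add: v_def True)
      then show ?thesis by (rule tendsto_eventually)
    qed (simp add: v_def)
    then show "AE x in lborel. (\<lambda>n. \<bar>v n x\<bar>) \<longlonglongrightarrow> 0" by simp
  qed (use int in \<open>auto simp: v_def indicator_def\<close>)
  have eq: "(\<integral>\<^sup>+x. ennreal \<bar>indicator U (x + y n) - indicator U x\<bar> \<partial>lborel) = ennreal (2 * (LINT x|lborel. \<bar>v n x\<bar>))" for n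
  proof -
    have intp: "integrable lborel (\<lambda>x. indicat_real U x * indicat_real U (x + y n))"
      by (rule Bochner_Integration.integrable_bound[OF int]) (auto simp: indicator_def)
    have "(\<integral>\<^sup>+x. ennreal \<bar>indicator U (x + y n) - indicator U x\<bar> \<partial>lborel)
        = ennreal (LINT x|lborel. \<bar>indicator U (x + y n) - indicator U x\<bar>)"
      using int int' by (intro nn_integral_eq_integral integrable_abs Bochner_Integration.integrable_diff) auto
    also have "(LINT x|lborel. \<bar>indicator U (x + y n) - indicator U x\<bar>)
        = (LINT x|lborel. indicat_real U (x + y n) + indicat_real U x - 2 * (indicat_real U x * indicat_real U (x + y n)))"
      by (intro Bochner_Integration.integral_cong) (auto simp: indicator_def)
    also have "\<dots> = 2 * (LINT x|lborel. \<bar>v n x\<bar>)"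
    proof -
      have "(LINT x|lborel. \<bar>v n x\<bar>) = (LINT x|lborel. v n x)"
        by (intro Bochner_Integration.integral_cong) (auto simp: indicator_def v_def)
      then show ?thesis
        using int int' intp integral_shift[of "indicat_real U" "y n"] by (simp add: v_def)
    qed
    finally show ?thesis .
  qed
  have "(\<lambda>n. ennreal (2 * (LINT x|lborel. \<bar>v n x\<bar>))) \<longlonglongrightarrow> ennreal (2 * 0)"
    using v by (intro tendsto_ennrealI tendsto_mult tendsto_const) simp
  then show ?thesis unfolding eq by simp
qed

text \<open>The translates of \<open>f\<close> and \<open>g\<close> are as close as \<open>f\<close> and \<open>g\<close>, so it suffices to approximate.\<close>

lemma translation_approx:
  fixes f g :: "'a::euclidean_space \<Rightarrow> real"
  assumes [measurable]: "f \<in> borel_measurable borel" "g \<in> borel_measurable borel"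
  shows "(\<integral>\<^sup>+x. ennreal \<bar>f (x + a) - f x\<bar> \<partial>lborel) \<le>
    (\<integral>\<^sup>+x. ennreal \<bar>g (x + a) - g x\<bar> \<partial>lborel) + 2 * (\<integral>\<^sup>+x. ennreal \<bar>f x - g x\<bar> \<partial>lborel)"
proof -
  have "(\<integral>\<^sup>+x. ennreal \<bar>f (x + a) - f x\<bar> \<partial>lborel) \<le>
      (\<integral>\<^sup>+x. ennreal \<bar>f (x + a) - g (x + a)\<bar> \<partial>lborel) + (\<integral>\<^sup>+x. ennreal \<bar>g (x + a) - f x\<bar> \<partial>lborel)"
    by (rule nn_integral_abs_triangle) auto
  also have "(\<integral>\<^sup>+x. ennreal \<bar>g (x + a) - f x\<bar> \<partial>lborel) \<le>
      (\<integral>\<^sup>+x. ennreal \<bar>g (x + a) - g x\<bar> \<partial>lborel) + (\<integral>\<^sup>+x. ennreal \<bar>g x - f x\<bar> \<partial>lborel)"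
    by (rule nn_integral_abs_triangle) auto
  also have "(\<integral>\<^sup>+x. ennreal \<bar>f (x + a) - g (x + a)\<bar> \<partial>lborel) = (\<integral>\<^sup>+x. ennreal \<bar>f x - g x\<bar> \<partial>lborel)"
    by (rule nn_integral_shift[of "\<lambda>x. ennreal \<bar>f x - g x\<bar>"]) simp
  finally show ?thesis by (simp add: abs_minus_commute[of "g _" "f _"] mult_2 add_ac add_left_mono)
qed

lemma tendsto_ennreal_zero_approx:
  fixes F :: "nat \<Rightarrow> ennreal"
  assumes "\<And>e. e > 0 \<Longrightarrow> \<exists>G. G \<longlonglongrightarrow> 0 \<and> (\<forall>n. F n \<le> G n + ennreal e)"
  shows "F \<longlonglongrightarrow> 0"
proof (rule order_tendstoI)
  fix c :: ennreal assume "0 < c"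
  then obtain e where e: "0 < e" "ennreal (2 * e) < c"
  proof (cases c)
    case (real r)
    then have "r > 0" using \<open>0 < c\<close> by simp
    then show ?thesis by (intro that[of "r / 4"]) (auto simp: real ennreal_less_iff)
  qed (auto intro: that[of 1])
  from assms[OF e(1)] obtain G where G: "G \<longlonglongrightarrow> 0" "\<And>n. F n \<le> G n + ennreal e" by blast
  have "\<forall>\<^sub>F n in sequentially. G n < ennreal e" using order_tendstoD(2)[OF G(1)] e(1) by simp
  then show "\<forall>\<^sub>F n in sequentially. F n < c"
  proof eventually_elim
    case (elim n)
    have "F n \<le> ennreal e + ennreal e" using G(2)[of n] elim by (meson add_right_mono less_imp_le order_trans)
    also have "\<dots> = ennreal (2 * e)" using e by (simp flip: ennreal_plus)
    finally show ?case using e(2) by simp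
  qed
qed simp

text \<open>Density argument along \<open>integrable_induct\<close>: an indicator is compared with
  that of a slightly larger open set, sums follow from the triangle inequality, and limits are
  limits in $L^1$ by domination. \<open>translation_approx\<close> transfers the convergence in the
  first and the last case.\<close>

lemma translation_L1:
  fixes f :: "'a::euclidean_space \<Rightarrow> real"
  assumes "integrable lborel f" "y \<longlonglongrightarrow> 0"
  shows "(\<lambda>n. \<integral>\<^sup>+x. ennreal \<bar>f (x + y n) - f x\<bar> \<partial>lborel) \<longlonglongrightarrow> 0"
  using assms(1)
proof (induction rule: integrable_induct)
  case (base A c)
  have [measurable]: "A \<in> sets borel" using base by simp
  have "(\<lambda>n. \<integral>\<^sup>+x. ennreal \<bar>indicat_real A (x + y n) - indicat_real A x\<bar> \<partial>lborel) \<longlonglongrightarrow> 0"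
  proof (rule tendsto_ennreal_zero_approx)
    fix e :: real assume "e > 0"
    then obtain U where U: "open U" "A \<subseteq> U" "emeasure lborel (U - A) < ennreal (e / 2)"
      using outer_regular_lborel[of A "e / 2"] base by (auto simp: ennreal_less_iff)
    have [measurable]: "U \<in> sets borel" using U by simp
    have "emeasure lborel U \<le> emeasure lborel A + emeasure lborel (U - A)"
      using emeasure_subadditive[of A lborel "U - A"] U(2) by (simp add: Un_absorb1)
    also have "\<dots> < \<infinity>" using U(3) base by (auto simp: less_top[symmetric])
    finally have "emeasure lborel U < \<infinity>" .
    note lim = translation_open[OF U(1) this assms(2)]
    have "(\<integral>\<^sup>+x. ennreal \<bar>indicat_real A x - indicat_real U x\<bar> \<partial>lborel) = (\<integral>\<^sup>+x. indicator (U - A) x \<partial>lborel)"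
      using U(2) by (intro nn_integral_cong) (auto simp: indicator_def)
    also have "\<dots> = emeasure lborel (U - A)" by simp
    finally have "2 * (\<integral>\<^sup>+x. ennreal \<bar>indicat_real A x - indicat_real U x\<bar> \<partial>lborel) \<le> 2 * ennreal (e / 2)"
      using U(3) by (intro mult_left_mono) auto
    also have "\<dots> = ennreal e" using ennreal_mult[of 2 "e / 2"] \<open>e > 0\<close> by simp
    finally have *: "2 * (\<integral>\<^sup>+x. ennreal \<bar>indicat_real A x - indicat_real U x\<bar> \<partial>lborel) \<le> ennreal e" .
    have "(\<integral>\<^sup>+x. ennreal \<bar>indicat_real A (x + y n) - indicat_real A x\<bar> \<partial>lborel) \<le>
        (\<integral>\<^sup>+x. ennreal \<bar>indicator U (x + y n) - indicator U x\<bar> \<partial>lborel) + ennreal e" for n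
      by (rule order_trans[OF translation_approx[of "indicat_real A" "indicat_real U"] add_left_mono[OF *]]) auto
    with lim show "\<exists>G. G \<longlonglongrightarrow> 0 \<and> (\<forall>n. (\<integral>\<^sup>+x. ennreal \<bar>indicat_real A (x + y n) - indicat_real A x\<bar> \<partial>lborel)
        \<le> G n + ennreal e)" by blast
  qed
  then have "(\<lambda>n. ennreal \<bar>c\<bar> * (\<integral>\<^sup>+x. ennreal \<bar>indicat_real A (x + y n) - indicat_real A x\<bar> \<partial>lborel)) \<longlonglongrightarrow> ennreal \<bar>c\<bar> * 0"
    by (intro ennreal_tendsto_cmult) simp
  moreover have "ennreal \<bar>c\<bar> * (\<integral>\<^sup>+x. ennreal \<bar>indicat_real A (x + y n) - indicat_real A x\<bar> \<partial>lborel)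
      = (\<integral>\<^sup>+x. ennreal \<bar>indicat_real A (x + y n) *\<^sub>R c - indicat_real A x *\<^sub>R c\<bar> \<partial>lborel)" for n
    by (subst nn_integral_cmult[symmetric])
      (auto intro!: nn_integral_cong simp: mult.commute[of _ c] right_diff_distrib simp flip: ennreal_mult abs_mult)
  ultimately show ?case by simp
next
  case (add f g)
  have [measurable]: "f \<in> borel_measurable borel" "g \<in> borel_measurable borel" using add by auto
  have "(\<lambda>n. (\<integral>\<^sup>+x. ennreal \<bar>f (x + y n) - f x\<bar> \<partial>lborel) + (\<integral>\<^sup>+x. ennreal \<bar>g (x + y n) - g x\<bar> \<partial>lborel)) \<longlonglongrightarrow> 0 + 0"
    using add by (intro tendsto_add)
  then have lim: "(\<lambda>n. (\<integral>\<^sup>+x. ennreal \<bar>f (x + y n) - f x\<bar> \<partial>lborel) + (\<integral>\<^sup>+x. ennreal \<bar>g (x + y n) - g x\<bar> \<partial>lborel)) \<longlonglongrightarrow> 0"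
    by simp
  show ?case
  proof (rule tendsto_sandwich[OF _ _ tendsto_const lim])
    have "(\<integral>\<^sup>+x. ennreal \<bar>f (x + y n) + g (x + y n) - (f x + g x)\<bar> \<partial>lborel) \<le>
       (\<integral>\<^sup>+x. ennreal \<bar>f (x + y n) - f x\<bar> + ennreal \<bar>g (x + y n) - g x\<bar> \<partial>lborel)" for n
      by (intro nn_integral_mono) (auto simp flip: ennreal_plus intro!: ennreal_leI)
    then show "\<forall>\<^sub>F n in sequentially. (\<integral>\<^sup>+x. ennreal \<bar>f (x + y n) + g (x + y n) - (f x + g x)\<bar> \<partial>lborel) \<le>
       (\<integral>\<^sup>+x. ennreal \<bar>f (x + y n) - f x\<bar> \<partial>lborel) + (\<integral>\<^sup>+x. ennreal \<bar>g (x + y n) - g x\<bar> \<partial>lborel)"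
      by (subst (asm) nn_integral_add) auto
  qed auto
next
  case (lim f s)
  have [measurable]: "f \<in> borel_measurable borel" "\<And>i. s i \<in> borel_measurable borel" using lim by auto
  have conv: "(\<lambda>i. \<integral>\<^sup>+x. ennreal \<bar>f x - s i x\<bar> \<partial>lborel) \<longlonglongrightarrow> 0"
  \<comment> \<open>\<open>integrable_induct\<close> supplies approximants bounded by twice |f|,
    hence the factor 3.\<close>
  proof (rule nn_integral_dominated_zero[where w = "\<lambda>x. 3 * \<bar>f x\<bar>"])
    show "\<bar>f x - s i x\<bar> \<le> 3 * \<bar>f x\<bar>" if "x \<in> space lborel" for i x using lim.hyps(3)[OF that, of i] by simp
    show "AE x in lborel. (\<lambda>i. f x - s i x) \<longlonglongrightarrow> 0"
    proof (rule AE_I2)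
      fix x :: 'a assume "x \<in> space lborel"
      from tendsto_diff[OF tendsto_const lim.hyps(2)[OF this], of "f x"]
      show "(\<lambda>i. f x - s i x) \<longlonglongrightarrow> 0" by simp
    qed
  qed (use lim in \<open>auto intro!: integrable_mult_right integrable_abs\<close>)
  show ?case
  proof (rule tendsto_ennreal_zero_approx)
    fix e :: real assume "e > 0"
    then have "\<forall>\<^sub>F i in sequentially. (\<integral>\<^sup>+x. ennreal \<bar>f x - s i x\<bar> \<partial>lborel) < ennreal (e / 2)"
      by (intro order_tendstoD(2)[OF conv]) simp
    then obtain i where i: "(\<integral>\<^sup>+x. ennreal \<bar>f x - s i x\<bar> \<partial>lborel) < ennreal (e / 2)"
      by (auto simp: eventually_sequentially)
    then have "2 * (\<integral>\<^sup>+x. ennreal \<bar>f x - s i x\<bar> \<partial>lborel) \<le> 2 * ennreal (e / 2)"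
      by (intro mult_left_mono) auto
    also have "\<dots> = ennreal e" using ennreal_mult[of 2 "e / 2"] \<open>e > 0\<close> by simp
    finally have *: "2 * (\<integral>\<^sup>+x. ennreal \<bar>f x - s i x\<bar> \<partial>lborel) \<le> ennreal e" .
    have "(\<integral>\<^sup>+x. ennreal \<bar>f (x + y n) - f x\<bar> \<partial>lborel) \<le>
        (\<integral>\<^sup>+x. ennreal \<bar>s i (x + y n) - s i x\<bar> \<partial>lborel) + ennreal e" for n
      by (rule order_trans[OF translation_approx[of f "s i"] add_left_mono[OF *]]) auto
    with lim.IH[of i] show "\<exists>G. G \<longlonglongrightarrow> 0 \<and> (\<forall>n. (\<integral>\<^sup>+x. ennreal \<bar>f (x + y n) - f x\<bar> \<partial>lborel)
        \<le> G n + ennreal e)" by blast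
  qed
qed

text \<open>\<open>conv_L1\<close> averages over all small shifts at once and so needs a modulus
  rather than sequences. If there were none, shifts tending to 0 would contradict
  \<open>translation_L1\<close>.\<close>

lemma translation_L1_uniform:
  fixes f :: "'a::euclidean_space \<Rightarrow> real"
  assumes "integrable lborel f" "e > 0"
  obtains d where "d > 0" "\<And>a. norm a < d \<Longrightarrow> (\<integral>\<^sup>+x. ennreal \<bar>f (x + a) - f x\<bar> \<partial>lborel) \<le> ennreal e"
proof -
  have "\<exists>d>0. \<forall>a. norm a < d \<longrightarrow> (\<integral>\<^sup>+x. ennreal \<bar>f (x + a) - f x\<bar> \<partial>lborel) \<le> ennreal e"
  proof (rule ccontr)
    assume "\<not> ?thesis"
    then have "\<forall>n. \<exists>a. norm a < inverse (real (Suc n)) \<and> \<not> (\<integral>\<^sup>+x. ennreal \<bar>f (x + a) - f x\<bar> \<partial>lborel) \<le> ennreal e"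
      by (metis inverse_positive_iff_positive of_nat_0_less_iff zero_less_Suc)
    then obtain a where a: "\<And>n. norm (a n) < inverse (real (Suc n))"
      "\<And>n. ennreal e < (\<integral>\<^sup>+x. ennreal \<bar>f (x + a n) - f x\<bar> \<partial>lborel)"
      by (metis not_le)
    have "a \<longlonglongrightarrow> 0"
      by (rule Lim_null_comparison[OF _ LIMSEQ_inverse_real_of_nat]) (use a(1) in \<open>auto intro!: always_eventually less_imp_le\<close>)
    from order_tendstoD(2)[OF translation_L1[OF assms(1) this], of "ennreal e"] assms(2)
    obtain n where "(\<integral>\<^sup>+x. ennreal \<bar>f (x + a n) - f x\<bar> \<partial>lborel) < ennreal e"
      unfolding eventually_sequentially by auto
    then show False using a(2)[of n] by (meson less_asym)
  qed
  then show ?thesis using that by blast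
qed

section \<open>Mollifiers and the fundamental lemma of the calculus of variations\<close>

definition mollifier :: "nat \<Rightarrow> 'a::euclidean_space \<Rightarrow> real" where
  "mollifier n x = inverse (LINT z|lborel. bump (inverse (real (Suc n))) (z::'a)) * bump (inverse (real (Suc n))) x"

lemma mollifier_test: "mollifier n \<in> test_functions"
  unfolding mollifier_def[abs_def] by (intro test_cmult bump_test)

lemma mollifier_nonneg: "0 \<le> mollifier n x"
  unfolding mollifier_def by (auto intro!: mult_nonneg_nonneg Bochner_Integration.integral_nonneg bump_nonneg)

lemma mollifier_zero: "inverse (real (Suc n)) \<le> norm x \<Longrightarrow> mollifier n x = 0"
  unfolding mollifier_def by (simp add: bump_zero)

lemma integral_bump_pos:
  assumes "r > 0" shows "(LINT z|lborel. bump r (z::'a::euclidean_space)) > 0"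
proof (rule ccontr)
  assume "\<not> ?thesis"
  moreover have "0 \<le> (LINT z|lborel. bump r (z::'a))"
    by (rule Bochner_Integration.integral_nonneg) (rule bump_nonneg)
  ultimately have "(LINT z|lborel. bump r (z::'a)) = 0" by linarith
  then have "AE z::'a in lborel. bump r z = 0"
    using integral_nonneg_eq_0_iff_AE[OF integrable_test[OF bump_test[of r]]] bump_nonneg[of r] by auto
  then have "AE z::'a in lborel. z \<notin> ball 0 r"
    by eventually_elim (use bump_pos[of _ r] in force)
  then have "emeasure lborel (ball (0::'a) r) = 0"
    by (subst (asm) AE_iff_measurable[OF _ refl]) (auto simp: ball_def)
  then show False using emeasure_ball[of r "0::'a"] assms unit_ball_vol_pos[of "real DIM('a)"] by simp
qed

lemma mollifier_integral: "(LINT z|lborel. mollifier n (z::'a::euclidean_space)) = 1"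
  unfolding mollifier_def using integral_bump_pos[of "inverse (real (Suc n))", where 'a = 'a] by simp

lemma mollifier_nn_integral: "(\<integral>\<^sup>+z. ennreal (mollifier n (z::'a::euclidean_space)) \<partial>lborel) = 1"
  unfolding nn_integral_eq_integral[OF integrable_test[OF mollifier_test] AE_I2[OF mollifier_nonneg]]
  by (simp add: mollifier_integral)

lemma conv_shift: 
  assumes "loc_integrable f" "\<psi> \<in> test_functions"
  shows "conv f \<psi> y = (LINT z|lborel. f (z + y) * \<psi> z)"
proof -
  have [measurable]: "f \<in> borel_measurable borel" "\<psi> \<in> borel_measurable borel"
    using assms by (auto intro: loc_integrable_measurable test_measurable)
  show ?thesis unfolding conv_def
    using integral_shift[of "\<lambda>x. f x * \<psi> (x - y)" y] by simp
qed

text \<open>The error is the average of f(. + z) - f against the mollifier. By Tonelli its $L^1$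
  norm is at most the largest $L^1$ norm of these differences over z in the support of the
  mollifier.\<close>

lemma conv_L1:
  fixes f :: "'a::euclidean_space \<Rightarrow> real"
  assumes f: "integrable lborel f"
  shows "(\<lambda>n. \<integral>\<^sup>+y. ennreal \<bar>conv f (mollifier n) y - f y\<bar> \<partial>lborel) \<longlonglongrightarrow> 0"
proof (rule tendsto_ennreal_zero_approx)
  fix e :: real assume "e > 0"
  obtain d where d: "d > 0" "\<And>a. norm a < d \<Longrightarrow> (\<integral>\<^sup>+x. ennreal \<bar>f (x + a) - f x\<bar> \<partial>lborel) \<le> ennreal e"
    by (rule translation_L1_uniform[OF f \<open>e > 0\<close>]) (rule that)
  have lf: "loc_integrable f" by (rule loc_integrable_integrable[OF f])
  have [measurable]: "f \<in> borel_measurable borel" "\<And>n. mollifier n \<in> borel_measurable (borel::'a measure)"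
    using f by (auto intro: test_measurable mollifier_test)
  define G where "G n = (\<integral>\<^sup>+y. ennreal \<bar>conv f (mollifier n) y - f y\<bar> \<partial>lborel)" for n
  have le: "G n \<le> ennreal e" if n: "inverse (real (Suc n)) < d" for n
  proof -
    have pt: "ennreal \<bar>conv f (mollifier n) y - f y\<bar> \<le> (\<integral>\<^sup>+z. ennreal \<bar>f (z + y) - f y\<bar> * ennreal (mollifier n z) \<partial>lborel)" for y
    proof -
      have i1: "integrable lborel (\<lambda>z. f (z + y) * mollifier n z)"
        by (intro integrable_mult_test mollifier_test loc_integrable_integrable integrable_shift f)
      have i2: "integrable lborel (\<lambda>z. f y * mollifier n z)"
        by (intro integrable_mult_right integrable_test mollifier_test)
      have eq: "conv f (mollifier n) y - f y = (LINT z|lborel. f (z + y) * mollifier n z - f y * mollifier n z)"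
        by (simp add: Bochner_Integration.integral_diff[OF i1 i2] conv_shift[OF lf mollifier_test] mollifier_integral)
      have "ennreal \<bar>conv f (mollifier n) y - f y\<bar> \<le> (\<integral>\<^sup>+z. ennreal (norm (f (z + y) * mollifier n z - f y * mollifier n z)) \<partial>lborel)"
        unfolding eq unfolding real_norm_def[symmetric]
        by (rule integral_norm_bound_ennreal) (intro Bochner_Integration.integrable_diff i1 i2)
      also have "\<dots> = (\<integral>\<^sup>+z. ennreal \<bar>f (z + y) - f y\<bar> * ennreal (mollifier n z) \<partial>lborel)"
        by (intro nn_integral_cong)
          (simp add: mollifier_nonneg abs_mult flip: ennreal_mult left_diff_distrib)
      finally show ?thesis .
    qed
    have "G n \<le> (\<integral>\<^sup>+y. \<integral>\<^sup>+z. ennreal \<bar>f (z + y) - f y\<bar> * ennreal (mollifier n z) \<partial>lborel \<partial>lborel)"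
      unfolding G_def by (intro nn_integral_mono pt)
    also have "\<dots> = (\<integral>\<^sup>+z. \<integral>\<^sup>+y. ennreal \<bar>f (z + y) - f y\<bar> * ennreal (mollifier n z) \<partial>lborel \<partial>lborel)"
      by (rule lborel_pair.Fubini') measurable
    also have "\<dots> \<le> (\<integral>\<^sup>+z. ennreal e * ennreal (mollifier n (z::'a)) \<partial>lborel)"
    proof (rule nn_integral_mono)
      fix z :: 'a
      show "(\<integral>\<^sup>+y. ennreal \<bar>f (z + y) - f y\<bar> * ennreal (mollifier n z) \<partial>lborel) \<le> ennreal e * ennreal (mollifier n z)"
      proof (cases "norm z < d")
        case True
        then show ?thesis using d(2)[of z]
          by (subst nn_integral_multc) (auto intro!: mult_right_mono simp: add.commute)
      next
        case False
        then have "mollifier n z = 0" using n by (intro mollifier_zero) simp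
        then show ?thesis by simp
      qed
    qed
    also have "\<dots> = ennreal e" by (subst nn_integral_cmult) (auto simp: mollifier_nn_integral)
    finally show ?thesis .
  qed
  obtain N where N: "\<And>n. n \<ge> N \<Longrightarrow> inverse (real (Suc n)) < d"
    using order_tendstoD(2)[OF LIMSEQ_inverse_real_of_nat d(1)] unfolding eventually_sequentially by blast
  \<comment> \<open>The estimate holds from N on. The finitely many earlier terms are stored in a
    sequence tending to 0, since \<open>tendsto_ennreal_zero_approx\<close> wants a bound for every
    n.\<close>
  let ?H = "\<lambda>n. if n < N then G n else 0"
  have "?H \<longlonglongrightarrow> 0" by (rule tendsto_eventually) (use eventually_ge_at_top[of N] in \<open>eventually_elim, auto\<close>)
  moreover have "G n \<le> ?H n + ennreal e" for n using le N by auto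
  ultimately show "\<exists>H. H \<longlonglongrightarrow> 0 \<and> (\<forall>n. (\<integral>\<^sup>+y. ennreal \<bar>conv f (mollifier n) y - f y\<bar> \<partial>lborel) \<le> H n + ennreal e)"
    unfolding G_def by blast
qed

text \<open>All mollifications of f vanish, being integrals against shifted test functions. To make
  \<open>conv_L1\<close> applicable, f is cut off outside the ball of radius R + 1: for |y| <= R the
  mollifiers, supported in the unit ball, do not see the cut.\<close>

lemma fundamental_lemma:
  fixes f :: "'a::euclidean_space \<Rightarrow> real"
  assumes f: "loc_integrable f" and zero: "\<And>\<psi>. \<psi> \<in> test_functions \<Longrightarrow> (LINT x|lborel. f x * \<psi> x) = 0"
  shows "AE x in lborel. f x = 0"
proof -
  have [measurable]: "f \<in> borel_measurable borel" using f by (rule loc_integrable_measurable)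
  have "AE x in lborel. x \<in> cball 0 (real R) \<longrightarrow> f x = 0" for R :: nat
  proof -
    define F where "F x = indicator (cball 0 (real R + 1)) x * f x" for x
    have F: "integrable lborel F"
      using f unfolding loc_integrable_def set_integrable_def F_def[abs_def] by auto
    have [measurable]: "F \<in> borel_measurable borel" unfolding F_def[abs_def]
      by (intro borel_measurable_times borel_measurable_indicator) simp_all
    have conv0: "conv F (mollifier n) y = 0" if y: "norm y \<le> real R" for y n
    proof -
      have "F x * mollifier n (x - y) = f x * mollifier n (x - y)" for x
      proof (cases "norm x \<le> real R + 1")
        case False
        then have "1 \<le> norm (x - y)" using y norm_triangle_ineq2[of x y] by simp
        moreover have "inverse (real (Suc n)) \<le> 1" by (simp add: inverse_le_1_iff)
        ultimately have "mollifier n (x - y) = 0" by (intro mollifier_zero) linarith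
        then show ?thesis by simp
      qed (simp add: F_def)
      then have "(\<lambda>x. F x * mollifier n (x - y)) = (\<lambda>x. f x * mollifier n (x - y))" by blast
      then show ?thesis unfolding conv_def by (simp only: zero[OF test_shift[OF mollifier_test]])
    qed
    have [measurable]: "cball (0::'a) (real R) \<in> sets borel" by simp
    have "(\<integral>\<^sup>+y. ennreal \<bar>f y\<bar> * indicator (cball 0 (real R)) y \<partial>lborel)
        \<le> (\<integral>\<^sup>+y. ennreal \<bar>conv F (mollifier n) y - F y\<bar> \<partial>lborel)" for n
      by (intro nn_integral_mono) (auto simp: indicator_def conv0 F_def)
    then have "(\<integral>\<^sup>+y. ennreal \<bar>f y\<bar> * indicator (cball 0 (real R)) y \<partial>lborel) \<le> 0"
      by (intro LIMSEQ_le_const[OF conv_L1[OF F]]) auto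
    then have "AE y in lborel. ennreal \<bar>f y\<bar> * indicator (cball 0 (real R)) y = 0"
      by (subst (asm) le_zero_eq, subst (asm) nn_integral_0_iff_AE) auto
    then show ?thesis by eventually_elim (auto simp: indicator_def split: if_splits)
  qed
  then have "AE x in lborel. \<forall>R::nat. x \<in> cball 0 (real R) \<longrightarrow> f x = 0"
    unfolding AE_all_countable by blast
  then show ?thesis
  proof eventually_elim
    case (elim x)
    obtain R :: nat where "norm x \<le> real R" using real_arch_simple by blast
    then show ?case using elim by auto
  qed
qed

section \<open>Weak gradients\<close>

text \<open>Squared $L^2$ distance of vector fields. With values in \<open>ennreal\<close> it can be
  manipulated before square integrability is known.\<close>

definition sqdist :: "('a::euclidean_space \<Rightarrow> 'b::euclidean_space) \<Rightarrow> ('a \<Rightarrow> 'b) \<Rightarrow> ennreal" where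
  "sqdist f g = (\<integral>\<^sup>+x. ennreal ((norm (f x - g x))\<^sup>2) \<partial>lborel)"

lemma ennreal_pos_approx:
  assumes "(0::ennreal) < c" obtains e where "0 < e" "ennreal e < c"
proof (cases c)
  case (real r)
  then have "r > 0" using assms by simp
  then show ?thesis by (intro that[of "r / 2"]) (auto simp: real ennreal_less_iff)
qed (auto intro: that[of 1])

lemma norm_sq_triangle: "(norm (a + b :: 'a::real_normed_vector))\<^sup>2 \<le> 2 * (norm a)\<^sup>2 + 2 * (norm b)\<^sup>2"
proof -
  have "(norm (a + b))\<^sup>2 \<le> (norm a + norm b)\<^sup>2"
    by (intro power_mono norm_triangle_ineq) simp
  also have "\<dots> \<le> 2 * (norm a)\<^sup>2 + 2 * (norm b)\<^sup>2"
    using zero_le_power2[of "norm a - norm b"] by (simp add: power2_sum power2_diff)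
  finally show ?thesis .
qed

text \<open>Working with squares costs a factor 2 in the triangle inequality, which is harmless for
  convergence to 0 and for finiteness.\<close>

lemma sqdist_triangle:
  fixes f g h :: "'a::euclidean_space \<Rightarrow> 'b::euclidean_space"
  assumes [measurable]: "f \<in> borel_measurable borel" "g \<in> borel_measurable borel" "h \<in> borel_measurable borel"
  shows "sqdist f h \<le> 2 * sqdist f g + 2 * sqdist g h"
proof -
  have "sqdist f h \<le> (\<integral>\<^sup>+x. 2 * ennreal ((norm (f x - g x))\<^sup>2) + 2 * ennreal ((norm (g x - h x))\<^sup>2) \<partial>lborel)"
    unfolding sqdist_def
  proof (rule nn_integral_mono)
    fix x
    have "ennreal ((norm (f x - h x))\<^sup>2) \<le> ennreal (2 * (norm (f x - g x))\<^sup>2 + 2 * (norm (g x - h x))\<^sup>2)"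
      using norm_sq_triangle[of "f x - g x" "g x - h x"] by (intro ennreal_leI) simp
    then show "ennreal ((norm (f x - h x))\<^sup>2) \<le> 2 * ennreal ((norm (f x - g x))\<^sup>2) + 2 * ennreal ((norm (g x - h x))\<^sup>2)"
      by (simp add: ennreal_mult)
  qed
  also have "\<dots> = 2 * sqdist f g + 2 * sqdist g h"
    unfolding sqdist_def by (subst nn_integral_add) (auto simp: nn_integral_cmult)
  finally show ?thesis .
qed

lemma sqdist_commute: "sqdist f g = sqdist g f"
  unfolding sqdist_def by (simp add: norm_minus_commute)

lemma sqdist_cong: "AE x in lborel. f x = f' x \<Longrightarrow> AE x in lborel. g x = g' x \<Longrightarrow> sqdist f g = sqdist f' g'"
  unfolding sqdist_def by (intro nn_integral_cong_AE) auto

lemma sqdist_lincomb: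
  fixes f g h k :: "'a::euclidean_space \<Rightarrow> 'b::euclidean_space"
  assumes [measurable]: "f \<in> borel_measurable borel" "g \<in> borel_measurable borel"
    "h \<in> borel_measurable borel" "k \<in> borel_measurable borel"
  shows "sqdist (\<lambda>x. a *\<^sub>R f x + b *\<^sub>R g x) (\<lambda>x. a *\<^sub>R h x + b *\<^sub>R k x) \<le>
    ennreal (2 * a\<^sup>2) * sqdist f h + ennreal (2 * b\<^sup>2) * sqdist g k"
proof -
  have "sqdist (\<lambda>x. a *\<^sub>R f x + b *\<^sub>R g x) (\<lambda>x. a *\<^sub>R h x + b *\<^sub>R k x) \<le>
      (\<integral>\<^sup>+x. ennreal (2 * a\<^sup>2) * ennreal ((norm (f x - h x))\<^sup>2) + ennreal (2 * b\<^sup>2) * ennreal ((norm (g x - k x))\<^sup>2) \<partial>lborel)"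
    unfolding sqdist_def
  proof (rule nn_integral_mono)
    fix x
    have "a *\<^sub>R f x + b *\<^sub>R g x - (a *\<^sub>R h x + b *\<^sub>R k x) = a *\<^sub>R (f x - h x) + b *\<^sub>R (g x - k x)"
      by (simp add: algebra_simps)
    then have "(norm (a *\<^sub>R f x + b *\<^sub>R g x - (a *\<^sub>R h x + b *\<^sub>R k x)))\<^sup>2 \<le>
        2 * a\<^sup>2 * (norm (f x - h x))\<^sup>2 + 2 * b\<^sup>2 * (norm (g x - k x))\<^sup>2"
      using norm_sq_triangle[of "a *\<^sub>R (f x - h x)" "b *\<^sub>R (g x - k x)"] by (simp add: power_mult_distrib)
    then show "ennreal ((norm (a *\<^sub>R f x + b *\<^sub>R g x - (a *\<^sub>R h x + b *\<^sub>R k x)))\<^sup>2) \<le>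
        ennreal (2 * a\<^sup>2) * ennreal ((norm (f x - h x))\<^sup>2) + ennreal (2 * b\<^sup>2) * ennreal ((norm (g x - k x))\<^sup>2)"
      by (simp flip: ennreal_mult ennreal_plus add: ennreal_leI)
  qed
  also have "\<dots> = ennreal (2 * a\<^sup>2) * sqdist f h + ennreal (2 * b\<^sup>2) * sqdist g k"
    unfolding sqdist_def by (subst nn_integral_add) (auto simp: nn_integral_cmult)
  finally show ?thesis .
qed

text \<open>A subsequence whose successive distances decay like \<open>8\<^sup>-\<^sup>k\<close> converges almost everywhere, because
  \<open>\<Sum> 4\<^sup>k |G\<^sub>k\<^sub>+\<^sub>1 - G\<^sub>k|\<^sup>2\<close> has a finite integral.\<close>

lemma sqdist_complete:
  fixes G :: "nat \<Rightarrow> 'a::euclidean_space \<Rightarrow> 'b::euclidean_space"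
  assumes meas [measurable]: "\<And>n. G n \<in> borel_measurable borel"
    and cauchy: "\<And>e. e > 0 \<Longrightarrow> \<exists>M. \<forall>m\<ge>M. \<forall>n\<ge>M. sqdist (G m) (G n) < ennreal e"
  obtains g r where "g \<in> borel_measurable borel" "strict_mono r"
    "AE x in lborel. (\<lambda>n. G (r n) x) \<longlonglongrightarrow> g x" "(\<lambda>n. sqdist (G n) g) \<longlonglongrightarrow> 0"
proof -
  have "\<exists>M. \<forall>m\<ge>M. \<forall>n\<ge>M. sqdist (G m) (G n) < ennreal ((1/8)^k)" for k
    by (rule cauchy) simp
  then obtain M where M: "\<And>k m n. m \<ge> M k \<Longrightarrow> n \<ge> M k \<Longrightarrow> sqdist (G m) (G n) < ennreal ((1/8)^k)"
    by metis
  \<comment> \<open>The maximum makes r strictly increasing and keeps \<open>r k\<close> at or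
    beyond \<open>M k\<close>, so consecutive terms are within \<open>(1/8)^k\<close>.\<close>
  define r where "r = rec_nat (M 0) (\<lambda>k q. max (M (Suc k)) (Suc q))"
  have r_Suc: "r (Suc k) = max (M (Suc k)) (Suc (r k))" for k by (simp add: r_def)
  have r_M: "r k \<ge> M k" for k by (cases k) (simp_all add: r_def)
  have mono: "strict_mono r" unfolding strict_mono_Suc_iff by (simp add: r_Suc less_max_iff_disj)
  have step: "sqdist (G (r (Suc k))) (G (r k)) < ennreal ((1/8)^k)" for k
    using r_M[of k] strict_monoD[OF mono, of k "Suc k"] by (intro M) auto
  define d where "d k x = G (r (Suc k)) x - G (r k) x" for k x
  have [measurable]: "d k \<in> borel_measurable borel" for k unfolding d_def[abs_def] by measurable
  have "(\<integral>\<^sup>+x. (\<Sum>k. ennreal (4^k * (norm (d k x))\<^sup>2)) \<partial>lborel) = (\<Sum>k. \<integral>\<^sup>+x. ennreal (4^k * (norm (d k x))\<^sup>2) \<partial>lborel)"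
    by (rule nn_integral_suminf) simp
  also have "\<dots> \<le> (\<Sum>k. ennreal ((1/2)^k))"
  proof (rule suminf_le)
    fix k
    have "(\<integral>\<^sup>+x. ennreal (4^k * (norm (d k x))\<^sup>2) \<partial>lborel) = ennreal (4^k) * sqdist (G (r (Suc k))) (G (r k))"
      unfolding sqdist_def by (subst nn_integral_cmult[symmetric]) (auto simp: d_def ennreal_mult)
    also have "\<dots> \<le> ennreal (4^k) * ennreal ((1/8)^k)" using step[of k] by (intro mult_left_mono) auto
    also have "\<dots> = ennreal ((1/2)^k)" by (simp flip: ennreal_mult add: power_mult_distrib[symmetric])
    finally show "(\<integral>\<^sup>+x. ennreal (4^k * (norm (d k x))\<^sup>2) \<partial>lborel) \<le> ennreal ((1/2)^k)" .
  qed simp_all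
  also have "\<dots> < \<infinity>"
  proof -
    have "(\<Sum>k. ennreal ((1/2)^k)) \<noteq> top"
      by (rule ennreal_suminf_neq_top) (auto intro: summable_geometric)
    then show ?thesis by (simp only: top.not_eq_extremum infinity_ennreal_def)
  qed
  finally have fin: "(\<integral>\<^sup>+x. (\<Sum>k. ennreal (4^k * (norm (d k x))\<^sup>2)) \<partial>lborel) < \<infinity>" .
  have "AE x in lborel. (\<Sum>k. ennreal (4^k * (norm (d k x))\<^sup>2)) \<noteq> \<infinity>"
    by (rule nn_integral_PInf_AE[OF _ less_imp_neq[OF fin]]) measurable
  then have conv: "AE x in lborel. convergent (\<lambda>n. G (r n) x)"
  proof eventually_elim
    case (elim x)
    define C where "C = enn2real (\<Sum>k. ennreal (4^k * (norm (d k x))\<^sup>2))"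
    have C: "(\<Sum>k. ennreal (4^k * (norm (d k x))\<^sup>2)) = ennreal C" "C \<ge> 0"
      unfolding C_def using elim by (simp_all add: ennreal_enn2real_if)
    \<comment> \<open>A single summand is at most the finite total C; taking the root turns this
      into geometric decay of the increments.\<close>
    have bound: "norm (d k x) \<le> sqrt C * (1/2)^k" for k
    proof -
      have "ennreal (4^k * (norm (d k x))\<^sup>2) \<le> (\<Sum>k. ennreal (4^k * (norm (d k x))\<^sup>2))"
        using ennreal_suminf_lessD[of "\<lambda>k. ennreal (4^k * (norm (d k x))\<^sup>2)" "ennreal (4^k * (norm (d k x))\<^sup>2)" k]
        by (meson less_irrefl not_le)
      then have "4^k * (norm (d k x))\<^sup>2 \<le> C" unfolding C(1) ennreal_le_iff[OF C(2)] .
      moreover have "4^k * (norm (d k x))\<^sup>2 = (2^k * norm (d k x))\<^sup>2"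
      proof -
        have "(4::real)^k = (2^k)\<^sup>2" by (simp add: power2_eq_square flip: power_mult_distrib)
        then show ?thesis by (simp only: power_mult_distrib)
      qed
      ultimately have "2^k * norm (d k x) \<le> sqrt C" by (intro real_le_rsqrt) simp
      then show ?thesis by (simp add: field_simps)
    qed
    have "summable (\<lambda>k. sqrt C * (1/2)^k)" by (intro summable_mult summable_geometric) simp
    then have "summable (\<lambda>k. d k x)" by (rule summable_comparison_test'[where N = 0]) (rule bound)
    then have "convergent (\<lambda>n. \<Sum>k<n. d k x)" unfolding summable_iff_convergent .
    then have "convergent (\<lambda>n. G (r n) x - G (r 0) x)"
      unfolding d_def sum_lessThan_telescope[of "\<lambda>k. G (r k) x"] .
    then have "convergent (\<lambda>n. (G (r n) x - G (r 0) x) + G (r 0) x)" by (intro convergent_add convergent_const)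
    then show ?case by simp
  qed
  define g where "g x = lim (\<lambda>n. G (r n) x)" for x
  have g_meas [measurable]: "g \<in> borel_measurable borel" unfolding g_def[abs_def] by measurable
  have ae: "AE x in lborel. (\<lambda>n. G (r n) x) \<longlonglongrightarrow> g x"
    using conv by eventually_elim (simp add: g_def convergent_LIMSEQ_iff)
  \<comment> \<open>Fatou's lemma along the subsequence bounds the distance of any late
    \<open>G n\<close> to the limit, so the whole sequence converges and not just the
    subsequence.\<close>
  have le: "sqdist (G n) g \<le> ennreal ((1/8)^k)" if n: "n \<ge> M k" for n k
  proof -
    have "sqdist (G n) g = (\<integral>\<^sup>+x. liminf (\<lambda>j. ennreal ((norm (G n x - G (r j) x))\<^sup>2)) \<partial>lborel)"
      unfolding sqdist_def
    proof (rule nn_integral_cong_AE)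
      show "AE x in lborel. ennreal ((norm (G n x - g x))\<^sup>2) = liminf (\<lambda>j. ennreal ((norm (G n x - G (r j) x))\<^sup>2))"
        using ae
      proof eventually_elim
        case (elim x)
        have "(\<lambda>j. ennreal ((norm (G n x - G (r j) x))\<^sup>2)) \<longlonglongrightarrow> ennreal ((norm (G n x - g x))\<^sup>2)"
          by (intro tendsto_intros elim)
        from lim_imp_Liminf[OF trivial_limit_sequentially this] show ?case by (rule sym)
      qed
    qed
    also have "\<dots> \<le> liminf (\<lambda>j. sqdist (G n) (G (r j)))"
      unfolding sqdist_def by (rule nn_integral_liminf) simp
    also have "\<dots> \<le> ennreal ((1/8)^k)"
    proof (rule Liminf_le)
      have "sqdist (G n) (G (r j)) \<le> ennreal ((1/8)^k)" if "j \<ge> M k" for j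
        by (rule less_imp_le[OF M[OF n order_trans[OF that seq_suble[OF mono]]]])
      then show "\<forall>\<^sub>F j in sequentially. sqdist (G n) (G (r j)) \<le> ennreal ((1/8)^k)"
        unfolding eventually_sequentially by blast
    qed simp
    finally show ?thesis .
  qed
  have "(\<lambda>n. sqdist (G n) g) \<longlonglongrightarrow> 0"
  proof (rule order_tendstoI)
    fix c :: ennreal assume "0 < c"
    have "(\<lambda>k. ennreal ((1/8)^k)) \<longlonglongrightarrow> ennreal 0"
      by (intro tendsto_ennrealI LIMSEQ_power_zero) simp
    from order_tendstoD(2)[OF this, of c] \<open>0 < c\<close> obtain k where "ennreal ((1/8)^k) < c"
      by (auto simp: eventually_sequentially)
    then have "sqdist (G n) g < c" if "n \<ge> M k" for n using le[OF that] by (rule le_less_trans[rotated])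
    then show "\<forall>\<^sub>F n in sequentially. sqdist (G n) g < c" unfolding eventually_sequentially by blast
  qed simp
  then show ?thesis by (rule that[OF g_meas mono ae])
qed

section \<open>Uniqueness of weak gradients; functions paired with their gradients\<close>

lemma weak_grad_loc_integrable:
  assumes "is_weak_grad \<phi> g" shows "loc_integrable \<phi>" "loc_integrable g"
  using assms unfolding is_weak_grad_def loc_integrable_def by blast+

lemma weak_gradD:
  assumes "is_weak_grad \<phi> g" "\<psi> \<in> test_functions" "b \<in> Basis"
  shows "(LINT x|lborel. \<phi> x * (gradient \<psi> x \<bullet> b)) = - (LINT x|lborel. (g x \<bullet> b) * \<psi> x)"
  using assms unfolding is_weak_grad_def by blast

text \<open>Each component of the difference integrates to 0 against every test function. This makes
  the choice in \<open>weak_grad\<close> immaterial up to a null set.\<close>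

lemma weak_grad_unique:
  fixes \<phi> :: "'a::euclidean_space \<Rightarrow> real"
  assumes g: "is_weak_grad \<phi> g" and h: "is_weak_grad \<phi> h"
  shows "AE x in lborel. g x = h x"
proof -
  have "AE x in lborel. g x \<bullet> b - h x \<bullet> b = 0" if b: "b \<in> Basis" for b
  proof (rule fundamental_lemma)
    show "loc_integrable (\<lambda>x. g x \<bullet> b - h x \<bullet> b)"
      by (intro loc_integrable_diff loc_integrable_inner weak_grad_loc_integrable(2)[OF g] weak_grad_loc_integrable(2)[OF h])
    fix \<psi> :: "'a \<Rightarrow> real" assume \<psi>: "\<psi> \<in> test_functions"
    have "integrable lborel (\<lambda>x. (g x \<bullet> b) * \<psi> x)" "integrable lborel (\<lambda>x. (h x \<bullet> b) * \<psi> x)"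
      by (intro integrable_mult_test[OF _ \<psi>] loc_integrable_inner weak_grad_loc_integrable(2)[OF g] weak_grad_loc_integrable(2)[OF h])+
    moreover have "(LINT x|lborel. (g x \<bullet> b) * \<psi> x) = (LINT x|lborel. (h x \<bullet> b) * \<psi> x)"
      using weak_gradD[OF g \<psi> b] weak_gradD[OF h \<psi> b] by linarith
    ultimately show "(LINT x|lborel. (g x \<bullet> b - h x \<bullet> b) * \<psi> x) = 0"
      by (simp add: left_diff_distrib)
  qed
  then have "AE x in lborel. \<forall>b\<in>Basis. g x \<bullet> b - h x \<bullet> b = 0"
    by (subst AE_ball_countable) (auto intro: countable_finite)
  then show ?thesis by eventually_elim (auto intro: euclidean_eqI)
qed

lemma weak_grad_eq: "is_weak_grad \<phi> g \<Longrightarrow> AE x in lborel. weak_grad \<phi> x = g x"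
  using weak_grad_unique someI[of "is_weak_grad \<phi>" g] unfolding weak_grad_def by blast

text \<open>\<open>D12g \<phi> g\<close>: the function \<open>\<phi>\<close> lies in \<open>D12\<close> and \<open>g\<close> is its weak gradient.\<close>

definition D12g :: "('a::euclidean_space \<Rightarrow> real) \<Rightarrow> ('a \<Rightarrow> 'a) \<Rightarrow> bool" where
  "D12g \<phi> g \<longleftrightarrow> \<phi> \<in> borel_measurable borel \<and> g \<in> borel_measurable borel \<and>
     (\<exists>\<psi>. (\<forall>n. \<psi> n \<in> test_functions) \<and> (\<lambda>n. sqdist (gradient (\<psi> n)) g) \<longlonglongrightarrow> 0 \<and>
       (\<forall>R. (\<lambda>n. \<integral>\<^sup>+x\<in>cball 0 R. ennreal \<bar>\<psi> n x - \<phi> x\<bar> \<partial>lborel) \<longlonglongrightarrow> 0))"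

lemma D12g_measurable: "D12g \<phi> g \<Longrightarrow> \<phi> \<in> borel_measurable borel" "D12g \<phi> g \<Longrightarrow> g \<in> borel_measurable borel"
  unfolding D12g_def by auto

lemma D12gE:
  assumes "D12g \<phi> g"
  obtains \<psi> where "\<And>n. \<psi> n \<in> test_functions" "(\<lambda>n. sqdist (gradient (\<psi> n)) g) \<longlonglongrightarrow> 0"
    "\<And>R. (\<lambda>n. \<integral>\<^sup>+x\<in>cball 0 R. ennreal \<bar>\<psi> n x - \<phi> x\<bar> \<partial>lborel) \<longlonglongrightarrow> 0"
  using assms unfolding D12g_def by blast

lemma integrable_gradient_sq:
  assumes "\<psi> \<in> test_functions" shows "integrable lborel (\<lambda>x. (norm (gradient \<psi> x))\<^sup>2)"
proof -
  have "integrable lborel (\<lambda>x. \<Sum>b\<in>Basis. (gradient \<psi> x \<bullet> b) * (gradient \<psi> x \<bullet> b))"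
    by (intro Bochner_Integration.integrable_sum integrable_mult_test loc_integrable_continuous
        test_continuous test_partial assms)
  then show ?thesis unfolding power2_norm_eq_inner euclidean_inner[of "gradient \<psi> x" "gradient \<psi> x" for x] .
qed

lemma sqdist_zero_test: "\<psi> \<in> test_functions \<Longrightarrow>
    sqdist (gradient \<psi>) (\<lambda>x. 0) = ennreal (LINT x|lborel. (norm (gradient \<psi> x))\<^sup>2)"
  unfolding sqdist_def by (simp add: nn_integral_eq_integral integrable_gradient_sq)

lemma D12g_finite:
  assumes "D12g \<phi> g" shows "sqdist g (\<lambda>x. 0) < \<infinity>"
proof -
  obtain \<psi> where \<psi>: "\<And>n. \<psi> n \<in> test_functions" "(\<lambda>n. sqdist (gradient (\<psi> n)) g) \<longlonglongrightarrow> 0"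
    by (rule D12gE[OF assms]) (rule that)
  from order_tendstoD(2)[OF \<psi>(2), of 1] obtain n where n: "sqdist (gradient (\<psi> n)) g < 1"
    by (auto simp: eventually_sequentially)
  have "sqdist g (\<lambda>x. 0) \<le> 2 * sqdist g (gradient (\<psi> n)) + 2 * sqdist (gradient (\<psi> n)) (\<lambda>x. 0)"
    by (intro sqdist_triangle gradient_measurable \<psi>(1) D12g_measurable(2)[OF assms]) simp
  also have "\<dots> < \<infinity>"
    using less_trans[OF n ennreal_one_less_top] unfolding sqdist_zero_test[OF \<psi>(1)] sqdist_commute[of g]
    by (simp add: ennreal_mult_less_top)
  finally show ?thesis .
qed

lemma loc_integrableI_nn:
  fixes f :: "'a::euclidean_space \<Rightarrow> 'b::euclidean_space"
  assumes [measurable]: "f \<in> borel_measurable borel"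
    and fin: "\<And>R. (\<integral>\<^sup>+x\<in>cball 0 R. ennreal (norm (f x)) \<partial>lborel) < \<infinity>"
  shows "loc_integrable f"
  unfolding loc_integrable_def set_integrable_def
proof safe
  fix K :: "'a set" assume K: "compact K"
  then have [measurable]: "K \<in> sets borel" by (rule borel_compact)
  obtain R where R: "K \<subseteq> cball 0 R" using compact_imp_bounded[OF K] unfolding bounded_iff by fastforce
  show "integrable lborel (\<lambda>x. indicator K x *\<^sub>R f x)"
  proof (rule integrableI_bounded)
    have "(\<integral>\<^sup>+x. ennreal (norm (indicator K x *\<^sub>R f x)) \<partial>lborel) \<le> (\<integral>\<^sup>+x\<in>cball 0 R. ennreal (norm (f x)) \<partial>lborel)"
      using R by (intro nn_integral_mono) (auto simp: indicator_def)
    also note fin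
    finally show "(\<integral>\<^sup>+x. ennreal (norm (indicator K x *\<^sub>R f x)) \<partial>lborel) < \<infinity>" .
  qed simp
qed

lemma nn_set_integral_le:
  "(\<integral>\<^sup>+x\<in>S. f x \<partial>M) \<le> (\<integral>\<^sup>+x. f x \<partial>M)"
  by (intro nn_integral_mono) (auto simp: indicator_def)

text \<open>Integration by parts for the approximating test functions passes to the limit: on the
  left by local $L^1$ convergence against a bounded factor of compact support, on the right by
  Cauchy-Schwarz from the $L^2$ convergence of the gradients.\<close>

lemma D12g_is_weak_grad:
  assumes D: "D12g \<phi> g" shows "is_weak_grad \<phi> g"
proof -
  note [measurable] = D12g_measurable[OF D]
  obtain \<psi> where \<psi>: "\<And>n. \<psi> n \<in> test_functions" "(\<lambda>n. sqdist (gradient (\<psi> n)) g) \<longlonglongrightarrow> 0"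
    "\<And>R. (\<lambda>n. \<integral>\<^sup>+x\<in>cball 0 R. ennreal \<bar>\<psi> n x - \<phi> x\<bar> \<partial>lborel) \<longlonglongrightarrow> 0"
    by (rule D12gE[OF D]) (rule that)
  have [measurable]: "\<psi> n \<in> borel_measurable borel" "gradient (\<psi> n) \<in> borel_measurable borel" for n
    using \<psi>(1) by (auto intro: test_measurable gradient_measurable)
  have cball [measurable]: "cball (0::'a) R \<in> sets borel" for R by simp
  have l\<phi>: "loc_integrable \<phi>"
  proof (rule loc_integrableI_nn)
    fix R
    from order_tendstoD(2)[OF \<psi>(3)[of R], of 1] obtain n where n: "(\<integral>\<^sup>+x\<in>cball 0 R. ennreal \<bar>\<psi> n x - \<phi> x\<bar> \<partial>lborel) < 1"
      by (auto simp: eventually_sequentially)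
    have "(\<integral>\<^sup>+x\<in>cball 0 R. ennreal (norm (\<phi> x)) \<partial>lborel) \<le>
        (\<integral>\<^sup>+x. ennreal \<bar>\<psi> n x\<bar> + ennreal \<bar>\<psi> n x - \<phi> x\<bar> * indicator (cball 0 R) x \<partial>lborel)"
      by (intro nn_integral_mono) (auto simp: indicator_def simp flip: ennreal_plus intro!: ennreal_leI)
    also have "\<dots> = (\<integral>\<^sup>+x. ennreal \<bar>\<psi> n x\<bar> \<partial>lborel) + (\<integral>\<^sup>+x\<in>cball 0 R. ennreal \<bar>\<psi> n x - \<phi> x\<bar> \<partial>lborel)"
      by (rule nn_integral_add) auto
    also have "\<dots> < \<infinity>"
      using integrableD(2)[OF integrable_abs[OF integrable_test[OF \<psi>(1)[of n]]]] less_trans[OF n ennreal_one_less_top]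
      by (simp add: top.not_eq_extremum)
    finally show "(\<integral>\<^sup>+x\<in>cball 0 R. ennreal (norm (\<phi> x)) \<partial>lborel) < \<infinity>" .
  qed simp
  have lg: "loc_integrable g"
  proof (rule loc_integrableI_nn)
    fix R
    have "(\<integral>\<^sup>+x\<in>cball 0 R. ennreal (norm (g x)) \<partial>lborel) \<le>
        (\<integral>\<^sup>+x. indicator (cball 0 R) x + ennreal ((norm (g x - 0))\<^sup>2) \<partial>lborel)"
    proof (rule nn_integral_mono)
      fix x
      \<comment> \<open>Square integrability gives integrability on balls, because t is at most 1 +
        t^2.\<close>
      have "norm (g x) \<le> 1 + (norm (g x))\<^sup>2"
      proof -
        have "0 \<le> (norm (g x))\<^sup>2 - 2 * norm (g x) + 1"
          using zero_le_power2[of "norm (g x) - 1"] by (simp add: power2_diff)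
        then show ?thesis using norm_ge_zero[of "g x"] by linarith
      qed
      then have "ennreal (norm (g x)) \<le> 1 + ennreal ((norm (g x))\<^sup>2)"
        by (metis ennreal_1 ennreal_leI ennreal_plus zero_le_one zero_le_power2)
      then show "ennreal (norm (g x)) * indicator (cball 0 R) x \<le> indicator (cball 0 R) x + ennreal ((norm (g x - 0))\<^sup>2)"
        by (auto simp: indicator_def)
    qed
    also have "\<dots> = emeasure lborel (cball (0::'a) R) + sqdist g (\<lambda>x. 0)"
      unfolding sqdist_def by (subst nn_integral_add) auto
    also have "\<dots> < \<infinity>" using D12g_finite[OF D] emeasure_compact_finite[of "cball (0::'a) R"]
      by simp
    finally show "(\<integral>\<^sup>+x\<in>cball 0 R. ennreal (norm (g x)) \<partial>lborel) < \<infinity>" .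
  qed simp
  have "(LINT x|lborel. \<phi> x * (gradient \<zeta> x \<bullet> b)) = - (LINT x|lborel. (g x \<bullet> b) * \<zeta> x)"
    if \<zeta>: "\<zeta> \<in> test_functions" and b: "b \<in> Basis" for \<zeta> b
  proof (rule LIMSEQ_unique)
    obtain B where B: "B \<ge> 0" "\<And>x. \<bar>\<zeta> x\<bar> \<le> B" "\<And>x. norm (gradient \<zeta> x) \<le> B"
      by (rule test_bounded[OF \<zeta>]) (rule that)
    obtain R where R: "\<And>x. R < norm x \<Longrightarrow> gradient \<zeta> x = 0"
      by (rule test_supportE[OF \<zeta>]) (rule that)
    have [measurable]: "\<zeta> \<in> borel_measurable borel" "gradient \<zeta> \<in> borel_measurable borel"
      using \<zeta> by (auto intro: test_measurable gradient_measurable)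
    have i1: "integrable lborel (\<lambda>x. \<psi> n x * (gradient \<zeta> x \<bullet> b))" for n
      by (intro integrable_mult_test loc_integrable_continuous test_continuous test_partial \<psi> \<zeta> b)
    have i2: "integrable lborel (\<lambda>x. \<phi> x * (gradient \<zeta> x \<bullet> b))"
      by (intro integrable_mult_test l\<phi> test_partial \<zeta> b)
    have i3: "integrable lborel (\<lambda>x. (gradient (\<psi> n) x \<bullet> b) * \<zeta> x)" for n
      by (intro integrable_mult_test loc_integrable_continuous test_continuous test_partial \<psi> \<zeta> b)
    have i4: "integrable lborel (\<lambda>x. (g x \<bullet> b) * \<zeta> x)"
      by (intro integrable_mult_test loc_integrable_inner lg \<zeta>)
    show "(\<lambda>n. LINT x|lborel. \<psi> n x * (gradient \<zeta> x \<bullet> b)) \<longlonglongrightarrow> (LINT x|lborel. \<phi> x * (gradient \<zeta> x \<bullet> b))"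
    proof (rule tendsto_L1_int[OF i1 i2])
      have "(\<lambda>n. ennreal B * (\<integral>\<^sup>+x\<in>cball 0 R. ennreal \<bar>\<psi> n x - \<phi> x\<bar> \<partial>lborel)) \<longlonglongrightarrow> ennreal B * 0"
        by (intro ennreal_tendsto_cmult \<psi>(3)) simp
      then have lim: "(\<lambda>n. ennreal B * (\<integral>\<^sup>+x\<in>cball 0 R. ennreal \<bar>\<psi> n x - \<phi> x\<bar> \<partial>lborel)) \<longlonglongrightarrow> 0" by simp
      have "(\<integral>\<^sup>+x. ennreal (norm (\<psi> n x * (gradient \<zeta> x \<bullet> b) - \<phi> x * (gradient \<zeta> x \<bullet> b))) \<partial>lborel)
          \<le> ennreal B * (\<integral>\<^sup>+x\<in>cball 0 R. ennreal \<bar>\<psi> n x - \<phi> x\<bar> \<partial>lborel)" for n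
      proof (subst nn_integral_cmult[symmetric], simp, rule nn_integral_mono)
        fix x
        have "\<bar>gradient \<zeta> x \<bullet> b\<bar> \<le> B" using Basis_le_norm[OF b, of "gradient \<zeta> x"] B(3)[of x] by linarith
        then have "\<bar>\<psi> n x - \<phi> x\<bar> * \<bar>gradient \<zeta> x \<bullet> b\<bar> \<le> B * \<bar>\<psi> n x - \<phi> x\<bar>"
          by (simp add: mult.commute mult_right_mono)
        then show "ennreal (norm (\<psi> n x * (gradient \<zeta> x \<bullet> b) - \<phi> x * (gradient \<zeta> x \<bullet> b)))
            \<le> ennreal B * (ennreal \<bar>\<psi> n x - \<phi> x\<bar> * indicator (cball 0 R) x)"
          using R[of x] B(1)
          by (cases "R < norm x") (auto simp: indicator_def abs_mult simp flip: left_diff_distrib ennreal_mult intro!: ennreal_leI)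
      qed
      then show "(\<lambda>n. \<integral>\<^sup>+x. ennreal (norm (\<psi> n x * (gradient \<zeta> x \<bullet> b) - \<phi> x * (gradient \<zeta> x \<bullet> b))) \<partial>lborel) \<longlonglongrightarrow> 0"
        by (intro tendsto_sandwich[OF _ _ tendsto_const lim]) auto
    qed
    have "(\<lambda>n. LINT x|lborel. (gradient (\<psi> n) x \<bullet> b) * \<zeta> x) \<longlonglongrightarrow> (LINT x|lborel. (g x \<bullet> b) * \<zeta> x)"
    proof (rule tendsto_L1_int[OF i3 i4])
      define Z where "Z = (\<integral>\<^sup>+x. (ennreal \<bar>\<zeta> x\<bar>)\<^sup>2 \<partial>lborel)"
      have "Z < \<infinity>"
      proof -
        have "integrable lborel (\<lambda>x. \<zeta> x * \<zeta> x)"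
          by (intro integrable_mult_test loc_integrable_continuous test_continuous \<zeta>)
        then show ?thesis unfolding Z_def
          using integrableD(2)[of lborel "\<lambda>x. \<zeta> x * \<zeta> x"]
          by (simp add: power2_eq_square abs_mult less_top flip: ennreal_mult)
      qed
      define F where "F n = (\<integral>\<^sup>+x. ennreal (norm ((gradient (\<psi> n) x \<bullet> b) * \<zeta> x - (g x \<bullet> b) * \<zeta> x)) \<partial>lborel)" for n
      have sq: "(F n)\<^sup>2 \<le> sqdist (gradient (\<psi> n)) g * Z" for n
      proof -
        have "F n \<le> (\<integral>\<^sup>+x. ennreal (norm (gradient (\<psi> n) x - g x)) * ennreal \<bar>\<zeta> x\<bar> \<partial>lborel)"
          unfolding F_def
        proof (rule nn_integral_mono)
          fix x
          have "\<bar>(gradient (\<psi> n) x - g x) \<bullet> b\<bar> * \<bar>\<zeta> x\<bar> \<le> norm (gradient (\<psi> n) x - g x) * \<bar>\<zeta> x\<bar>"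
            by (intro mult_right_mono Basis_le_norm b) simp
          then show "ennreal (norm ((gradient (\<psi> n) x \<bullet> b) * \<zeta> x - (g x \<bullet> b) * \<zeta> x))
              \<le> ennreal (norm (gradient (\<psi> n) x - g x)) * ennreal \<bar>\<zeta> x\<bar>"
            by (auto simp: abs_mult inner_diff_left simp flip: left_diff_distrib ennreal_mult intro!: ennreal_leI)
        qed
        then have "(F n)\<^sup>2 \<le> (\<integral>\<^sup>+x. ennreal (norm (gradient (\<psi> n) x - g x)) * ennreal \<bar>\<zeta> x\<bar> \<partial>lborel)\<^sup>2"
          unfolding power2_eq_square by (intro mult_mono) auto
        also have "\<dots> \<le> (\<integral>\<^sup>+x. (ennreal (norm (gradient (\<psi> n) x - g x)))\<^sup>2 \<partial>lborel) * Z"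
          unfolding Z_def by (rule Cauchy_Schwarz_nn_integral) auto
        finally show ?thesis unfolding sqdist_def by (simp add: ennreal_power)
      qed
      have "(\<lambda>n. sqdist (gradient (\<psi> n)) g * Z) \<longlonglongrightarrow> 0 * Z"
        using \<open>Z < \<infinity>\<close> by (intro tendsto_mult_ennreal \<psi>(2) tendsto_const) auto
      then have lim: "(\<lambda>n. sqdist (gradient (\<psi> n)) g * Z) \<longlonglongrightarrow> 0" by simp
      show "F \<longlonglongrightarrow> 0"
      proof (rule order_tendstoI)
        fix c :: ennreal assume "0 < c"
        then obtain e where e: "0 < e" "ennreal e < c" by (rule ennreal_pos_approx) (rule that)
        have "\<forall>\<^sub>F n in sequentially. sqdist (gradient (\<psi> n)) g * Z < ennreal e * ennreal e"
          using e by (intro order_tendstoD(2)[OF lim]) (simp flip: ennreal_mult)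
        then show "\<forall>\<^sub>F n in sequentially. F n < c"
        proof eventually_elim
          case (elim n)
          have "\<not> ennreal e \<le> F n"
          proof
            assume "ennreal e \<le> F n"
            then have "ennreal e * ennreal e \<le> (F n)\<^sup>2" unfolding power2_eq_square by (intro mult_mono) auto
            then show False using sq[of n] elim by simp
          qed
          then show ?case using e(2) by simp
        qed
      qed simp
    qed
    then show "(\<lambda>n. LINT x|lborel. \<psi> n x * (gradient \<zeta> x \<bullet> b)) \<longlonglongrightarrow> - (LINT x|lborel. (g x \<bullet> b) * \<zeta> x)"
      by (subst test_integration_by_parts[OF \<psi>(1) \<zeta> b]) (rule tendsto_minus)
  qed
  with l\<phi> lg show ?thesis unfolding is_weak_grad_def loc_integrable_def by blast
qed

section \<open>The space $D^{1,2}$ and Hardy's inequality\<close>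

lemma sqdist_test:
  assumes "\<psi> \<in> test_functions" "\<xi> \<in> test_functions"
  shows "sqdist (gradient \<psi>) (gradient \<xi>) = ennreal ((dirichlet_norm (\<lambda>x. \<psi> x - \<xi> x))\<^sup>2)"
proof -
  have "sqdist (gradient \<psi>) (gradient \<xi>) = sqdist (gradient (\<lambda>x. \<psi> x - \<xi> x)) (\<lambda>x. 0)"
    unfolding sqdist_def by (simp add: gradient_diff[OF assms])
  then show ?thesis
    unfolding sqdist_zero_test[OF test_diff[OF assms]] dirichlet_norm_def by simp
qed

lemma ennreal_tendsto_zeroD:
  fixes F :: "nat \<Rightarrow> ennreal"
  assumes "F \<longlonglongrightarrow> 0" "e > 0"
  obtains M where "\<And>n. n \<ge> M \<Longrightarrow> F n < ennreal e"
  using order_tendstoD(2)[OF assms(1), of "ennreal e"] assms(2) that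
  unfolding eventually_sequentially by auto

text \<open>Completeness of $L^2$ supplies the gradient that the Cauchy condition in
  \<open>D12\<close> leaves implicit.\<close>

lemma D12_D12g:
  assumes "\<phi> \<in> D12" shows "\<exists>g. D12g \<phi> g"
proof -
  from assms obtain \<psi> where \<phi>: "\<phi> \<in> borel_measurable borel" and \<psi>: "\<forall>n. \<psi> n \<in> test_functions"
    and cauchy: "\<forall>e>0. \<exists>M. \<forall>m\<ge>M. \<forall>n\<ge>M. dirichlet_norm (\<lambda>x. \<psi> m x - \<psi> n x) < e"
    and lim: "\<forall>R. (\<lambda>n. \<integral>\<^sup>+x\<in>cball 0 R. ennreal \<bar>\<psi> n x - \<phi> x\<bar> \<partial>lborel) \<longlonglongrightarrow> 0"
    unfolding D12_def by auto
  obtain g r where g: "g \<in> borel_measurable borel" "(\<lambda>n. sqdist (gradient (\<psi> n)) g) \<longlonglongrightarrow> 0"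
  proof (rule sqdist_complete[of "\<lambda>n. gradient (\<psi> n)"])
    show "gradient (\<psi> n) \<in> borel_measurable borel" for n using \<psi> by (simp add: gradient_measurable)
    fix e :: real assume "e > 0"
    then obtain M where M: "\<And>m n. m \<ge> M \<Longrightarrow> n \<ge> M \<Longrightarrow> dirichlet_norm (\<lambda>x. \<psi> m x - \<psi> n x) < sqrt e"
      using cauchy by (meson real_sqrt_gt_zero)
    have "sqdist (gradient (\<psi> m)) (gradient (\<psi> n)) < ennreal e" if "m \<ge> M" "n \<ge> M" for m n
    proof -
      have "0 \<le> dirichlet_norm (\<lambda>x. \<psi> m x - \<psi> n x)" unfolding dirichlet_norm_def by simp
      then have "(dirichlet_norm (\<lambda>x. \<psi> m x - \<psi> n x))\<^sup>2 < (sqrt e)\<^sup>2"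
        using M[OF that] by (intro power_strict_mono) auto
      then show ?thesis using \<psi> \<open>e > 0\<close> by (simp add: sqdist_test ennreal_less_iff)
    qed
    then show "\<exists>M. \<forall>m\<ge>M. \<forall>n\<ge>M. sqdist (gradient (\<psi> m)) (gradient (\<psi> n)) < ennreal e" by blast
  qed (rule that)
  then have "D12g \<phi> g" unfolding D12g_def using \<phi> \<psi> lim by auto
  then show ?thesis by blast
qed

lemma D12g_D12:
  assumes D: "D12g \<phi> g" shows "\<phi> \<in> D12"
proof -
  obtain \<psi> where \<psi>: "\<And>n. \<psi> n \<in> test_functions" "(\<lambda>n. sqdist (gradient (\<psi> n)) g) \<longlonglongrightarrow> 0"
    "\<And>R. (\<lambda>n. \<integral>\<^sup>+x\<in>cball 0 R. ennreal \<bar>\<psi> n x - \<phi> x\<bar> \<partial>lborel) \<longlonglongrightarrow> 0"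
    by (rule D12gE[OF D]) (rule that)
  have "\<exists>M. \<forall>m\<ge>M. \<forall>n\<ge>M. dirichlet_norm (\<lambda>x. \<psi> m x - \<psi> n x) < e" if "e > 0" for e
  proof -
    \<comment> \<open>Two distances below e^2 / 4, each doubled by \<open>sqdist_triangle\<close>,
      add up to less than e^2.\<close>
    have "e\<^sup>2 / 4 > 0" using that by simp
    then obtain M where M: "\<And>n. n \<ge> M \<Longrightarrow> sqdist (gradient (\<psi> n)) g < ennreal (e\<^sup>2 / 4)"
      by (rule ennreal_tendsto_zeroD[OF \<psi>(2)]) (rule that)
    have "dirichlet_norm (\<lambda>x. \<psi> m x - \<psi> n x) < e" if mn: "m \<ge> M" "n \<ge> M" for m n
    proof -
      have "ennreal ((dirichlet_norm (\<lambda>x. \<psi> m x - \<psi> n x))\<^sup>2) = sqdist (gradient (\<psi> m)) (gradient (\<psi> n))"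
        by (rule sqdist_test[OF \<psi>(1) \<psi>(1), symmetric])
      also have "\<dots> \<le> 2 * sqdist (gradient (\<psi> m)) g + 2 * sqdist g (gradient (\<psi> n))"
        by (intro sqdist_triangle gradient_measurable \<psi>(1) D12g_measurable(2)[OF D])
      also have "\<dots> < ennreal (e\<^sup>2)"
      proof -
        obtain a where a: "sqdist (gradient (\<psi> m)) g = ennreal a" "0 \<le> a"
          using M[OF mn(1)] by (cases "sqdist (gradient (\<psi> m)) g") auto
        obtain b where b: "sqdist (gradient (\<psi> n)) g = ennreal b" "0 \<le> b"
          using M[OF mn(2)] by (cases "sqdist (gradient (\<psi> n)) g") auto
        have "a < e\<^sup>2 / 4" "b < e\<^sup>2 / 4" using M[OF mn(1)] M[OF mn(2)] a b by (simp_all add: ennreal_less_iff)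
        then have "ennreal (2 * a + 2 * b) < ennreal (e\<^sup>2)" using a b by (intro ennreal_lessI) auto
        then show ?thesis unfolding sqdist_commute[of g] a(1) b(1)
          using a(2) b(2) by (simp add: ennreal_mult)
      qed
      finally have "(dirichlet_norm (\<lambda>x. \<psi> m x - \<psi> n x))\<^sup>2 < e\<^sup>2" by (simp add: ennreal_less_iff)
      then show ?thesis by (rule power2_less_imp_less) (use \<open>e > 0\<close> in simp)
    qed
    then show ?thesis by blast
  qed
  then show ?thesis unfolding D12_def using \<psi> D12g_measurable(1)[OF D] by auto
qed

lemma D12g_weak_grad_AE: "D12g \<phi> g \<Longrightarrow> AE x in lborel. weak_grad \<phi> x = g x"
  by (rule weak_grad_eq[OF D12g_is_weak_grad])

lemma D12g_AE:
  assumes "D12g \<phi> g" "AE x in lborel. g x = h x" "h \<in> borel_measurable borel"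
  shows "D12g \<phi> h"
proof -
  have "sqdist f g = sqdist f h" for f :: "'a \<Rightarrow> 'a" by (rule sqdist_cong[OF _ assms(2)]) simp
  then show ?thesis using assms(1,3) unfolding D12g_def by simp
qed

lemma D12g_weak_grad:
  assumes "\<phi> \<in> D12" shows "D12g \<phi> (weak_grad \<phi>)"
proof -
  obtain g where g: "D12g \<phi> g" using D12_D12g[OF assms] ..
  have "is_weak_grad \<phi> (weak_grad \<phi>)"
    unfolding weak_grad_def using D12g_is_weak_grad[OF g] by (rule someI[of "is_weak_grad \<phi>"])
  then have "weak_grad \<phi> \<in> borel_measurable borel"
    by (intro loc_integrable_measurable weak_grad_loc_integrable(2))
  moreover have "AE x in lborel. g x = weak_grad \<phi> x" using D12g_weak_grad_AE[OF g] by eventually_elim simp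
  ultimately show ?thesis using D12g_AE[OF g] by blast
qed

lemma D12g_test:
  assumes "\<psi> \<in> test_functions" shows "D12g \<psi> (gradient \<psi>)"
  unfolding D12g_def
  by (intro conjI exI[of _ "\<lambda>_. \<psi>"] test_measurable gradient_measurable assms allI)
    (auto simp: assms sqdist_def)

lemma set_nn_integral_abs_lincomb:
  fixes f g h k :: "'a::euclidean_space \<Rightarrow> real"
  assumes [measurable]: "f \<in> borel_measurable borel" "g \<in> borel_measurable borel"
    "h \<in> borel_measurable borel" "k \<in> borel_measurable borel" "S \<in> sets borel"
  shows "(\<integral>\<^sup>+x\<in>S. ennreal \<bar>(a * f x + b * g x) - (a * h x + b * k x)\<bar> \<partial>lborel) \<le>
    ennreal \<bar>a\<bar> * (\<integral>\<^sup>+x\<in>S. ennreal \<bar>f x - h x\<bar> \<partial>lborel) + ennreal \<bar>b\<bar> * (\<integral>\<^sup>+x\<in>S. ennreal \<bar>g x - k x\<bar> \<partial>lborel)"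
proof -
  have "(\<integral>\<^sup>+x\<in>S. ennreal \<bar>(a * f x + b * g x) - (a * h x + b * k x)\<bar> \<partial>lborel) \<le>
     (\<integral>\<^sup>+x. ennreal \<bar>a\<bar> * (ennreal \<bar>f x - h x\<bar> * indicator S x) + ennreal \<bar>b\<bar> * (ennreal \<bar>g x - k x\<bar> * indicator S x) \<partial>lborel)"
  proof (rule nn_integral_mono)
    fix x
    have "(a * f x + b * g x) - (a * h x + b * k x) = a * (f x - h x) + b * (g x - k x)" by (simp add: algebra_simps)
    then have "\<bar>(a * f x + b * g x) - (a * h x + b * k x)\<bar> \<le> \<bar>a\<bar> * \<bar>f x - h x\<bar> + \<bar>b\<bar> * \<bar>g x - k x\<bar>"
      by (metis abs_mult abs_triangle_ineq)
    then show "ennreal \<bar>(a * f x + b * g x) - (a * h x + b * k x)\<bar> * indicator S x \<le>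
        ennreal \<bar>a\<bar> * (ennreal \<bar>f x - h x\<bar> * indicator S x) + ennreal \<bar>b\<bar> * (ennreal \<bar>g x - k x\<bar> * indicator S x)"
      by (auto simp: indicator_def simp flip: ennreal_mult ennreal_plus intro!: ennreal_leI)
  qed
  also have "\<dots> = ennreal \<bar>a\<bar> * (\<integral>\<^sup>+x\<in>S. ennreal \<bar>f x - h x\<bar> \<partial>lborel) + ennreal \<bar>b\<bar> * (\<integral>\<^sup>+x\<in>S. ennreal \<bar>g x - k x\<bar> \<partial>lborel)"
    by (subst nn_integral_add) (auto simp: nn_integral_cmult)
  finally show ?thesis .
qed

lemma tendsto_ennreal_lincomb_zero:
  fixes F G H :: "nat \<Rightarrow> ennreal"
  assumes "F \<longlonglongrightarrow> 0" "G \<longlonglongrightarrow> 0" "\<And>n. H n \<le> ennreal a * F n + ennreal b * G n"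
  shows "H \<longlonglongrightarrow> 0"
proof -
  have "(\<lambda>n. ennreal a * F n + ennreal b * G n) \<longlonglongrightarrow> ennreal a * 0 + ennreal b * 0"
    by (intro tendsto_add ennreal_tendsto_cmult assms) auto
  then have lim: "(\<lambda>n. ennreal a * F n + ennreal b * G n) \<longlonglongrightarrow> 0" by simp
  show ?thesis by (rule tendsto_sandwich[OF _ _ tendsto_const lim]) (auto simp: assms(3))
qed

lemma D12g_lincomb:
  fixes u v :: "'a::euclidean_space \<Rightarrow> real"
  assumes u: "D12g u g" and v: "D12g v h"
  shows "D12g (\<lambda>x. a * u x + b * v x) (\<lambda>x. a *\<^sub>R g x + b *\<^sub>R h x)"
proof -
  note [measurable] = D12g_measurable[OF u] D12g_measurable[OF v]
  obtain \<psi> where \<psi>: "\<And>n. \<psi> n \<in> test_functions" "(\<lambda>n. sqdist (gradient (\<psi> n)) g) \<longlonglongrightarrow> 0"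
    "\<And>R. (\<lambda>n. \<integral>\<^sup>+x\<in>cball 0 R. ennreal \<bar>\<psi> n x - u x\<bar> \<partial>lborel) \<longlonglongrightarrow> 0"
    by (rule D12gE[OF u]) (rule that)
  obtain \<xi> where \<xi>: "\<And>n. \<xi> n \<in> test_functions" "(\<lambda>n. sqdist (gradient (\<xi> n)) h) \<longlonglongrightarrow> 0"
    "\<And>R. (\<lambda>n. \<integral>\<^sup>+x\<in>cball 0 R. ennreal \<bar>\<xi> n x - v x\<bar> \<partial>lborel) \<longlonglongrightarrow> 0"
    by (rule D12gE[OF v]) (rule that)
  let ?\<theta> = "\<lambda>n x. a * \<psi> n x + b * \<xi> n x"
  have \<theta>: "?\<theta> n \<in> test_functions" for n by (intro test_add test_cmult \<psi> \<xi>)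
  have grad: "gradient (?\<theta> n) = (\<lambda>x. a *\<^sub>R gradient (\<psi> n) x + b *\<^sub>R gradient (\<xi> n) x)" for n
    by (rule ext) (simp add: gradient_add gradient_cmult test_cmult \<psi>(1) \<xi>(1))
  have [measurable]: "gradient (\<psi> n) \<in> borel_measurable borel" "gradient (\<xi> n) \<in> borel_measurable borel"
    "\<psi> n \<in> borel_measurable borel" "\<xi> n \<in> borel_measurable borel" for n
    using \<psi>(1) \<xi>(1) by (auto intro: gradient_measurable test_measurable)
  have "(\<lambda>n. sqdist (gradient (?\<theta> n)) (\<lambda>x. a *\<^sub>R g x + b *\<^sub>R h x)) \<longlonglongrightarrow> 0"
    unfolding grad by (rule tendsto_ennreal_lincomb_zero[OF \<psi>(2) \<xi>(2) sqdist_lincomb]) auto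
  moreover have "(\<lambda>n. \<integral>\<^sup>+x\<in>cball 0 R. ennreal \<bar>?\<theta> n x - (a * u x + b * v x)\<bar> \<partial>lborel) \<longlonglongrightarrow> 0" for R
    by (rule tendsto_ennreal_lincomb_zero[OF \<psi>(3)[of R] \<xi>(3)[of R] set_nn_integral_abs_lincomb]) auto
  moreover have "(\<lambda>x. a * u x + b * v x) \<in> borel_measurable borel" "(\<lambda>x. a *\<^sub>R g x + b *\<^sub>R h x) \<in> borel_measurable borel"
    by auto
  ultimately show ?thesis unfolding D12g_def using \<theta> by (intro conjI exI[of _ ?\<theta>]) auto
qed

lemma D12g_diff: "D12g u g \<Longrightarrow> D12g v h \<Longrightarrow> D12g (\<lambda>x. u x - v x) (\<lambda>x. g x - h x)"
  using D12g_lincomb[of u g v h 1 "-1"] by simp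

text \<open>Diagonal argument: the n-th test function is within 1 / (n + 1) of the n-th function, in
  \<open>sqdist\<close> of the gradients and in $L^1$ of the ball of radius n. For fixed R these
  balls eventually contain the ball of radius R.\<close>

lemma D12g_limit:
  fixes \<phi> :: "'a::euclidean_space \<Rightarrow> real"
  assumes \<phi>n: "\<And>n. D12g (\<phi>n n) (G n)" and meas: "\<phi> \<in> borel_measurable borel" "g \<in> borel_measurable borel"
    and grad: "(\<lambda>n. sqdist (G n) g) \<longlonglongrightarrow> 0"
    and loc: "\<And>R. (\<lambda>n. \<integral>\<^sup>+x\<in>cball 0 R. ennreal \<bar>\<phi>n n x - \<phi> x\<bar> \<partial>lborel) \<longlonglongrightarrow> 0"
  shows "D12g \<phi> g"
proof -
  note [measurable] = meas
  have [measurable]: "\<phi>n n \<in> borel_measurable borel" "G n \<in> borel_measurable borel" for n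
    using D12g_measurable[OF \<phi>n] by auto
  have cb [measurable]: "cball (0::'a) R \<in> sets borel" for R by simp
  have "\<exists>\<theta>. \<theta> \<in> test_functions \<and> sqdist (gradient \<theta>) (G n) < ennreal (inverse (real (Suc n))) \<and>
      (\<integral>\<^sup>+x\<in>cball 0 (real n). ennreal \<bar>\<theta> x - \<phi>n n x\<bar> \<partial>lborel) < ennreal (inverse (real (Suc n)))" for n
  proof -
    obtain \<psi> where \<psi>: "\<And>k. \<psi> k \<in> test_functions" "(\<lambda>k. sqdist (gradient (\<psi> k)) (G n)) \<longlonglongrightarrow> 0"
      "\<And>R. (\<lambda>k. \<integral>\<^sup>+x\<in>cball 0 R. ennreal \<bar>\<psi> k x - \<phi>n n x\<bar> \<partial>lborel) \<longlonglongrightarrow> 0"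
      by (rule D12gE[OF \<phi>n[of n]]) (rule that)
    have pos: "inverse (real (Suc n)) > 0" by simp
    obtain K1 where K1: "\<And>k. k \<ge> K1 \<Longrightarrow> sqdist (gradient (\<psi> k)) (G n) < ennreal (inverse (real (Suc n)))"
      by (rule ennreal_tendsto_zeroD[OF \<psi>(2) pos]) (rule that)
    obtain K2 where K2: "\<And>k. k \<ge> K2 \<Longrightarrow> (\<integral>\<^sup>+x\<in>cball 0 (real n). ennreal \<bar>\<psi> k x - \<phi>n n x\<bar> \<partial>lborel) < ennreal (inverse (real (Suc n)))"
      by (rule ennreal_tendsto_zeroD[OF \<psi>(3) pos]) (rule that)
    show ?thesis
      by (intro exI[of _ "\<psi> (max K1 K2)"] conjI \<psi>(1) K1 K2) auto
  qed
  then obtain \<theta> where \<theta>: "\<And>n. \<theta> n \<in> test_functions"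
    "\<And>n. sqdist (gradient (\<theta> n)) (G n) < ennreal (inverse (real (Suc n)))"
    "\<And>n. (\<integral>\<^sup>+x\<in>cball 0 (real n). ennreal \<bar>\<theta> n x - \<phi>n n x\<bar> \<partial>lborel) < ennreal (inverse (real (Suc n)))"
    by metis
  have [measurable]: "gradient (\<theta> n) \<in> borel_measurable borel" "\<theta> n \<in> borel_measurable borel" for n
    using \<theta>(1) by (auto intro: gradient_measurable test_measurable)
  have inv: "(\<lambda>n. ennreal (inverse (real (Suc n)))) \<longlonglongrightarrow> 0"
    using tendsto_ennrealI[OF LIMSEQ_inverse_real_of_nat] by simp
  have "(\<lambda>n. sqdist (gradient (\<theta> n)) g) \<longlonglongrightarrow> 0"
  proof (rule tendsto_ennreal_lincomb_zero[OF inv grad])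
    fix n
    have "sqdist (gradient (\<theta> n)) g \<le> 2 * sqdist (gradient (\<theta> n)) (G n) + 2 * sqdist (G n) g"
      by (rule sqdist_triangle) auto
    also have "\<dots> \<le> ennreal 2 * ennreal (inverse (real (Suc n))) + ennreal 2 * sqdist (G n) g"
      using \<theta>(2)[of n] by (intro add_mono mult_mono) auto
    finally show "sqdist (gradient (\<theta> n)) g \<le> ennreal 2 * ennreal (inverse (real (Suc n))) + ennreal 2 * sqdist (G n) g" .
  qed
  moreover have "(\<lambda>n. \<integral>\<^sup>+x\<in>cball 0 R. ennreal \<bar>\<theta> n x - \<phi> x\<bar> \<partial>lborel) \<longlonglongrightarrow> 0" for R
  proof -
    obtain N :: nat where N: "R \<le> real N" using real_arch_simple by blast
    have lim: "(\<lambda>n. ennreal (inverse (real (Suc n))) + (\<integral>\<^sup>+x\<in>cball 0 R. ennreal \<bar>\<phi>n n x - \<phi> x\<bar> \<partial>lborel)) \<longlonglongrightarrow> 0"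
      using tendsto_add[OF inv loc[of R]] by simp
    show ?thesis
    proof (rule tendsto_sandwich[OF _ _ tendsto_const lim])
      have "(\<integral>\<^sup>+x\<in>cball 0 R. ennreal \<bar>\<theta> n x - \<phi> x\<bar> \<partial>lborel) \<le>
          ennreal (inverse (real (Suc n))) + (\<integral>\<^sup>+x\<in>cball 0 R. ennreal \<bar>\<phi>n n x - \<phi> x\<bar> \<partial>lborel)" if "n \<ge> N" for n
      proof -
        have "(\<integral>\<^sup>+x\<in>cball 0 R. ennreal \<bar>\<theta> n x - \<phi> x\<bar> \<partial>lborel) \<le>
          (\<integral>\<^sup>+x. ennreal \<bar>\<theta> n x - \<phi>n n x\<bar> * indicator (cball 0 (real n)) x + ennreal \<bar>\<phi>n n x - \<phi> x\<bar> * indicator (cball 0 R) x \<partial>lborel)"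
          using N that
          by (intro nn_integral_mono) (auto simp: indicator_def simp flip: ennreal_plus intro!: ennreal_leI)
        also have "\<dots> = (\<integral>\<^sup>+x\<in>cball 0 (real n). ennreal \<bar>\<theta> n x - \<phi>n n x\<bar> \<partial>lborel) + (\<integral>\<^sup>+x\<in>cball 0 R. ennreal \<bar>\<phi>n n x - \<phi> x\<bar> \<partial>lborel)"
          by (rule nn_integral_add) auto
        also have "\<dots> \<le> ennreal (inverse (real (Suc n))) + (\<integral>\<^sup>+x\<in>cball 0 R. ennreal \<bar>\<phi>n n x - \<phi> x\<bar> \<partial>lborel)"
          using \<theta>(3)[of n] by (intro add_right_mono) simp
        finally show ?thesis .
      qed
      then show "\<forall>\<^sub>F n in sequentially. (\<integral>\<^sup>+x\<in>cball 0 R. ennreal \<bar>\<theta> n x - \<phi> x\<bar> \<partial>lborel) \<le>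
          ennreal (inverse (real (Suc n))) + (\<integral>\<^sup>+x\<in>cball 0 R. ennreal \<bar>\<phi>n n x - \<phi> x\<bar> \<partial>lborel)"
        unfolding eventually_sequentially by blast
    qed simp
  qed
  ultimately show ?thesis unfolding D12g_def using \<theta>(1) meas by blast
qed

section \<open>Hardy's inequality and its consequence on balls\<close>

lemma Ck_inverse: "Ck k f \<Longrightarrow> (\<And>x. f x \<noteq> 0) \<Longrightarrow> Ck k (\<lambda>x. inverse (f x))"
proof (induction k arbitrary: f)
  case 0
  then show ?case by (auto intro!: continuous_intros)
next
  case (Suc k f)
  have "Ck k (\<lambda>x. (- 1) * (inverse (f x) * inverse (f x)) * (gradient f x \<bullet> b))" if "b \<in> Basis" for b
    by (intro Ck_mult Ck_const Suc.IH Ck_Suc[OF Suc.prems(1)] Suc.prems(2) Ck_SucD(2)[OF Suc.prems(1)] that)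
  then show ?case
    by (intro Ck_SucI[OF GDERIV_inverse[OF Ck_SucD(1)[OF Suc.prems(1)] Suc.prems(2)]])
      (simp add: power2_eq_square)
qed

text \<open>Hardy's inequality, from integrating the divergence of \<open>u\<^sup>2 V\<close> with
  \<open>V = (x - p) / (|x - p|\<^sup>2 + e)\<close>; here \<open>div V \<ge> (N - 2) / (|x - p|\<^sup>2 + e)\<close>.\<close>

lemma hardy_test:
  fixes u :: "'a::euclidean_space \<Rightarrow> real"
  assumes u: "u \<in> test_functions" and dim: "DIM('a) \<ge> 3" and e: "e > 0"
  shows "(LINT x|lborel. (u x)\<^sup>2 / ((norm (x - p))\<^sup>2 + e)) \<le> 4 * (LINT x|lborel. (norm (gradient u x))\<^sup>2)"
    and "integrable lborel (\<lambda>x. (u x)\<^sup>2 / ((norm (x - p))\<^sup>2 + e))"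
proof -
  \<comment> \<open>e > 0 keeps V smooth at p, so that the components of u^2 V are test functions
    and their partial derivatives integrate to 0.\<close>
  define q where "q x = (x - p) \<bullet> (x - p) + e" for x
  have q_pos: "q x > 0" for x unfolding q_def using e by (simp add: add_nonneg_pos)
  have q_eq: "q x = (norm (x - p))\<^sup>2 + e" for x by (simp add: q_def power2_norm_eq_inner)
  have Dq: "GDERIV q x :> 2 *\<^sub>R (x - p)" for x
    unfolding gderiv_def q_def[abs_def] by (auto intro!: derivative_eq_intros simp: inner_commute)
  have Ckp: "Ck k (\<lambda>x. (x - p) \<bullet> b)" for k b by (rule Ck_shift[OF Ck_inner])
  have "Ck k (\<lambda>x. (\<Sum>b\<in>Basis. ((x - p) \<bullet> b) * ((x - p) \<bullet> b)) + e)" for k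
    by (intro Ck_add Ck_sum Ck_mult Ckp Ck_const) simp
  then have Ckq: "Ck k q" for k unfolding q_def[abs_def] euclidean_inner[of "x - p" "x - p" for x] .
  have Cki: "Ck k (\<lambda>x. inverse (q x))" for k
    by (rule Ck_inverse[OF Ckq]) (use q_pos in \<open>simp add: less_imp_neq[symmetric]\<close>)
  have uk: "\<And>k. Ck k u" using u unfolding test_functions_iff by blast
  define V where "V b x = ((x - p) \<bullet> b) * inverse (q x)" for b x
  define h where "h b x = (u x * u x) * V b x" for b x
  have DV: "GDERIV (V b) x :> ((x - p) \<bullet> b) *\<^sub>R (- (inverse (q x))\<^sup>2 *\<^sub>R (2 *\<^sub>R (x - p))) + inverse (q x) *\<^sub>R b" for b x
  proof -
    have "GDERIV (\<lambda>x. (x - p) \<bullet> b) x :> b" unfolding gderiv_def by (auto intro!: derivative_eq_intros)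
    moreover have "q x \<noteq> 0" using q_pos[of x] by simp
    ultimately show ?thesis unfolding V_def[abs_def] by (intro GDERIV_mult GDERIV_inverse Dq)
  qed
  have Dh: "gradient (h b) x = (u x * u x) *\<^sub>R (((x - p) \<bullet> b) *\<^sub>R (- (inverse (q x))\<^sup>2 *\<^sub>R (2 *\<^sub>R (x - p))) + inverse (q x) *\<^sub>R b)
      + V b x *\<^sub>R (u x *\<^sub>R gradient u x + u x *\<^sub>R gradient u x)" for b x
    unfolding h_def[abs_def] by (intro GDERIV_gradient GDERIV_mult DV test_GDERIV u)
  have h_test: "h b \<in> test_functions" for b
    unfolding h_def[abs_def] V_def by (intro test_mult_Ck Ck_mult Ckp Cki u uk)
  have i_h: "integrable lborel (\<lambda>x. gradient (h b) x \<bullet> b)" if "b \<in> Basis" for b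
    by (intro integrable_test test_partial h_test that)
  have "(LINT x|lborel. (\<Sum>b\<in>Basis. gradient (h b) x \<bullet> b)) = (\<Sum>b\<in>Basis. (LINT x|lborel. gradient (h b) x \<bullet> b))"
    by (rule Bochner_Integration.integral_sum) (rule i_h)
  also have "\<dots> = 0" by (simp add: integral_partial_zero h_test)
  finally have zero: "(LINT x|lborel. (\<Sum>b\<in>Basis. gradient (h b) x \<bullet> b)) = 0" .
  have i_sum: "integrable lborel (\<lambda>x. \<Sum>b\<in>Basis. gradient (h b) x \<bullet> b)"
    by (rule Bochner_Integration.integrable_sum) (rule i_h)
  have "integrable lborel (\<lambda>x. (u x * (u x * inverse (q x))))"
    by (intro integrable_mult_test loc_integrable_continuous test_continuous test_mult_Ck Cki u)
  moreover have "u x * (u x * inverse (q x)) = (u x)\<^sup>2 / ((norm (x - p))\<^sup>2 + e)" for x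
    by (simp add: q_eq power2_eq_square divide_inverse)
  ultimately show i_q: "integrable lborel (\<lambda>x. (u x)\<^sup>2 / ((norm (x - p))\<^sup>2 + e))" by simp
  \<comment> \<open>Write i for 1 / q. The divergence of V contributes at least N - 2 >= 1 times u^2
    i. Young's inequality for the cross term 2 u \<nabla>u . V gives away half of u^2 i and twice
    the squared gradient. What remains is 1/2 against 2, hence the constant 4.\<close>
  have pt: "(u x)\<^sup>2 / ((norm (x - p))\<^sup>2 + e) / 2 - 2 * (norm (gradient u x))\<^sup>2 \<le> (\<Sum>b\<in>Basis. gradient (h b) x \<bullet> b)" for x
  proof -
    define s i G where "s = (norm (x - p))\<^sup>2" and "i = inverse (q x)" and "G = gradient u x \<bullet> (x - p)"
    have s: "s \<ge> 0" "i > 0" "s * i \<le> 1"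
      using q_pos[of x] e by (auto simp: s_def i_def q_eq field_simps)
    have "(\<Sum>b\<in>Basis. gradient (h b) x \<bullet> b) =
        (\<Sum>b\<in>Basis. - 2 * (u x)\<^sup>2 * i\<^sup>2 * (((x - p) \<bullet> b) * ((x - p) \<bullet> b)) + (u x)\<^sup>2 * i + 2 * u x * i * ((gradient u x \<bullet> b) * ((x - p) \<bullet> b)))"
      by (intro sum.cong) (auto simp: Dh V_def i_def inner_add_left inner_Basis power2_eq_square algebra_simps)
    also have "\<dots> = - 2 * (u x)\<^sup>2 * i\<^sup>2 * s + DIM('a) * ((u x)\<^sup>2 * i) + 2 * u x * i * G"
      unfolding s_def G_def power2_norm_eq_inner euclidean_inner[of "x - p" "x - p"] euclidean_inner[of "gradient u x" "x - p"]
      by (simp only: sum.distrib sum_distrib_left sum_constant)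
    finally have eq: "(\<Sum>b\<in>Basis. gradient (h b) x \<bullet> b) = - 2 * (u x)\<^sup>2 * i\<^sup>2 * s + DIM('a) * ((u x)\<^sup>2 * i) + 2 * u x * i * G" .
    have "- 2 * (u x)\<^sup>2 * i\<^sup>2 * s \<ge> - 2 * ((u x)\<^sup>2 * i)"
    proof -
      have "((u x)\<^sup>2 * i) * (s * i) \<le> ((u x)\<^sup>2 * i) * 1" using s by (intro mult_left_mono) auto
      then show ?thesis by (simp add: power2_eq_square algebra_simps)
    qed
    moreover have "DIM('a) * ((u x)\<^sup>2 * i) \<ge> 3 * ((u x)\<^sup>2 * i)"
      using dim s by (intro mult_right_mono) auto
    moreover have "2 * u x * i * G \<ge> - ((u x)\<^sup>2 * i) / 2 - 2 * (norm (gradient u x))\<^sup>2"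
    proof -
      have "\<bar>G\<bar> \<le> norm (gradient u x) * norm (x - p)" unfolding G_def by (rule Cauchy_Schwarz_ineq2)
      then have "\<bar>u x\<bar> * \<bar>i\<bar> * \<bar>G\<bar> \<le> \<bar>u x\<bar> * i * (norm (gradient u x) * norm (x - p))"
        using s by (intro mult_mono) auto
      then have "\<bar>u x * i * G\<bar> \<le> 2 * (\<bar>u x\<bar> * i * norm (x - p) / 2) * norm (gradient u x)"
        by (simp add: abs_mult mult_ac)
      also have "\<dots> \<le> (\<bar>u x\<bar> * i * norm (x - p) / 2)\<^sup>2 + (norm (gradient u x))\<^sup>2"
        by (rule sum_squares_bound)
      finally have "\<bar>u x * i * G\<bar> \<le> (\<bar>u x\<bar> * i * norm (x - p) / 2)\<^sup>2 + (norm (gradient u x))\<^sup>2" .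
      moreover have "(\<bar>u x\<bar> * i * norm (x - p) / 2)\<^sup>2 \<le> ((u x)\<^sup>2 * i) / 4"
      proof -
        have "(\<bar>u x\<bar> * i * norm (x - p) / 2)\<^sup>2 = ((u x)\<^sup>2 * i) * (s * i) / 4"
          by (simp add: s_def power_mult_distrib power_divide) (simp add: power2_eq_square)
        also have "\<dots> \<le> ((u x)\<^sup>2 * i) * 1 / 4" using s by (intro divide_right_mono mult_left_mono) auto
        finally show ?thesis by simp
      qed
      ultimately have "\<bar>u x * i * G\<bar> \<le> ((u x)\<^sup>2 * i) / 4 + (norm (gradient u x))\<^sup>2" by linarith
      moreover have "2 * u x * i * G = 2 * (u x * i * G)" by simp
      ultimately show ?thesis by linarith
    qed
    moreover have eq': "(u x)\<^sup>2 / ((norm (x - p))\<^sup>2 + e) = (u x)\<^sup>2 * i" by (simp add: i_def q_eq divide_inverse)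
    moreover have "0 \<le> (u x)\<^sup>2 * i" using s by simp
    ultimately show ?thesis unfolding eq eq' by linarith
  qed
  have "(LINT x|lborel. (u x)\<^sup>2 / ((norm (x - p))\<^sup>2 + e) / 2 - 2 * (norm (gradient u x))\<^sup>2) \<le> (LINT x|lborel. (\<Sum>b\<in>Basis. gradient (h b) x \<bullet> b))"
    by (intro integral_mono i_sum pt Bochner_Integration.integrable_diff integrable_divide integrable_mult_right i_q integrable_gradient_sq u)
  also note zero
  finally have "(LINT x|lborel. (u x)\<^sup>2 / ((norm (x - p))\<^sup>2 + e) / 2 - 2 * (norm (gradient u x))\<^sup>2) \<le> 0" .
  moreover have "(LINT x|lborel. (u x)\<^sup>2 / ((norm (x - p))\<^sup>2 + e) / 2 - 2 * (norm (gradient u x))\<^sup>2) =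
     (LINT x|lborel. (u x)\<^sup>2 / ((norm (x - p))\<^sup>2 + e)) / 2 - 2 * (LINT x|lborel. (norm (gradient u x))\<^sup>2)"
    unfolding Bochner_Integration.integral_diff[OF integrable_divide[OF i_q, of 2] integrable_mult_right[OF integrable_gradient_sq[OF u], of 2]]
    by (simp only: integral_divide_zero integral_mult_right_zero)
  ultimately show "(LINT x|lborel. (u x)\<^sup>2 / ((norm (x - p))\<^sup>2 + e)) \<le> 4 * (LINT x|lborel. (norm (gradient u x))\<^sup>2)"
    by linarith
qed

text \<open>Hardy's inequality with e = r^2 and centre p: the weight is at least 1 / (2 r^2) on the
  ball, which gives the factor 2 * 4 * r^2 for an approximating test function. Returning from its
  gradient to g doubles it through \<open>sqdist_triangle\<close>.\<close>

lemma D12g_ball: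
  fixes u :: "'a::euclidean_space \<Rightarrow> real"
  assumes D: "D12g u g" and dim: "DIM('a) \<ge> 3" and r: "r > 0" and m: "m \<ge> 0"
    and lower: "\<And>x. x \<in> ball p r \<Longrightarrow> m \<le> \<bar>u x\<bar>"
  shows "ennreal (m\<^sup>2) * emeasure lborel (ball p r) \<le> ennreal (16 * r\<^sup>2) * sqdist g (\<lambda>x. 0)"
proof -
  note [measurable] = D12g_measurable[OF D]
  obtain \<psi> where \<psi>: "\<And>n. \<psi> n \<in> test_functions" "(\<lambda>n. sqdist (gradient (\<psi> n)) g) \<longlonglongrightarrow> 0"
    "\<And>R. (\<lambda>n. \<integral>\<^sup>+x\<in>cball 0 R. ennreal \<bar>\<psi> n x - u x\<bar> \<partial>lborel) \<longlonglongrightarrow> 0"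
    by (rule D12gE[OF D]) (rule that)
  have [measurable]: "\<psi> n \<in> borel_measurable borel" "gradient (\<psi> n) \<in> borel_measurable borel" for n
    using \<psi>(1) by (auto intro: test_measurable gradient_measurable)
  have cb [measurable]: "cball (0::'a) R \<in> sets borel" "ball p r \<in> sets borel" for R by simp_all
  define R where "R = norm p + r"
  have sub: "ball p r \<subseteq> cball 0 R"
  proof
    fix x assume "x \<in> ball p r"
    then have "norm (x - p) < r" by (simp add: dist_norm norm_minus_commute)
    then show "x \<in> cball 0 R" using norm_triangle_ineq[of "x - p" p] by (simp add: R_def)
  qed
  have step: "ennreal (m\<^sup>2) * emeasure lborel (ball p r) \<le>
      (ennreal (16 * r\<^sup>2) * sqdist (gradient (\<psi> n)) g + ennreal (2 * m) * (\<integral>\<^sup>+x\<in>cball 0 R. ennreal \<bar>\<psi> n x - u x\<bar> \<partial>lborel))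
       + ennreal (16 * r\<^sup>2) * sqdist g (\<lambda>x. 0)" for n
  proof -
    let ?f = "\<lambda>x. (\<psi> n x)\<^sup>2 / ((norm (x - p))\<^sup>2 + r\<^sup>2)"
    have r2: "r\<^sup>2 > 0" using r by simp
    note H = hardy_test[OF \<psi>(1)[of n] dim r2, of p]
    have "ennreal (m\<^sup>2) * emeasure lborel (ball p r) = (\<integral>\<^sup>+x. ennreal (m\<^sup>2) * indicator (ball p r) x \<partial>lborel)"
      by (simp add: nn_integral_cmult)
    also have "\<dots> \<le> (\<integral>\<^sup>+x. ennreal (2 * r\<^sup>2) * ennreal (?f x) + ennreal (2 * m) * (ennreal \<bar>\<psi> n x - u x\<bar> * indicator (cball 0 R) x) \<partial>lborel)"
    proof (rule nn_integral_mono)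
      fix x
      show "ennreal (m\<^sup>2) * indicator (ball p r) x \<le> ennreal (2 * r\<^sup>2) * ennreal (?f x) + ennreal (2 * m) * (ennreal \<bar>\<psi> n x - u x\<bar> * indicator (cball 0 R) x)"
      proof (cases "x \<in> ball p r")
        case True
        \<comment> \<open>The error must enter linearly: the approximants are known to converge to u
          in local $L^1$, which says nothing about the integral of its square.\<close>
        have "m \<le> \<bar>\<psi> n x\<bar> + \<bar>\<psi> n x - u x\<bar>" using lower[OF True] by linarith
        then have "m * m \<le> m * \<bar>\<psi> n x\<bar> + m * \<bar>\<psi> n x - u x\<bar>"
          using mult_left_mono[OF _ m] by (fastforce simp: distrib_left)
        moreover have "2 * m * \<bar>\<psi> n x\<bar> \<le> m\<^sup>2 + (\<psi> n x)\<^sup>2" using sum_squares_bound[of m "\<bar>\<psi> n x\<bar>"] by simp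
        ultimately have "m\<^sup>2 \<le> (\<psi> n x)\<^sup>2 + 2 * m * \<bar>\<psi> n x - u x\<bar>" by (simp add: power2_eq_square)
        also have "(\<psi> n x)\<^sup>2 \<le> 2 * r\<^sup>2 * ?f x"
        proof -
          have "norm (x - p) \<le> r" using True by (simp add: dist_norm norm_minus_commute)
          then have "(norm (x - p))\<^sup>2 \<le> r\<^sup>2" by (intro power_mono) auto
          then have "(\<psi> n x)\<^sup>2 * ((norm (x - p))\<^sup>2 + r\<^sup>2) \<le> (\<psi> n x)\<^sup>2 * (2 * r\<^sup>2)" by (intro mult_left_mono) auto
          moreover have "(norm (x - p))\<^sup>2 + r\<^sup>2 > 0" using r2 by (simp add: add_nonneg_pos)
          ultimately show ?thesis by (simp add: pos_le_divide_eq mult.commute)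
        qed
        finally have "ennreal (m\<^sup>2) \<le> ennreal (2 * r\<^sup>2 * ?f x + 2 * m * \<bar>\<psi> n x - u x\<bar>)" by (intro ennreal_leI) simp
        moreover have "ennreal (2 * r\<^sup>2 * ?f x + 2 * m * \<bar>\<psi> n x - u x\<bar>) =
            ennreal (2 * r\<^sup>2) * ennreal (?f x) + ennreal (2 * m) * ennreal \<bar>\<psi> n x - u x\<bar>"
        proof -
          have "0 \<le> 2 * r\<^sup>2" "0 \<le> ?f x" "0 \<le> 2 * m" "0 \<le> \<bar>\<psi> n x - u x\<bar>" using m by auto
          then show ?thesis by (simp only: ennreal_plus ennreal_mult mult_nonneg_nonneg)
        qed
        moreover have "x \<in> cball 0 R" using True sub by blast
        ultimately show ?thesis using True by (simp only: indicator_simps mult_1_right)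
      qed simp
    qed
    also have "\<dots> = ennreal (2 * r\<^sup>2) * (\<integral>\<^sup>+x. ennreal (?f x) \<partial>lborel) + ennreal (2 * m) * (\<integral>\<^sup>+x\<in>cball 0 R. ennreal \<bar>\<psi> n x - u x\<bar> \<partial>lborel)"
      by (subst nn_integral_add) (auto simp: nn_integral_cmult)
    also have "(\<integral>\<^sup>+x. ennreal (?f x) \<partial>lborel) = ennreal (LINT x|lborel. ?f x)"
      by (rule nn_integral_eq_integral[OF H(2)]) simp
    also have "ennreal (2 * r\<^sup>2) * ennreal (LINT x|lborel. ?f x) \<le> ennreal (8 * r\<^sup>2) * sqdist (gradient (\<psi> n)) (\<lambda>x. 0)"
    proof -
      have "ennreal (2 * r\<^sup>2) * ennreal (LINT x|lborel. ?f x) \<le> ennreal (2 * r\<^sup>2) * ennreal (4 * (LINT x|lborel. (norm (gradient (\<psi> n) x))\<^sup>2))"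
        using H(1) by (intro mult_left_mono ennreal_leI) auto
      also have "\<dots> = ennreal (8 * r\<^sup>2) * sqdist (gradient (\<psi> n)) (\<lambda>x. 0)"
        unfolding sqdist_zero_test[OF \<psi>(1)] by (simp flip: ennreal_mult)
      finally show ?thesis .
    qed
    also have "ennreal (8 * r\<^sup>2) * sqdist (gradient (\<psi> n)) (\<lambda>x. 0) \<le>
        ennreal (8 * r\<^sup>2) * (2 * sqdist (gradient (\<psi> n)) g + 2 * sqdist g (\<lambda>x. 0))"
      by (intro mult_left_mono sqdist_triangle) auto
    also have "\<dots> = ennreal (16 * r\<^sup>2) * sqdist (gradient (\<psi> n)) g + ennreal (16 * r\<^sup>2) * sqdist g (\<lambda>x. 0)"
    proof -
      have "ennreal (16 * r\<^sup>2) = ennreal (8 * r\<^sup>2) * 2" using ennreal_mult[of "8 * r\<^sup>2" 2] by simp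
      then show ?thesis by (simp add: distrib_left mult.assoc)
    qed
    finally show ?thesis by (simp add: ac_simps)
  qed
  have "(\<lambda>n. ennreal (16 * r\<^sup>2) * sqdist (gradient (\<psi> n)) g + ennreal (2 * m) * (\<integral>\<^sup>+x\<in>cball 0 R. ennreal \<bar>\<psi> n x - u x\<bar> \<partial>lborel)) \<longlonglongrightarrow> 0"
    by (rule tendsto_ennreal_lincomb_zero[OF \<psi>(2) \<psi>(3)[of R]]) (rule order_refl)
  from tendsto_add[OF this tendsto_const[of "ennreal (16 * r\<^sup>2) * sqdist g (\<lambda>x. 0)"]]
  show ?thesis by (intro LIMSEQ_le_const[of _ _ "ennreal (m\<^sup>2) * emeasure lborel (ball p r)"]) (use step in auto)
qed

section \<open>Admissible functions\<close>

text \<open>\<open>enn2real\<close> sends infinity to 0, so the value is meaningful only when the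
  distance is finite, as it is for gradients in \<open>D12g\<close>.\<close>

definition sqnorm :: "('a::euclidean_space \<Rightarrow> 'a) \<Rightarrow> real" where
  "sqnorm g = enn2real (sqdist g (\<lambda>x. 0))"

lemma sqnorm_nonneg: "0 \<le> sqnorm g"
  unfolding sqnorm_def by simp

lemma D12g_sqdist: "D12g \<phi> g \<Longrightarrow> sqdist g (\<lambda>x. 0) = ennreal (sqnorm g)"
  unfolding sqnorm_def using D12g_finite[of \<phi> g] by (simp add: ennreal_enn2real_if top.not_eq_extremum)

lemma D12g_integrable_sq:
  assumes "D12g \<phi> g" shows "integrable lborel (\<lambda>x. (norm (g x))\<^sup>2)" "(LINT x|lborel. (norm (g x))\<^sup>2) = sqnorm g"
proof -
  note [measurable] = D12g_measurable[OF assms]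
  show *: "integrable lborel (\<lambda>x. (norm (g x))\<^sup>2)"
    by (rule integrableI_bounded) (use D12g_finite[OF assms] in \<open>auto simp: sqdist_def\<close>)
  show "(LINT x|lborel. (norm (g x))\<^sup>2) = sqnorm g"
    unfolding sqnorm_def sqdist_def using nn_integral_eq_integral[OF *] by simp
qed

text \<open>If |u x| = 4 r, the Lipschitz constant keeps |u| at least 2 r on the ball of radius r;
  \<open>D12g_ball\<close> then bounds r^N, with N the dimension, by a multiple of the Dirichlet
  energy. The constant 2 is that of a difference of two 1-Lipschitz functions.\<close>

lemma sup_bound:
  assumes dim: "DIM('a::euclidean_space) \<ge> 3"
  obtains C where "C > 0"
    "\<And>(u :: 'a \<Rightarrow> real) g x. D12g u g \<Longrightarrow> 2-lipschitz_on UNIV u \<Longrightarrow> \<bar>u x\<bar> ^ DIM('a) \<le> C * sqnorm g"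
proof -
  define k where "k = unit_ball_vol (real DIM('a))"
  have k: "k > 0" unfolding k_def by (rule unit_ball_vol_pos) simp
  have "\<bar>u x\<bar> ^ DIM('a) \<le> (4 ^ DIM('a) * (4 / k)) * sqnorm g"
    if D: "D12g u g" and L: "2-lipschitz_on UNIV u" for u :: "'a \<Rightarrow> real" and g x
  proof (cases "u x = 0")
    case True
    then show ?thesis using k sqnorm_nonneg[of g] by (simp add: zero_power)
  next
    case False
    define r where "r = \<bar>u x\<bar> / 4"
    have r: "r > 0" using False by (simp add: r_def)
    have "2 * r \<le> \<bar>u y\<bar>" if "y \<in> ball x r" for y
    proof -
      have "\<bar>u x - u y\<bar> \<le> 2 * dist x y" using lipschitz_onD[OF L, of x y] by (simp add: dist_real_def)
      then have "\<bar>u x - u y\<bar> \<le> 2 * r" using that by simp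
      then show ?thesis unfolding r_def by linarith
    qed
    then have "ennreal ((2 * r)\<^sup>2) * emeasure lborel (ball x r) \<le> ennreal (16 * r\<^sup>2) * sqdist g (\<lambda>x. 0)"
      using r by (intro D12g_ball[OF D dim r]) auto
    then have "ennreal ((2 * r)\<^sup>2 * (k * r ^ DIM('a))) \<le> ennreal (16 * r\<^sup>2 * sqnorm g)"
      unfolding D12g_sqdist[OF D] using r k sqnorm_nonneg[of g] by (simp add: emeasure_ball k_def flip: ennreal_mult)
    then have "(2 * r)\<^sup>2 * (k * r ^ DIM('a)) \<le> 16 * r\<^sup>2 * sqnorm g"
      using sqnorm_nonneg[of g] by (subst (asm) ennreal_le_iff) auto
    then have "(4 * r\<^sup>2) * (k * r ^ DIM('a)) \<le> (4 * r\<^sup>2) * (4 * sqnorm g)" by (simp add: power_mult_distrib mult_ac)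
    then have "k * r ^ DIM('a) \<le> 4 * sqnorm g" using r by (subst (asm) mult_le_cancel_left_pos) auto
    then have "r ^ DIM('a) \<le> 4 / k * sqnorm g" using k by (simp add: field_simps)
    then have "4 ^ DIM('a) * r ^ DIM('a) \<le> 4 ^ DIM('a) * (4 / k * sqnorm g)" by (intro mult_left_mono) auto
    moreover have "\<bar>u x\<bar> ^ DIM('a) = 4 ^ DIM('a) * r ^ DIM('a)" unfolding r_def by (simp add: power_divide)
    ultimately show ?thesis by (simp only: mult.assoc)
  qed
  moreover have "4 ^ DIM('a) * (4 / k) > 0" using k by simp
  ultimately show ?thesis using that[of "4 ^ DIM('a) * (4 / k)"] by auto
qed

text \<open>Away from the support of a test function \<open>\<psi>\<close> close to \<open>\<phi>\<close>, a large value of \<open>\<phi>\<close> would be a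
  large value of \<open>\<phi> - \<psi>\<close> on a ball.\<close>

lemma D12g_decay:
  fixes \<phi> :: "'a::euclidean_space \<Rightarrow> real"
  assumes D: "D12g \<phi> g" and dim: "DIM('a) \<ge> 3" and L: "1-lipschitz_on UNIV \<phi>" and e: "e > 0"
  obtains R where "\<And>x. R < norm x \<Longrightarrow> \<bar>\<phi> x\<bar> < e"
proof -
  \<comment> \<open>Within distance r of a point where |\<phi>| is at least e, |\<phi>| is still at
    least r.\<close>
  define r where "r = e / 2"
  have r: "r > 0" using e by (simp add: r_def)
  define k where "k = unit_ball_vol (real DIM('a)) * r ^ DIM('a)"
  have k: "k > 0" unfolding k_def using r by simp
  obtain \<psi> where \<psi>: "\<And>n. \<psi> n \<in> test_functions" "(\<lambda>n. sqdist (gradient (\<psi> n)) g) \<longlonglongrightarrow> 0"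
    by (rule D12gE[OF D]) (rule that)
  \<comment> \<open>With m = r, \<open>D12g_ball\<close> requires a Dirichlet energy of at least k /
    16, where k is the volume of a ball of radius r.\<close>
  have pos: "k / 16 > 0" using k by simp
  obtain n where n: "sqdist (gradient (\<psi> n)) g < ennreal (k / 16)"
    by (rule ennreal_tendsto_zeroD[OF \<psi>(2) pos]) blast
  obtain S where S: "\<And>x. S < norm x \<Longrightarrow> \<psi> n x = 0"
    by (rule test_supportE[OF \<psi>(1)[of n]]) (rule that)
  have Dd: "D12g (\<lambda>x. \<phi> x - \<psi> n x) (\<lambda>x. g x - gradient (\<psi> n) x)"
    by (intro D12g_diff D D12g_test \<psi>)
  have "\<bar>\<phi> x\<bar> < e" if x: "S + r < norm x" for x
  proof (rule ccontr)
    assume "\<not> \<bar>\<phi> x\<bar> < e"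
    then have big: "e \<le> \<bar>\<phi> x\<bar>" by simp
    have low: "r \<le> \<bar>\<phi> y - \<psi> n y\<bar>" if y: "y \<in> ball x r" for y
    proof -
      have d: "dist x y < r" using y by simp
      have "norm x \<le> norm y + dist x y" using norm_triangle_sub[of x y] by (simp add: dist_norm)
      then have "\<psi> n y = 0" using x d by (intro S) linarith
      moreover have "\<bar>\<phi> x - \<phi> y\<bar> \<le> dist x y" using lipschitz_onD[OF L, of x y] by (simp add: dist_real_def)
      ultimately show ?thesis using big d unfolding r_def by simp
    qed
    have "ennreal (r\<^sup>2) * emeasure lborel (ball x r) \<le> ennreal (16 * r\<^sup>2) * sqdist (\<lambda>x. g x - gradient (\<psi> n) x) (\<lambda>x. 0)"
      by (rule D12g_ball[OF Dd dim r less_imp_le[OF r] low])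
    also have "sqdist (\<lambda>x. g x - gradient (\<psi> n) x) (\<lambda>x. 0) = sqdist (gradient (\<psi> n)) g"
      unfolding sqdist_def by (simp add: norm_minus_commute)
    also have "ennreal (16 * r\<^sup>2) * sqdist (gradient (\<psi> n)) g < ennreal (16 * r\<^sup>2) * ennreal (k / 16)"
      using n r by (intro ennreal_mult_strict_left_mono) auto
    also have "\<dots> = ennreal (r\<^sup>2 * k)" using k by (simp flip: ennreal_mult)
    finally show False using r k by (simp add: emeasure_ball k_def flip: ennreal_mult)
  qed
  then show ?thesis by (rule that)
qed

section \<open>From a bound on the weak gradient to a Lipschitz constant\<close>

lemma gradient_conv_weak:
  assumes g: "is_weak_grad \<phi> g" and \<psi>: "\<psi> \<in> test_functions" and b: "b \<in> Basis"
  shows "gradient (conv \<phi> \<psi>) y \<bullet> b = conv (\<lambda>x. g x \<bullet> b) \<psi> y"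
proof -
  have "gradient (conv \<phi> \<psi>) y \<bullet> b = - (LINT x|lborel. \<phi> x * (gradient (\<lambda>x. \<psi> (x - y)) x \<bullet> b))"
    unfolding gradient_conv[OF weak_grad_loc_integrable(1)[OF g] \<psi> b] by (simp add: conv_def gradient_shift[OF \<psi>])
  also have "\<dots> = (LINT x|lborel. (g x \<bullet> b) * \<psi> (x - y))"
    using weak_gradD[OF g test_shift[OF \<psi>] b, of y] by simp
  finally show ?thesis by (simp add: conv_def)
qed

lemma conv_continuous_tendsto:
  fixes f :: "'a::euclidean_space \<Rightarrow> real"
  assumes f: "continuous_on UNIV f"
  shows "(\<lambda>n. conv f (mollifier n) y) \<longlonglongrightarrow> f y"
proof (rule LIMSEQ_I)
  fix e :: real assume "e > 0"
  then obtain d where d: "d > 0" "\<And>x. dist x y < d \<Longrightarrow> dist (f x) (f y) < e / 2"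
    using f unfolding continuous_on_iff by (metis UNIV_I half_gt_zero)
  obtain N where N: "\<And>n. n \<ge> N \<Longrightarrow> inverse (real (Suc n)) < d"
    using order_tendstoD(2)[OF LIMSEQ_inverse_real_of_nat d(1)] unfolding eventually_sequentially by blast
  have lf: "loc_integrable f" by (rule loc_integrable_continuous[OF f])
  have lf': "loc_integrable (\<lambda>z. f (z + y))"
    by (intro loc_integrable_continuous continuous_on_compose2[OF f] continuous_intros) auto
  have "norm (conv f (mollifier n) y - f y) < e" if n: "n \<ge> N" for n
  proof -
    have i1: "integrable lborel (\<lambda>z. f (z + y) * mollifier n z)"
      by (intro integrable_mult_test mollifier_test lf')
    have i2: "integrable lborel (\<lambda>z. c * mollifier n (z::'a))" for c
      by (intro integrable_mult_right integrable_test mollifier_test)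
    have eq: "conv f (mollifier n) y - f y = (LINT z|lborel. f (z + y) * mollifier n z - f y * mollifier n z)"
      by (simp add: Bochner_Integration.integral_diff[OF i1 i2] conv_shift[OF lf mollifier_test] mollifier_integral)
    have "norm (conv f (mollifier n) y - f y) \<le> (LINT z|lborel. norm (f (z + y) * mollifier n z - f y * mollifier n z))"
      unfolding eq by (rule integral_norm_bound)
    also have "\<dots> \<le> (LINT z|lborel. e / 2 * mollifier n (z::'a))"
    proof (rule integral_mono)
      fix z :: 'a
      have eq: "norm (f (z + y) * mollifier n z - f y * mollifier n z) = \<bar>f (z + y) - f y\<bar> * mollifier n z"
        by (simp add: mollifier_nonneg abs_mult flip: left_diff_distrib)
      show "norm (f (z + y) * mollifier n z - f y * mollifier n z) \<le> e / 2 * mollifier n z"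
      proof (cases "norm z < d")
        case True
        then have "\<bar>f (z + y) - f y\<bar> \<le> e / 2" using d(2)[of "z + y"] by (simp add: dist_norm)
        then show ?thesis unfolding eq by (intro mult_right_mono mollifier_nonneg)
      next
        case False
        then have "mollifier n z = 0" using N[OF n] by (intro mollifier_zero) simp
        then show ?thesis by simp
      qed
    qed (intro integrable_norm Bochner_Integration.integrable_diff i1 i2)+
    also have "\<dots> = e / 2" by (simp add: mollifier_integral)
    finally show ?thesis using \<open>e > 0\<close> by simp
  qed
  then show "\<exists>N. \<forall>n\<ge>N. norm (conv f (mollifier n) y - f y) < e" by blast
qed

text \<open>\<open>X_space\<close> provides some Lipschitz constant; this lowers it to 1. The
  gradients of the mollifications are averages of g, so they inherit the bound, and the
  mollifications converge pointwise by continuity.\<close>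

lemma weak_grad_bounded_lipschitz:
  fixes \<phi> :: "'a::euclidean_space \<Rightarrow> real"
  assumes g: "is_weak_grad \<phi> g" and cont: "continuous_on UNIV \<phi>" and bound: "AE x in lborel. norm (g x) \<le> 1"
  shows "1-lipschitz_on UNIV \<phi>"
proof -
  have l\<phi>: "loc_integrable \<phi>" and lg: "loc_integrable g" using weak_grad_loc_integrable[OF g] by auto
  have grad: "norm (gradient (conv \<phi> (mollifier n)) y) \<le> 1" for n y
  proof -
    define v where "v = gradient (conv \<phi> (mollifier n)) y"
    have m: "(\<lambda>x. mollifier n (x - y)) \<in> test_functions" by (intro test_shift mollifier_test)
    have i: "integrable lborel (\<lambda>x. (v \<bullet> b) * ((g x \<bullet> b) * mollifier n (x - y)))" for b
      by (intro integrable_mult_right integrable_mult_test loc_integrable_inner lg m)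
    \<comment> \<open>Testing the average against its own value v reduces the vector bound to scalar
      integrals and bounds the square of \<open>norm v\<close> by \<open>norm v\<close>.\<close>
    have "v \<bullet> v = (\<Sum>b\<in>Basis. (v \<bullet> b) * (v \<bullet> b))" by (rule euclidean_inner)
    also have "\<dots> = (\<Sum>b\<in>Basis. (v \<bullet> b) * (LINT x|lborel. (g x \<bullet> b) * mollifier n (x - y)))"
      using gradient_conv_weak[OF g mollifier_test] by (intro sum.cong) (auto simp: v_def conv_def)
    also have "\<dots> = (\<Sum>b\<in>Basis. (LINT x|lborel. (v \<bullet> b) * ((g x \<bullet> b) * mollifier n (x - y))))"
      by simp
    also have "\<dots> = (LINT x|lborel. (\<Sum>b\<in>Basis. (v \<bullet> b) * ((g x \<bullet> b) * mollifier n (x - y))))"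
      by (rule Bochner_Integration.integral_sum[symmetric]) (rule i)
    also have "\<dots> \<le> (LINT x|lborel. norm v * mollifier n (x - y))"
    proof (rule integral_mono_AE)
      show "integrable lborel (\<lambda>x. \<Sum>b\<in>Basis. (v \<bullet> b) * ((g x \<bullet> b) * mollifier n (x - y)))"
        by (intro Bochner_Integration.integrable_sum i)
      show "integrable lborel (\<lambda>x. norm v * mollifier n (x - y))"
        by (intro integrable_mult_right integrable_test m)
      show "AE x in lborel. (\<Sum>b\<in>Basis. (v \<bullet> b) * ((g x \<bullet> b) * mollifier n (x - y))) \<le> norm v * mollifier n (x - y)"
        using bound
      proof eventually_elim
        case (elim x)
        have "(\<Sum>b\<in>Basis. (v \<bullet> b) * ((g x \<bullet> b) * mollifier n (x - y))) = (v \<bullet> g x) * mollifier n (x - y)"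
          unfolding euclidean_inner[of v "g x"] sum_distrib_right by (simp only: mult.assoc)
        also have "\<dots> \<le> (norm v * 1) * mollifier n (x - y)"
          using elim by (intro mult_right_mono mollifier_nonneg order_trans[OF norm_cauchy_schwarz] mult_left_mono) auto
        finally show ?case by simp
      qed
    qed
    also have "\<dots> = norm v"
      using integral_shift[OF test_measurable[OF mollifier_test], of n "- y"] by (simp add: mollifier_integral)
    finally have "norm v * norm v \<le> norm v * 1" by (simp add: power2_eq_square flip: power2_norm_eq_inner)
    then have "norm v \<le> 1" by (cases "norm v = 0") (auto simp: mult_le_cancel_left)
    then show ?thesis by (simp only: v_def)
  qed
  have lip: "norm (conv \<phi> (mollifier n) x - conv \<phi> (mollifier n) y) \<le> 1 * norm (x - y)" for n x y
  proof (rule differentiable_bound[of UNIV _ "\<lambda>x h. h \<bullet> gradient (conv \<phi> (mollifier n)) x"])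
    fix x
    have "GDERIV (conv \<phi> (mollifier n)) x :> gradient (conv \<phi> (mollifier n)) x"
      using conv_GDERIV[OF l\<phi> mollifier_test] GDERIV_gradient by metis
    then show "(conv \<phi> (mollifier n) has_derivative (\<lambda>h. h \<bullet> gradient (conv \<phi> (mollifier n)) x)) (at x within UNIV)"
      unfolding gderiv_def by simp
    show "onorm (\<lambda>h. h \<bullet> gradient (conv \<phi> (mollifier n)) x) \<le> 1"
    proof (rule onorm_bound)
      fix h
      have "norm (h \<bullet> gradient (conv \<phi> (mollifier n)) x) \<le> norm h * norm (gradient (conv \<phi> (mollifier n)) x)"
        unfolding real_norm_def by (rule Cauchy_Schwarz_ineq2)
      also have "\<dots> \<le> norm h * 1" by (intro mult_left_mono grad) simp
      finally show "norm (h \<bullet> gradient (conv \<phi> (mollifier n)) x) \<le> 1 * norm h" by simp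
    qed simp
  qed auto
  show ?thesis
  proof (rule lipschitz_onI)
    fix x y
    have "(\<lambda>n. norm (conv \<phi> (mollifier n) x - conv \<phi> (mollifier n) y)) \<longlonglongrightarrow> norm (\<phi> x - \<phi> y)"
      by (intro tendsto_intros conv_continuous_tendsto cont)
    then have "norm (\<phi> x - \<phi> y) \<le> 1 * norm (x - y)" by (rule LIMSEQ_le_const2) (use lip in blast)
    then show "dist (\<phi> x) (\<phi> y) \<le> 1 * dist x y" by (simp add: dist_norm)
  qed simp
qed

text \<open>Every element of \<open>X_space\<close> has a weak gradient that is bounded by 1 everywhere, and its Lipschitz
  constant is then at most 1.\<close>

definition Xg :: "('a::euclidean_space \<Rightarrow> real) \<Rightarrow> ('a \<Rightarrow> 'a) \<Rightarrow> bool" where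
  "Xg \<phi> g \<longleftrightarrow> D12g \<phi> g \<and> (\<forall>x. norm (g x) \<le> 1) \<and> 1-lipschitz_on UNIV \<phi>"

lemma XgD: "Xg \<phi> g \<Longrightarrow> D12g \<phi> g" "Xg \<phi> g \<Longrightarrow> norm (g x) \<le> 1" "Xg \<phi> g \<Longrightarrow> 1-lipschitz_on UNIV \<phi>"
  "Xg \<phi> g \<Longrightarrow> continuous_on UNIV \<phi>"
  unfolding Xg_def by (auto intro: lipschitz_on_continuous_on)

text \<open>Overwriting g by 0 on the exceptional null set gives a bound at every point, so that
  later estimates of the density can be pointwise.\<close>

lemma D12g_Xg:
  assumes D: "D12g \<phi> g" and bound: "AE x in lborel. norm (g x) \<le> 1" and cont: "continuous_on UNIV \<phi>"
  obtains h where "Xg \<phi> h" "AE x in lborel. g x = h x"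
proof -
  note [measurable] = D12g_measurable[OF D]
  define h where "h x = (if norm (g x) \<le> 1 then g x else 0)" for x
  have ae: "AE x in lborel. g x = h x" using bound by eventually_elim (simp add: h_def)
  have "h \<in> borel_measurable borel" unfolding h_def[abs_def] by measurable
  then have "D12g \<phi> h" by (rule D12g_AE[OF D ae])
  moreover have "norm (h x) \<le> 1" for x by (simp add: h_def)
  moreover have "1-lipschitz_on UNIV \<phi>"
    by (rule weak_grad_bounded_lipschitz[OF D12g_is_weak_grad[OF D] cont bound])
  ultimately show ?thesis using that ae unfolding Xg_def by blast
qed

lemma X_space_Xg:
  assumes "\<phi> \<in> X_space" obtains g where "Xg \<phi> g"
proof -
  from assms have \<phi>: "\<phi> \<in> D12" "continuous_on UNIV \<phi>" "AE x in lborel. norm (weak_grad \<phi> x) \<le> 1"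
    unfolding X_space_def by (auto intro: lipschitz_on_continuous_on)
  show ?thesis by (rule D12g_Xg[OF D12g_weak_grad[OF \<phi>(1)] \<phi>(3,2)]) (rule that)
qed

lemma Xg_X_space:
  assumes "Xg \<phi> g" shows "\<phi> \<in> X_space"
proof -
  have "AE x in lborel. norm (weak_grad \<phi> x) \<le> 1"
    using D12g_weak_grad_AE[OF XgD(1)[OF assms]] by eventually_elim (simp add: XgD(2)[OF assms])
  then show ?thesis unfolding X_space_def using D12g_D12[OF XgD(1)[OF assms]] XgD(3)[OF assms] by blast
qed

section \<open>The Born-Infeld density and its uniform convexity\<close>

definition bi :: "'a::real_normed_vector \<Rightarrow> real" where
  "bi p = 1 - sqrt (1 - (norm p)\<^sup>2)"

text \<open>Comparison with the square gives integrability of the density from above and coercivity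
  in the Dirichlet norm from below.\<close>

lemma bi_bounds:
  assumes "norm p \<le> 1" shows "(norm p)\<^sup>2 / 2 \<le> bi p" "bi p \<le> (norm p)\<^sup>2" "0 \<le> bi p"
proof -
  have s: "0 \<le> (norm p)\<^sup>2" "(norm p)\<^sup>2 \<le> 1" using assms by (simp_all add: power_le_one)
  show "(norm p)\<^sup>2 / 2 \<le> bi p"
  proof -
    have "sqrt (1 - (norm p)\<^sup>2) \<le> 1 - (norm p)\<^sup>2 / 2"
    proof (rule real_le_lsqrt)
      have "0 \<le> ((norm p)\<^sup>2)\<^sup>2 / 4" by simp
      then show "1 - (norm p)\<^sup>2 \<le> (1 - (norm p)\<^sup>2 / 2)\<^sup>2" by (simp add: power2_diff power_divide)
    qed (use s in auto)
    then show ?thesis by (simp add: bi_def)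
  qed
  show "bi p \<le> (norm p)\<^sup>2"
  proof -
    have "1 - (norm p)\<^sup>2 \<le> sqrt (1 - (norm p)\<^sup>2)"
    proof (rule real_le_rsqrt)
      have "(1 - (norm p)\<^sup>2) * (1 - (norm p)\<^sup>2) \<le> (1 - (norm p)\<^sup>2) * 1" using s by (intro mult_left_mono) auto
      then show "(1 - (norm p)\<^sup>2)\<^sup>2 \<le> 1 - (norm p)\<^sup>2" by (simp add: power2_eq_square)
    qed
    then show ?thesis by (simp add: bi_def)
  qed
  show "0 \<le> bi p" using s by (simp add: bi_def)
qed

text \<open>By the parallelogram law the radicand at the midpoint is the mean of a and b plus d.
  Raising a radicand from A^2 to A^2 + d <= 1 raises the root by at least d / 2, and A dominates the
  mean of the two roots by concavity. Twice d / 2 is the gain in the statement.\<close>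

lemma bi_convex:
  fixes p q :: "'a::real_inner"
  assumes "norm p \<le> 1" "norm q \<le> 1"
  shows "(norm (p - q))\<^sup>2 / 4 + 2 * bi ((1/2) *\<^sub>R p + (1/2) *\<^sub>R q) \<le> bi p + bi q"
proof -
  define a b d where "a = 1 - (norm p)\<^sup>2" and "b = 1 - (norm q)\<^sup>2" and "d = (norm (p - q))\<^sup>2 / 4"
  have ab: "0 \<le> a" "a \<le> 1" "0 \<le> b" "b \<le> 1" using assms unfolding a_def b_def by (simp_all add: power_le_one)
  have d: "0 \<le> d" by (simp add: d_def)
  have m: "1 - (norm ((1/2) *\<^sub>R p + (1/2) *\<^sub>R q))\<^sup>2 = (a + b) / 2 + d"
    unfolding a_def b_def d_def power2_norm_eq_inner
    by (simp add: inner_add_left inner_add_right inner_diff_left inner_diff_right inner_commute field_simps)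
  have le1: "(a + b) / 2 + d \<le> 1" using m zero_le_power2[of "norm ((1/2) *\<^sub>R p + (1/2) *\<^sub>R q)"] by linarith
  define A S where "A = sqrt ((a + b) / 2)" and "S = sqrt ((a + b) / 2 + d)"
  have "S \<ge> A + d / 2"
    unfolding S_def
  proof (rule real_le_rsqrt)
    have A1: "0 \<le> A" "A\<^sup>2 = (a + b) / 2" using ab unfolding A_def by auto
    \<comment> \<open>A^2 + d <= 1 gives A <= 1 - d / 2, hence A + d / 4 <= 1, which is exactly what
      the expanded square requires.\<close>
    have "(A + d / 2)\<^sup>2 \<le> A\<^sup>2 + d"
    proof -
      have "A\<^sup>2 + d \<le> 1" unfolding A1(2) by (rule le1)
      moreover have "(1 - d / 2)\<^sup>2 = 1 - d + d\<^sup>2 / 4" by (simp add: power2_diff power_divide)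
      ultimately have "A\<^sup>2 \<le> (1 - d / 2)\<^sup>2" using zero_le_power2[of d] by linarith
      moreover have "0 \<le> 1 - d / 2"
      proof -
        have "0 \<le> (a + b) / 2" using ab by simp
        then show ?thesis using le1 d by linarith
      qed
      ultimately have "A \<le> 1 - d / 2" by (rule power2_le_imp_le)
      then have "d * (A + d / 4) \<le> d * 1" using d by (intro mult_left_mono) auto
      then show ?thesis by (simp add: power2_eq_square algebra_simps)
    qed
    then show "(A + d / 2)\<^sup>2 \<le> (a + b) / 2 + d" using A1 by simp
  qed
  moreover have "sqrt a + sqrt b \<le> 2 * A"
  proof (rule power2_le_imp_le)
    have "0 \<le> (sqrt a - sqrt b)\<^sup>2" by simp
    then have "2 * (sqrt a * sqrt b) \<le> a + b" using ab by (simp add: power2_diff)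
    then show "(sqrt a + sqrt b)\<^sup>2 \<le> (2 * A)\<^sup>2" using ab by (simp add: power2_sum power_mult_distrib A_def)
    show "0 \<le> 2 * A" using ab unfolding A_def by simp
  qed
  ultimately have "d + (sqrt a + sqrt b) \<le> 2 * S" by linarith
  moreover have "bi p = 1 - sqrt a" "bi q = 1 - sqrt b" unfolding bi_def a_def b_def by auto
  moreover have "bi ((1/2) *\<^sub>R p + (1/2) *\<^sub>R q) = 1 - S" unfolding bi_def m S_def by auto
  ultimately show ?thesis unfolding d_def[symmetric] by linarith
qed

lemma Xg_bi_integrable:
  assumes "Xg \<phi> g" shows "integrable lborel (\<lambda>x. bi (g x))"
proof (rule Bochner_Integration.integrable_bound[OF D12g_integrable_sq(1)[OF XgD(1)[OF assms]]])
  note [measurable] = D12g_measurable[OF XgD(1)[OF assms]]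
  show "(\<lambda>x. bi (g x)) \<in> borel_measurable lborel" unfolding bi_def by measurable
  show "AE x in lborel. norm (bi (g x)) \<le> norm ((norm (g x))\<^sup>2)"
    using bi_bounds[OF XgD(2)[OF assms]] by auto
qed

definition bi_energy :: "('a::euclidean_space \<Rightarrow> 'a) \<Rightarrow> real" where
  "bi_energy g = (LINT x|lborel. bi (g x))"

lemma bi_energy_bounds:
  assumes "Xg \<phi> g" shows "sqnorm g / 2 \<le> bi_energy g" "bi_energy g \<le> sqnorm g"
proof -
  note i = D12g_integrable_sq[OF XgD(1)[OF assms]] and j = Xg_bi_integrable[OF assms]
  have "(LINT x|lborel. (norm (g x))\<^sup>2 / 2) \<le> (LINT x|lborel. bi (g x))"
    by (intro integral_mono integrable_divide i j bi_bounds XgD(2)[OF assms])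
  then show "sqnorm g / 2 \<le> bi_energy g" unfolding bi_energy_def by (simp add: i(2))
  have "(LINT x|lborel. bi (g x)) \<le> (LINT x|lborel. (norm (g x))\<^sup>2)"
    by (intro integral_mono i j bi_bounds XgD(2)[OF assms])
  then show "bi_energy g \<le> sqnorm g" unfolding bi_energy_def by (simp add: i(2))
qed

lemma Xg_midpoint:
  assumes u: "Xg u g" and v: "Xg v h"
  shows "Xg (\<lambda>x. 1/2 * u x + 1/2 * v x) (\<lambda>x. (1/2) *\<^sub>R g x + (1/2) *\<^sub>R h x)"
  unfolding Xg_def
proof (intro conjI allI)
  show "D12g (\<lambda>x. 1/2 * u x + 1/2 * v x) (\<lambda>x. (1/2) *\<^sub>R g x + (1/2) *\<^sub>R h x)"
    by (intro D12g_lincomb XgD(1)[OF u] XgD(1)[OF v])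
  show "norm ((1/2) *\<^sub>R g x + (1/2) *\<^sub>R h x) \<le> 1" for x
    using XgD(2)[OF u, of x] XgD(2)[OF v, of x] norm_triangle_ineq[of "(1/2) *\<^sub>R g x" "(1/2) *\<^sub>R h x"] by simp
  show "1-lipschitz_on UNIV (\<lambda>x. 1/2 * u x + 1/2 * v x)"
  proof (rule lipschitz_onI)
    fix x y
    show "dist (1/2 * u x + 1/2 * v x) (1/2 * u y + 1/2 * v y) \<le> 1 * dist x y"
      using lipschitz_onD[OF XgD(3)[OF u], of x y] lipschitz_onD[OF XgD(3)[OF v], of x y]
      unfolding dist_real_def by simp
  qed simp
qed

lemma Xg_diff_lipschitz:
  assumes u: "Xg u g" and v: "Xg v h" shows "2-lipschitz_on UNIV (\<lambda>x. u x - v x)"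
proof (rule lipschitz_onI)
  fix x y
  show "dist (u x - v x) (u y - v y) \<le> 2 * dist x y"
    using lipschitz_onD[OF XgD(3)[OF u], of x y] lipschitz_onD[OF XgD(3)[OF v], of x y]
    unfolding dist_real_def by simp
qed simp

lemma bi_energy_convex:
  assumes u: "Xg u g" and v: "Xg v h"
  shows "sqnorm (\<lambda>x. g x - h x) / 4 + 2 * bi_energy (\<lambda>x. (1/2) *\<^sub>R g x + (1/2) *\<^sub>R h x) \<le> bi_energy g + bi_energy h"
proof -
  note D = D12g_diff[OF XgD(1)[OF u] XgD(1)[OF v]]
  note i = D12g_integrable_sq(1)[OF D] and j = Xg_bi_integrable[OF u] Xg_bi_integrable[OF v] Xg_bi_integrable[OF Xg_midpoint[OF u v]]
  have "(LINT x|lborel. (norm (g x - h x))\<^sup>2 / 4 + 2 * bi ((1/2) *\<^sub>R g x + (1/2) *\<^sub>R h x)) \<le> (LINT x|lborel. bi (g x) + bi (h x))"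
    by (intro integral_mono Bochner_Integration.integrable_add integrable_divide integrable_mult_right i j
        bi_convex XgD(2)[OF u] XgD(2)[OF v])
  moreover have "(LINT x|lborel. bi (g x) + bi (h x)) = bi_energy g + bi_energy h"
    unfolding bi_energy_def by (rule Bochner_Integration.integral_add[OF j(1,2)])
  moreover have "(LINT x|lborel. (norm (g x - h x))\<^sup>2 / 4 + 2 * bi ((1/2) *\<^sub>R g x + (1/2) *\<^sub>R h x)) =
      sqnorm (\<lambda>x. g x - h x) / 4 + 2 * bi_energy (\<lambda>x. (1/2) *\<^sub>R g x + (1/2) *\<^sub>R h x)"
    unfolding bi_energy_def
    using Bochner_Integration.integral_add[OF integrable_divide[OF i, of 4] integrable_mult_right[OF j(3), of 2]] D12g_integrable_sq(2)[OF D]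
    by simp
  ultimately show ?thesis by linarith
qed

lemma BI_functional_Xg:
  assumes "Xg \<phi> g" shows "BI_functional \<Omega> \<rho> \<phi> = bi_energy g - pairing \<Omega> \<rho> \<phi>"
proof -
  note [measurable] = D12g_measurable[OF XgD(1)[OF assms]]
  have "weak_grad \<phi> \<in> borel_measurable borel"
    by (rule D12g_measurable(2)[OF D12g_weak_grad[OF D12g_D12[OF XgD(1)[OF assms]]]])
  then have [measurable]: "weak_grad \<phi> \<in> borel_measurable borel" .
  have "(LINT x|lborel. 1 - sqrt (1 - (norm (weak_grad \<phi> x))\<^sup>2)) = bi_energy g"
    unfolding bi_energy_def bi_def
  proof (rule integral_cong_AE)
    show "AE x in lborel. 1 - sqrt (1 - (norm (weak_grad \<phi> x))\<^sup>2) = 1 - sqrt (1 - (norm (g x))\<^sup>2)"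
      using D12g_weak_grad_AE[OF XgD(1)[OF assms]] by eventually_elim simp
  qed measurable
  then show ?thesis by (simp add: BI_functional_def)
qed

section \<open>Minimizers\<close>

lemma prob_on_frontierD:
  assumes "\<rho> \<in> prob_on_frontier \<Omega>"
  shows "sets \<rho> = sets borel" "space \<rho> = UNIV" "emeasure \<rho> (frontier \<Omega>) = 1" "finite_measure \<rho>"
proof -
  show s: "sets \<rho> = sets borel" and f: "emeasure \<rho> (frontier \<Omega>) = 1"
    using assms unfolding prob_on_frontier_def by auto
  show sp: "space \<rho> = UNIV" using sets_eq_imp_space_eq[OF s] by simp
  have "emeasure \<rho> (frontier \<Omega> \<union> - frontier \<Omega>) \<le> emeasure \<rho> (frontier \<Omega>) + emeasure \<rho> (- frontier \<Omega>)"
    by (intro emeasure_subadditive) (auto simp: s)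
  also have "\<dots> = 1" using assms unfolding prob_on_frontier_def by auto
  finally have "emeasure \<rho> UNIV \<le> 1" by simp
  then show "finite_measure \<rho>" using sp by (intro finite_measureI) (auto simp: top_unique)
qed

lemma pairing_integrable:
  fixes \<phi> :: "'a::euclidean_space \<Rightarrow> real"
  assumes \<rho>: "\<rho> \<in> prob_on_frontier \<Omega>" and \<Omega>: "bounded \<Omega>" and \<phi>: "continuous_on UNIV \<phi>"
  shows "integrable \<rho> (\<lambda>x. indicator (frontier \<Omega>) x *\<^sub>R \<phi> x)"
proof -
  interpret finite_measure \<rho> by (rule prob_on_frontierD[OF \<rho>])
  have "compact (\<phi> ` frontier \<Omega>)"
    using \<Omega> \<phi> by (intro compact_continuous_image compact_frontier_bounded continuous_on_subset[OF \<phi>]) auto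
  then obtain B where B: "\<forall>y\<in>\<phi> ` frontier \<Omega>. norm y \<le> B" using compact_imp_bounded bounded_iff by metis
  have [measurable]: "\<phi> \<in> borel_measurable borel" by (rule borel_measurable_continuous_onI[OF \<phi>])
  have "(\<lambda>x. indicator (frontier \<Omega>) x *\<^sub>R \<phi> x) \<in> borel_measurable borel"
    by (intro borel_measurable_scaleR borel_measurable_indicator) auto
  then have m: "(\<lambda>x. indicator (frontier \<Omega>) x *\<^sub>R \<phi> x) \<in> borel_measurable \<rho>"
    using measurable_cong_sets[OF prob_on_frontierD(1)[OF \<rho>] refl] by blast
  show ?thesis
  proof (rule integrable_const_bound[OF AE_I2 m])
    fix x
    show "norm (indicator (frontier \<Omega>) x *\<^sub>R \<phi> x) \<le> \<bar>B\<bar>"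
      using B by (cases "x \<in> frontier \<Omega>") (auto intro: order_trans[OF _ abs_ge_self])
  qed
qed

lemma pairing_const:
  fixes \<Omega> :: "'a::euclidean_space set"
  assumes \<rho>: "\<rho> \<in> prob_on_frontier \<Omega>" shows "pairing \<Omega> \<rho> (\<lambda>x. c) = c"
proof -
  have "measure \<rho> (frontier \<Omega>) = 1" using prob_on_frontierD(3)[OF \<rho>] by (simp add: measure_def)
  moreover have "frontier \<Omega> \<in> sets \<rho>" using prob_on_frontierD(1)[OF \<rho>] by simp
  ultimately show ?thesis
    using prob_on_frontierD(2,3)[OF \<rho>] unfolding pairing_def set_lebesgue_integral_def by simp
qed

lemma pairing_lincomb:
  fixes \<phi> \<psi> :: "'a::euclidean_space \<Rightarrow> real"
  assumes "\<rho> \<in> prob_on_frontier \<Omega>" "bounded \<Omega>" "continuous_on UNIV \<phi>" "continuous_on UNIV \<psi>"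
  shows "pairing \<Omega> \<rho> (\<lambda>x. a * \<phi> x + b * \<psi> x) = a * pairing \<Omega> \<rho> \<phi> + b * pairing \<Omega> \<rho> \<psi>"
proof -
  note i = pairing_integrable[OF assms(1-3)] and j = pairing_integrable[OF assms(1,2,4)]
  have "(LINT x|\<rho>. a * (indicator (frontier \<Omega>) x *\<^sub>R \<phi> x) + b * (indicator (frontier \<Omega>) x *\<^sub>R \<psi> x))
      = a * pairing \<Omega> \<rho> \<phi> + b * pairing \<Omega> \<rho> \<psi>"
    unfolding pairing_def set_lebesgue_integral_def
    by (subst Bochner_Integration.integral_add[OF integrable_mult_right[OF i] integrable_mult_right[OF j]]) simp
  then show ?thesis unfolding pairing_def set_lebesgue_integral_def by (simp add: algebra_simps)
qed

lemma pairing_diff: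
  fixes \<phi> \<psi> :: "'a::euclidean_space \<Rightarrow> real"
  assumes "\<rho> \<in> prob_on_frontier \<Omega>" "bounded \<Omega>" "continuous_on UNIV \<phi>" "continuous_on UNIV \<psi>"
  shows "pairing \<Omega> \<rho> (\<lambda>x. \<phi> x - \<psi> x) = pairing \<Omega> \<rho> \<phi> - pairing \<Omega> \<rho> \<psi>"
  using pairing_lincomb[OF assms, of 1 "-1"] by simp

lemma pairing_mono:
  fixes \<phi> \<psi> :: "'a::euclidean_space \<Rightarrow> real"
  assumes "\<rho> \<in> prob_on_frontier \<Omega>" "bounded \<Omega>" "continuous_on UNIV \<phi>" "continuous_on UNIV \<psi>"
    "\<And>x. x \<in> frontier \<Omega> \<Longrightarrow> \<phi> x \<le> \<psi> x"
  shows "pairing \<Omega> \<rho> \<phi> \<le> pairing \<Omega> \<rho> \<psi>"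
  unfolding pairing_def set_lebesgue_integral_def
  by (intro integral_mono pairing_integrable assms(1-4)) (auto simp: indicator_def assms(5))

lemma pairing_bound:
  fixes \<phi> :: "'a::euclidean_space \<Rightarrow> real"
  assumes "\<rho> \<in> prob_on_frontier \<Omega>" "bounded \<Omega>" "continuous_on UNIV \<phi>"
    "\<And>x. x \<in> frontier \<Omega> \<Longrightarrow> \<bar>\<phi> x\<bar> \<le> B"
  shows "\<bar>pairing \<Omega> \<rho> \<phi>\<bar> \<le> B"
proof -
  have "pairing \<Omega> \<rho> \<phi> \<le> pairing \<Omega> \<rho> (\<lambda>x. B)"
    by (intro pairing_mono assms(1-3) continuous_on_const) (use assms(4) abs_le_iff in blast)
  moreover have "pairing \<Omega> \<rho> (\<lambda>x. - B) \<le> pairing \<Omega> \<rho> \<phi>"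
    by (intro pairing_mono assms(1-3) continuous_on_const) (use assms(4) abs_le_iff minus_le_iff in blast)
  ultimately show ?thesis unfolding pairing_const[OF assms(1)] by linarith
qed

text \<open>One constant serves all pairs and all points, so closeness of the gradients in $L^2$
  becomes uniform closeness of the functions.\<close>

lemma Xg_diff_bound:
  assumes dim: "DIM('a::euclidean_space) \<ge> 3"
  obtains C where "C > 0"
    "\<And>(u :: 'a \<Rightarrow> real) v g h x. Xg u g \<Longrightarrow> Xg v h \<Longrightarrow> \<bar>u x - v x\<bar> ^ DIM('a) \<le> C * sqnorm (\<lambda>x. g x - h x)"
proof -
  obtain C where C: "C > 0"
    "\<And>(u :: 'a \<Rightarrow> real) g x. D12g u g \<Longrightarrow> 2-lipschitz_on UNIV u \<Longrightarrow> \<bar>u x\<bar> ^ DIM('a) \<le> C * sqnorm g"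
    by (rule sup_bound[OF dim]) (rule that)
  show ?thesis by (rule that[OF C(1)]) (intro C(2) D12g_diff XgD(1) Xg_diff_lipschitz)
qed

section \<open>Convexity and coercivity of the functional\<close>

lemma Xg_zero: "Xg (\<lambda>x. 0) (\<lambda>x. 0)"
proof -
  have "gradient (\<lambda>x::'a. 0::real) = (\<lambda>x. 0)" by (rule ext) (rule GDERIV_gradient[OF GDERIV_const])
  moreover have "D12g (\<lambda>x::'a. 0::real) (gradient (\<lambda>x. 0))" by (rule D12g_test[OF test_zero])
  ultimately have "D12g (\<lambda>x::'a. 0) (\<lambda>x. 0)" by (simp only:)
  then show ?thesis unfolding Xg_def by (auto intro!: lipschitz_onI)
qed

lemma BI_zero: "BI_functional \<Omega> \<rho> (\<lambda>x. 0) = 0"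
  unfolding BI_functional_Xg[OF Xg_zero] bi_energy_def bi_def pairing_def set_lebesgue_integral_def by simp

lemma BI_convex:
  assumes u: "Xg u g" and v: "Xg v h" and \<rho>: "\<rho> \<in> prob_on_frontier \<Omega>" and \<Omega>: "bounded \<Omega>"
  shows "sqnorm (\<lambda>x. g x - h x) / 4 + 2 * BI_functional \<Omega> \<rho> (\<lambda>x. 1/2 * u x + 1/2 * v x) \<le>
    BI_functional \<Omega> \<rho> u + BI_functional \<Omega> \<rho> v"
  unfolding BI_functional_Xg[OF u] BI_functional_Xg[OF v] BI_functional_Xg[OF Xg_midpoint[OF u v]]
    pairing_lincomb[OF \<rho> \<Omega> XgD(4)[OF u] XgD(4)[OF v]]
  using bi_energy_convex[OF u v] by simp

text \<open>Turns bounds on N-th powers, as in \<open>Xg_diff_bound\<close>, into bounds on the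
  values themselves.\<close>

lemma power_dim_bound:
  fixes t :: real assumes "n \<ge> 2" "0 \<le> t" shows "t \<le> 1 + t ^ n"
proof (cases "t \<le> 1")
  case False
  then have "t ^ 1 \<le> t ^ n" using assms by (intro power_increasing) auto
  then show ?thesis by simp
qed (use assms in \<open>simp add: add_increasing2\<close>)

lemma BI_bounded_below:
  fixes \<Omega> :: "'a::euclidean_space set"
  assumes dim: "DIM('a) \<ge> 3" and \<rho>: "\<rho> \<in> prob_on_frontier \<Omega>" and \<Omega>: "bounded \<Omega>"
  obtains B where "\<And>\<phi>. \<phi> \<in> X_space \<Longrightarrow> - B \<le> BI_functional \<Omega> \<rho> \<phi>"
proof -
  obtain C where C: "C > 0"
    "\<And>(u :: 'a \<Rightarrow> real) v g h x. Xg u g \<Longrightarrow> Xg v h \<Longrightarrow> \<bar>u x - v x\<bar> ^ DIM('a) \<le> C * sqnorm (\<lambda>x. g x - h x)"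
    by (rule Xg_diff_bound[OF dim]) (rule that)
  \<comment> \<open>Rescaling by T makes C / T at most 1/2. Then the supremum of |\<phi>| is at most
    T plus half the Dirichlet energy, and this half is absorbed by the lower bound for
    \<open>bi_energy\<close>.\<close>
  define T where "T = 1 + 2 * C"
  have T: "T \<ge> 1" "2 * C \<le> T" using C by (auto simp: T_def)
  have "- T \<le> BI_functional \<Omega> \<rho> \<phi>" if X: "\<phi> \<in> X_space" for \<phi>
  proof -
    obtain g where g: "Xg \<phi> g" by (rule X_space_Xg[OF X]) (rule that)
    have pt: "\<bar>\<phi> x\<bar> \<le> T + sqnorm g / 2" for x
    proof -
      have "\<bar>\<phi> x\<bar> / T \<le> 1 + (\<bar>\<phi> x\<bar> / T) ^ DIM('a)" using T dim by (intro power_dim_bound) auto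
      also have "(\<bar>\<phi> x\<bar> / T) ^ DIM('a) \<le> \<bar>\<phi> x\<bar> ^ DIM('a) / T ^ 2"
        using T dim by (simp add: power_divide) (intro divide_left_mono power_increasing, auto)
      also have "\<bar>\<phi> x\<bar> ^ DIM('a) / T ^ 2 \<le> (C * sqnorm g) / T ^ 2"
        using C(2)[OF g Xg_zero, of x] by (intro divide_right_mono) auto
      also have "(C * sqnorm g) / T ^ 2 \<le> (T / 2 * sqnorm g) / T ^ 2"
        using T sqnorm_nonneg[of g] by (intro divide_right_mono mult_right_mono) auto
      finally have "\<bar>\<phi> x\<bar> / T \<le> 1 + (T / 2 * sqnorm g) / T ^ 2" by simp
      then have "T * (\<bar>\<phi> x\<bar> / T) \<le> T * (1 + (T / 2 * sqnorm g) / T ^ 2)" using T by (intro mult_left_mono) auto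
      moreover have "T * (1 + (T / 2 * sqnorm g) / T ^ 2) = T + sqnorm g / 2"
        using T by (simp add: power2_eq_square field_simps)
      ultimately show ?thesis using T by simp
    qed
    have "\<bar>pairing \<Omega> \<rho> \<phi>\<bar> \<le> T + sqnorm g / 2" by (rule pairing_bound[OF \<rho> \<Omega> XgD(4)[OF g] pt])
    then show ?thesis unfolding BI_functional_Xg[OF g] using bi_energy_bounds(1)[OF g] by linarith
  qed
  then show ?thesis by (rule that)
qed

lemma sqdist_sqnorm:
  assumes "D12g u g" "D12g v h" shows "sqdist g h = ennreal (sqnorm (\<lambda>x. g x - h x))"
  using D12g_sqdist[OF D12g_diff[OF assms]] unfolding sqdist_def by simp

text \<open>Direct method with strong limits. The limit arises twice, as uniform limit of the
  functions and as $L^2$ limit of the gradients; \<open>D12g_limit\<close> ties the two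
  together.\<close>

lemma minimizer_exists:
  fixes \<Omega> :: "'a::euclidean_space set"
  assumes dim: "DIM('a) \<ge> 3" and \<rho>: "\<rho> \<in> prob_on_frontier \<Omega>" and \<Omega>: "bounded \<Omega>"
  shows "\<exists>\<phi>\<in>X_space. \<forall>\<psi>\<in>X_space. BI_functional \<Omega> \<rho> \<phi> \<le> BI_functional \<Omega> \<rho> \<psi>"
proof -
  let ?I = "BI_functional \<Omega> \<rho>"
  obtain C where C: "C > 0"
    "\<And>(u :: 'a \<Rightarrow> real) v g h x. Xg u g \<Longrightarrow> Xg v h \<Longrightarrow> \<bar>u x - v x\<bar> ^ DIM('a) \<le> C * sqnorm (\<lambda>x. g x - h x)"
    by (rule Xg_diff_bound[OF dim]) (rule that)
  obtain B where B: "\<And>\<phi>. \<phi> \<in> X_space \<Longrightarrow> - B \<le> ?I \<phi>"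
    by (rule BI_bounded_below[OF dim \<rho> \<Omega>]) (rule that)
  define m where "m = (INF \<phi>\<in>X_space. ?I \<phi>)"
  have bdd: "bdd_below (?I ` X_space)" using B by (intro bdd_belowI2)
  have ne: "(X_space :: ('a \<Rightarrow> real) set) \<noteq> {}" using Xg_X_space[OF Xg_zero] by blast
  have m_le: "m \<le> ?I \<phi>" if "\<phi> \<in> X_space" for \<phi> unfolding m_def by (rule cINF_lower[OF bdd that])
  have "\<exists>\<phi> g. Xg \<phi> g \<and> ?I \<phi> < m + inverse (real (Suc n))" for n
  proof -
    have "m < m + inverse (real (Suc n))" by simp
    then obtain \<phi> where "\<phi> \<in> X_space" "?I \<phi> < m + inverse (real (Suc n))"
      unfolding m_def using cINF_less_iff[OF ne bdd] by blast
    then show ?thesis using X_space_Xg by metis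
  qed
  then obtain \<phi> g where X: "\<And>n. Xg (\<phi> n) (g n)" and I: "\<And>n. ?I (\<phi> n) < m + inverse (real (Suc n))"
    by metis
  have dirle: "sqnorm (\<lambda>x. g i x - g j x) \<le> 4 * (inverse (real (Suc i)) + inverse (real (Suc j)))" for i j
  proof -
    \<comment> \<open>The midpoint is admissible, so its value is at least m. Uniform convexity then
      leaves only the two excesses over m to bound the distance of the gradients.\<close>
    have aux: "d \<le> 4 * (s + t)" if "d / 4 + 2 * q \<le> a + b" "m \<le> q" "a < m + s" "b < m + t" for a b d q s t :: real
      using that by argo
    show ?thesis
      by (rule aux[OF BI_convex[OF X X \<rho> \<Omega>] m_le[OF Xg_X_space[OF Xg_midpoint[OF X X]]] I I])
  qed
  have small: "\<exists>M. \<forall>i\<ge>M. \<forall>j\<ge>M. sqnorm (\<lambda>x. g i x - g j x) < e" if e: "e > 0" for e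
  proof -
    have "e / 8 > 0" using e by simp
    then obtain M where M: "\<And>i. i \<ge> M \<Longrightarrow> inverse (real (Suc i)) < e / 8"
      using order_tendstoD(2)[OF LIMSEQ_inverse_real_of_nat, of "e / 8"] unfolding eventually_sequentially by blast
    have "sqnorm (\<lambda>x. g i x - g j x) < e" if "i \<ge> M" "j \<ge> M" for i j
      using dirle[of i j] M[OF that(1)] M[OF that(2)] by argo
    then show ?thesis by blast
  qed
  note [measurable] = D12g_measurable[OF XgD(1)[OF X]]
  obtain h r where h: "h \<in> borel_measurable borel" "strict_mono r"
    "AE x in lborel. (\<lambda>n. g (r n) x) \<longlonglongrightarrow> h x" "(\<lambda>n. sqdist (g n) h) \<longlonglongrightarrow> 0"
  proof (rule sqdist_complete[of g])
    show "g n \<in> borel_measurable borel" for n by simp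
    fix e :: real assume e: "e > 0"
    obtain M where M: "\<forall>i\<ge>M. \<forall>j\<ge>M. sqnorm (\<lambda>x. g i x - g j x) < e" using small[OF e] by blast
    have "sqdist (g i) (g j) < ennreal e" if "i \<ge> M" "j \<ge> M" for i j
      unfolding sqdist_sqnorm[OF XgD(1)[OF X] XgD(1)[OF X]] using M that e sqnorm_nonneg by (simp add: ennreal_lessI)
    then show "\<exists>M. \<forall>i\<ge>M. \<forall>j\<ge>M. sqdist (g i) (g j) < ennreal e" by blast
  qed (rule that)
  have ucauchy: "\<exists>M. \<forall>i\<ge>M. \<forall>j\<ge>M. \<forall>x. dist (\<phi> i x) (\<phi> j x) < e" if e: "e > 0" for e
  proof -
    have "e ^ DIM('a) / C > 0" using e C by simp
    then obtain M where M: "\<forall>i\<ge>M. \<forall>j\<ge>M. sqnorm (\<lambda>x. g i x - g j x) < e ^ DIM('a) / C" using small by blast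
    have "dist (\<phi> i x) (\<phi> j x) < e" if ij: "i \<ge> M" "j \<ge> M" for i j x
    proof -
      have "\<bar>\<phi> i x - \<phi> j x\<bar> ^ DIM('a) \<le> C * sqnorm (\<lambda>x. g i x - g j x)" by (rule C(2)[OF X X])
      also have "\<dots> < C * (e ^ DIM('a) / C)" using M ij C by (intro mult_strict_left_mono) auto
      finally have "\<bar>\<phi> i x - \<phi> j x\<bar> ^ DIM('a) < e ^ DIM('a)" using C by simp
      then show ?thesis unfolding dist_real_def by (rule power_less_imp_less_base) (use e in simp)
    qed
    then show ?thesis by blast
  qed
  have "\<exists>l. \<forall>e>0. \<exists>N. \<forall>n x. N \<le> n \<and> True \<longrightarrow> dist (\<phi> n x) (l x) < e"
    by (subst uniformly_convergent_eq_cauchy) (use ucauchy in blast)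
  then obtain \<Phi> where "\<forall>e>0. \<exists>N. \<forall>n x. N \<le> n \<and> True \<longrightarrow> dist (\<phi> n x) (\<Phi> x) < e" ..
  then have \<Phi>: "\<exists>N. \<forall>n\<ge>N. \<forall>x. \<bar>\<phi> n x - \<Phi> x\<bar> < e" if "e > 0" for e
    using that unfolding dist_real_def by blast
  have ptw: "(\<lambda>n. \<phi> n x) \<longlonglongrightarrow> \<Phi> x" for x
    unfolding LIMSEQ_def dist_real_def using \<Phi> by blast
  have lip: "1-lipschitz_on UNIV \<Phi>"
  proof (rule lipschitz_onI)
    fix x y
    have "(\<lambda>n. dist (\<phi> n x) (\<phi> n y)) \<longlonglongrightarrow> dist (\<Phi> x) (\<Phi> y)" by (intro tendsto_dist ptw)
    then show "dist (\<Phi> x) (\<Phi> y) \<le> 1 * dist x y"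
      by (rule LIMSEQ_le_const2) (use lipschitz_onD[OF XgD(3)[OF X]] in blast)
  qed simp
  then have cont: "continuous_on UNIV \<Phi>" by (rule lipschitz_on_continuous_on)
  have [measurable]: "\<Phi> \<in> borel_measurable borel" by (rule borel_measurable_continuous_onI[OF cont])
  have D: "D12g \<Phi> h"
  proof (rule D12g_limit[OF XgD(1)[OF X] _ h(1,4)])
    fix R :: real
    have cb [measurable]: "cball (0::'a) R \<in> sets borel" by simp
    define V where "V = measure lborel (cball (0::'a) R)"
    have V: "emeasure lborel (cball (0::'a) R) = ennreal V"
      unfolding V_def by (rule emeasure_eq_ennreal_measure) (use emeasure_compact_finite[of "cball (0::'a) R"] in auto)
    show "(\<lambda>n. \<integral>\<^sup>+x\<in>cball 0 R. ennreal \<bar>\<phi> n x - \<Phi> x\<bar> \<partial>lborel) \<longlonglongrightarrow> 0"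
    proof (rule order_tendstoI)
      fix c :: ennreal assume "0 < c"
      then obtain e where e: "0 < e" "ennreal e < c" by (rule ennreal_pos_approx) (rule that)
      have V0: "V \<ge> 0" by (simp add: V_def)
      \<comment> \<open>V + 1 because the ball may have volume 0, R being any real number.\<close>
      have "e / (V + 1) > 0" using e V0 by simp
      then obtain N where N: "\<forall>n\<ge>N. \<forall>x. \<bar>\<phi> n x - \<Phi> x\<bar> < e / (V + 1)" using \<Phi> by blast
      have "(\<integral>\<^sup>+x\<in>cball 0 R. ennreal \<bar>\<phi> n x - \<Phi> x\<bar> \<partial>lborel) < c" if "n \<ge> N" for n
      proof -
        have "(\<integral>\<^sup>+x\<in>cball 0 R. ennreal \<bar>\<phi> n x - \<Phi> x\<bar> \<partial>lborel) \<le> (\<integral>\<^sup>+x. ennreal (e / (V + 1)) * indicator (cball (0::'a) R) x \<partial>lborel)"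
        proof (rule nn_integral_mono)
          fix x
          have "\<bar>\<phi> n x - \<Phi> x\<bar> \<le> e / (V + 1)" using N that by (auto intro: less_imp_le)
          from ennreal_leI[OF this]
          show "ennreal \<bar>\<phi> n x - \<Phi> x\<bar> * indicator (cball 0 R) x \<le> ennreal (e / (V + 1)) * indicator (cball 0 R) x"
            by (rule mult_right_mono) simp
        qed
        also have "\<dots> = ennreal (e / (V + 1)) * ennreal V" by (simp add: nn_integral_cmult V)
        also have "\<dots> = ennreal (e * (V / (V + 1)))" using e V0 by (simp flip: ennreal_mult)
        also have "\<dots> \<le> ennreal e" using e V0 by (intro ennreal_leI mult_left_le) auto
        finally show ?thesis using e(2) by simp
      qed
      then show "\<forall>\<^sub>F n in sequentially. (\<integral>\<^sup>+x\<in>cball 0 R. ennreal \<bar>\<phi> n x - \<Phi> x\<bar> \<partial>lborel) < c"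
        unfolding eventually_sequentially by blast
    qed simp
  qed simp
  \<comment> \<open>The pointwise constraint passes to the limit along the almost everywhere
    convergent subsequence.\<close>
  have "AE x in lborel. norm (h x) \<le> 1"
    using h(3)
  proof eventually_elim
    case (elim x)
    show ?case by (rule LIMSEQ_le_const2[OF tendsto_norm[OF elim]]) (use XgD(2)[OF X] in blast)
  qed
  then obtain k where k: "Xg \<Phi> k" "AE x in lborel. h x = k x"
    by (rule D12g_Xg[OF D _ cont]) (rule that)
  have pair: "(\<lambda>n. pairing \<Omega> \<rho> (\<phi> n)) \<longlonglongrightarrow> pairing \<Omega> \<rho> \<Phi>"
  proof (rule LIMSEQ_I)
    fix e :: real assume "e > 0"
    then have "e / 2 > 0" by simp
    then obtain N where N: "\<forall>n\<ge>N. \<forall>x. \<bar>\<phi> n x - \<Phi> x\<bar> < e / 2" using \<Phi> by blast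
    have "norm (pairing \<Omega> \<rho> (\<phi> n) - pairing \<Omega> \<rho> \<Phi>) < e" if "n \<ge> N" for n
    proof -
      have b: "\<bar>\<phi> n x - \<Phi> x\<bar> \<le> e / 2" for x using N that by (auto intro: less_imp_le)
      have "\<bar>pairing \<Omega> \<rho> (\<lambda>x. \<phi> n x - \<Phi> x)\<bar> \<le> e / 2"
        by (rule pairing_bound[OF \<rho> \<Omega> _ b]) (intro continuous_on_diff XgD(4)[OF X] cont)
      then show ?thesis using \<open>e > 0\<close> unfolding pairing_diff[OF \<rho> \<Omega> XgD(4)[OF X] cont] by simp
    qed
    then show "\<exists>N. \<forall>n\<ge>N. norm (pairing \<Omega> \<rho> (\<phi> n) - pairing \<Omega> \<rho> \<Phi>) < e" by blast
  qed
  have bi_nn: "ennreal (bi_energy v) = (\<integral>\<^sup>+x. ennreal (bi (v x)) \<partial>lborel)" if "Xg u v" for u v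
    unfolding bi_energy_def
    by (rule nn_integral_eq_integral[OF Xg_bi_integrable[OF that], symmetric]) (simp add: bi_bounds(3)[OF XgD(2)[OF that]])
  have bi_meas [measurable]: "(\<lambda>x. bi (g n x)) \<in> borel_measurable borel" for n
    unfolding bi_def by measurable
  \<comment> \<open>Fatou's lemma for the nonnegative density: lower semicontinuity is all that a
    minimum requires.\<close>
  have "ennreal (bi_energy k) = (\<integral>\<^sup>+x. liminf (\<lambda>n. ennreal (bi (g (r n) x))) \<partial>lborel)"
    unfolding bi_nn[OF k(1)]
  proof (rule nn_integral_cong_AE)
    show "AE x in lborel. ennreal (bi (k x)) = liminf (\<lambda>n. ennreal (bi (g (r n) x)))"
      using h(3) k(2)
    proof eventually_elim
      case (elim x)
      have "(\<lambda>n. ennreal (bi (g (r n) x))) \<longlonglongrightarrow> ennreal (bi (k x))"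
        unfolding bi_def using elim by (intro tendsto_intros) auto
      from lim_imp_Liminf[OF trivial_limit_sequentially this] show ?case by (rule sym)
    qed
  qed
  also have "\<dots> \<le> liminf (\<lambda>n. \<integral>\<^sup>+x. ennreal (bi (g (r n) x)) \<partial>lborel)"
    by (rule nn_integral_liminf) simp
  also have "\<dots> \<le> liminf (\<lambda>n. ennreal (m + inverse (real (Suc (r n))) + pairing \<Omega> \<rho> (\<phi> (r n))))"
  proof (rule Liminf_mono, rule always_eventually, rule allI)
    fix n
    have "bi_energy (g (r n)) \<le> m + inverse (real (Suc (r n))) + pairing \<Omega> \<rho> (\<phi> (r n))"
      using I[of "r n"] unfolding BI_functional_Xg[OF X] by linarith
    then show "(\<integral>\<^sup>+x. ennreal (bi (g (r n) x)) \<partial>lborel) \<le> ennreal (m + inverse (real (Suc (r n))) + pairing \<Omega> \<rho> (\<phi> (r n)))"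
      unfolding bi_nn[OF X, symmetric] by (rule ennreal_leI)
  qed
  also have "\<dots> = ennreal (m + 0 + pairing \<Omega> \<rho> \<Phi>)"
  proof (rule lim_imp_Liminf[OF trivial_limit_sequentially])
    have "(\<lambda>n. m + inverse (real (Suc n)) + pairing \<Omega> \<rho> (\<phi> n)) \<longlonglongrightarrow> m + 0 + pairing \<Omega> \<rho> \<Phi>"
      by (intro tendsto_add tendsto_const LIMSEQ_inverse_real_of_nat pair)
    from tendsto_ennrealI[OF LIMSEQ_subseq_LIMSEQ[OF this h(2)]]
    show "(\<lambda>n. ennreal (m + inverse (real (Suc (r n))) + pairing \<Omega> \<rho> (\<phi> (r n)))) \<longlonglongrightarrow> ennreal (m + 0 + pairing \<Omega> \<rho> \<Phi>)"
      unfolding comp_def .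
  qed
  finally have le: "ennreal (bi_energy k) \<le> ennreal (m + pairing \<Omega> \<rho> \<Phi>)" by simp
  \<comment> \<open>\<open>ennreal\<close> collapses negative numbers to 0, so the inequality can be
    pulled back to the reals only once its right side is known to be nonnegative.\<close>
  have "0 \<le> m + pairing \<Omega> \<rho> \<Phi>"
  proof (rule LIMSEQ_le_const)
    show "(\<lambda>n. m + inverse (real (Suc n)) + pairing \<Omega> \<rho> (\<phi> n)) \<longlonglongrightarrow> m + pairing \<Omega> \<rho> \<Phi>"
      using tendsto_add[OF tendsto_add[OF tendsto_const LIMSEQ_inverse_real_of_nat] pair, of m] by simp
    have "0 \<le> m + inverse (real (Suc n)) + pairing \<Omega> \<rho> (\<phi> n)" for n
      using I[of n] bi_energy_bounds(1)[OF X, of n] sqnorm_nonneg[of "g n"] unfolding BI_functional_Xg[OF X] by linarith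
    then show "\<exists>N. \<forall>n\<ge>N. 0 \<le> m + inverse (real (Suc n)) + pairing \<Omega> \<rho> (\<phi> n)" by blast
  qed
  then have "bi_energy k \<le> m + pairing \<Omega> \<rho> \<Phi>" using le by (simp add: ennreal_le_iff)
  then have "?I \<Phi> \<le> m" unfolding BI_functional_Xg[OF k(1)] by simp
  then show ?thesis using Xg_X_space[OF k(1)] m_le by (meson order_trans)
qed

lemma Xg_eq:
  fixes u v :: "'a::euclidean_space \<Rightarrow> real"
  assumes dim: "DIM('a) \<ge> 3" and u: "Xg u g" and v: "Xg v h" and zero: "sqnorm (\<lambda>x. g x - h x) \<le> 0"
  shows "u = v"
proof
  fix x
  obtain C where C: "C > 0"
    "\<And>(u :: 'a \<Rightarrow> real) v g h x. Xg u g \<Longrightarrow> Xg v h \<Longrightarrow> \<bar>u x - v x\<bar> ^ DIM('a) \<le> C * sqnorm (\<lambda>x. g x - h x)"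
    by (rule Xg_diff_bound[OF dim]) (rule that)
  have "sqnorm (\<lambda>x. g x - h x) = 0" using zero sqnorm_nonneg[of "\<lambda>x. g x - h x"] by linarith
  then have "\<bar>u x - v x\<bar> ^ DIM('a) \<le> 0" using C(2)[OF u v, of x] by simp
  then have "\<bar>u x - v x\<bar> ^ DIM('a) = 0" by (intro antisym) auto
  then show "u x = v x" by simp
qed

text \<open>The midpoint cannot do better than u, while v does no worse; uniform convexity then
  forces the gradients to agree. Stated for any v that does at least as well as u, so that it also
  identifies the truncated competitor in the final theorem.\<close>

lemma minimizer_unique:
  fixes \<Omega> :: "'a::euclidean_space set"
  assumes dim: "DIM('a) \<ge> 3" and \<rho>: "\<rho> \<in> prob_on_frontier \<Omega>" and \<Omega>: "bounded \<Omega>"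
    and u: "u \<in> X_space" "\<And>\<psi>. \<psi> \<in> X_space \<Longrightarrow> BI_functional \<Omega> \<rho> u \<le> BI_functional \<Omega> \<rho> \<psi>"
    and v: "v \<in> X_space" "BI_functional \<Omega> \<rho> v \<le> BI_functional \<Omega> \<rho> u"
  shows "u = v"
proof -
  obtain g where g: "Xg u g" by (rule X_space_Xg[OF u(1)]) (rule that)
  obtain h where h: "Xg v h" by (rule X_space_Xg[OF v(1)]) (rule that)
  show ?thesis
    using BI_convex[OF g h \<rho> \<Omega>] u(2)[OF Xg_X_space[OF Xg_midpoint[OF g h]]] v(2)
    by (intro Xg_eq[OF dim g h]) linarith
qed

text \<open>Existence and uniqueness together discharge the definite description in
  \<open>potential\<close>.\<close>

lemma potential_minimizer:
  fixes \<Omega> :: "'a::euclidean_space set"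
  assumes dim: "DIM('a) \<ge> 3" and \<rho>: "\<rho> \<in> prob_on_frontier \<Omega>" and \<Omega>: "bounded \<Omega>"
  shows "potential \<Omega> \<rho> \<in> X_space"
    "\<psi> \<in> X_space \<Longrightarrow> BI_functional \<Omega> \<rho> (potential \<Omega> \<rho>) \<le> BI_functional \<Omega> \<rho> \<psi>"
proof -
  let ?P = "is_arg_min (BI_functional \<Omega> \<rho>) (\<lambda>\<phi>. \<phi> \<in> X_space)"
  obtain \<phi> where \<phi>: "\<phi> \<in> X_space" "\<And>\<psi>. \<psi> \<in> X_space \<Longrightarrow> BI_functional \<Omega> \<rho> \<phi> \<le> BI_functional \<Omega> \<rho> \<psi>"
    using minimizer_exists[OF assms] by blast
  have "?P (potential \<Omega> \<rho>)"
    unfolding potential_def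
  proof (rule theI[of ?P \<phi>])
    show "?P \<phi>" using \<phi> unfolding is_arg_min_def by (auto simp: not_less)
    fix \<psi> assume "?P \<psi>"
    then have "\<psi> \<in> X_space" "BI_functional \<Omega> \<rho> \<psi> \<le> BI_functional \<Omega> \<rho> \<phi>"
      using \<phi>(1) unfolding is_arg_min_def by (auto simp: not_less)
    then show "\<psi> = \<phi>" using minimizer_unique[OF assms \<phi>] by blast
  qed
  then show "potential \<Omega> \<rho> \<in> X_space"
    "\<psi> \<in> X_space \<Longrightarrow> BI_functional \<Omega> \<rho> (potential \<Omega> \<rho>) \<le> BI_functional \<Omega> \<rho> \<psi>"
    unfolding is_arg_min_def by (auto simp: not_less)
qed

section \<open>Equilibrium measures\<close>

text \<open>The convex combination of \<rho> and the Dirac measure at a, with weight t on the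
  latter. \<open>measure_of\<close> respects the prescribed values only if they are countably
  additive, which \<open>emeasure_mix_dirac\<close> verifies.\<close>

definition mix_dirac :: "real \<Rightarrow> 'a::euclidean_space measure \<Rightarrow> 'a \<Rightarrow> 'a measure" where
  "mix_dirac t \<rho> a = measure_of UNIV (sets borel) (\<lambda>A. ennreal (1 - t) * emeasure \<rho> A + ennreal t * indicator A a)"

lemma sets_mix_dirac: "sets (mix_dirac t \<rho> a) = sets borel"
  using sets.sigma_sets_eq[of "borel :: 'a measure"] unfolding mix_dirac_def by simp

lemma emeasure_mix_dirac:
  assumes \<rho>: "sets \<rho> = sets borel" and A: "A \<in> sets borel"
  shows "emeasure (mix_dirac t \<rho> a) A = ennreal (1 - t) * emeasure \<rho> A + ennreal t * indicator A a"
proof (rule emeasure_measure_of[OF mix_dirac_def])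
  show "A \<in> sets (mix_dirac t \<rho> a)" using A by (simp add: sets_mix_dirac)
  show "positive (sets (mix_dirac t \<rho> a)) (\<lambda>A. ennreal (1 - t) * emeasure \<rho> A + ennreal t * indicator A a)"
    by (simp add: positive_def)
  show "countably_additive (sets (mix_dirac t \<rho> a)) (\<lambda>A. ennreal (1 - t) * emeasure \<rho> A + ennreal t * indicator A a)"
  proof (rule countably_additiveI)
    fix F :: "nat \<Rightarrow> 'a set" assume F: "range F \<subseteq> sets (mix_dirac t \<rho> a)" "disjoint_family F"
    then have "range F \<subseteq> sets \<rho>" by (simp add: sets_mix_dirac \<rho>)
    then have "(\<Sum>i. emeasure \<rho> (F i)) = emeasure \<rho> (\<Union>i. F i)" using F(2) by (rule suminf_emeasure)
    moreover have "(\<Sum>i. indicator (F i) a :: ennreal) = indicator (\<Union>i. F i) a" using F(2) by (rule suminf_indicator)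
    ultimately show "(\<Sum>i. ennreal (1 - t) * emeasure \<rho> (F i) + ennreal t * indicator (F i) a) =
        ennreal (1 - t) * emeasure \<rho> (\<Union>i. F i) + ennreal t * indicator (\<Union>i. F i) a"
      by (subst suminf_add[symmetric]) auto
  qed
qed auto

lemma nn_integral_mix_dirac:
  fixes f :: "'a::euclidean_space \<Rightarrow> ennreal"
  assumes \<rho>: "sets \<rho> = sets borel" and f: "f \<in> borel_measurable borel"
  shows "(\<integral>\<^sup>+x. f x \<partial>mix_dirac t \<rho> a) = ennreal (1 - t) * (\<integral>\<^sup>+x. f x \<partial>\<rho>) + ennreal t * f a"
proof -
  have M: "borel_measurable (mix_dirac t \<rho> a) = (borel_measurable borel :: ('a \<Rightarrow> ennreal) set)"
    "borel_measurable \<rho> = (borel_measurable borel :: ('a \<Rightarrow> ennreal) set)"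
    by (rule measurable_cong_sets[OF sets_mix_dirac refl], rule measurable_cong_sets[OF \<rho> refl])
  show ?thesis
    using f
  proof (induction rule: borel_measurable_induct)
    case (cong f g)
    then have "f = g" by auto
    then show ?case using cong by simp
  next
    case (set A)
    then show ?case using emeasure_mix_dirac[OF \<rho> set] by (simp add: sets_mix_dirac \<rho>)
  next
    case (mult u c)
    then show ?case by (subst nn_integral_cmult, simp add: M)+ (simp add: distrib_left mult.left_commute)
  next
    case (add u v)
    have add_eq: "(\<integral>\<^sup>+x. v x + u x \<partial>N) = (\<integral>\<^sup>+x. v x \<partial>N) + (\<integral>\<^sup>+x. u x \<partial>N)"
      if "borel_measurable N = (borel_measurable borel :: ('a \<Rightarrow> ennreal) set)" for N :: "'a measure"
      using add that by (intro nn_integral_add) auto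
    show ?case using add.IH unfolding add_eq[OF M(1)] add_eq[OF M(2)]
      by (simp add: distrib_left add_ac)
  next
    case (seq U)
    have inc: "incseq (\<lambda>i. \<integral>\<^sup>+x. U i x \<partial>\<rho>)" "incseq (\<lambda>i. U i a)"
      using seq.hyps(3) by (auto simp: incseq_def le_fun_def intro!: nn_integral_mono)
    have "(\<integral>\<^sup>+x. (SUP i. U i) x \<partial>mix_dirac t \<rho> a) = (SUP i. \<integral>\<^sup>+x. U i x \<partial>mix_dirac t \<rho> a)"
      unfolding SUP_apply using seq.hyps(1,3) by (intro nn_integral_monotone_convergence_SUP) (auto simp: M)
    also have "\<dots> = (SUP i. ennreal (1 - t) * (\<integral>\<^sup>+x. U i x \<partial>\<rho>) + ennreal t * U i a)"
      by (simp add: seq.IH)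
    also have "\<dots> = (SUP i. ennreal (1 - t) * (\<integral>\<^sup>+x. U i x \<partial>\<rho>)) + (SUP i. ennreal t * U i a)"
      using inc by (intro ennreal_SUP_add) (auto simp: incseq_def intro!: mult_left_mono)
    also have "(SUP i. ennreal (1 - t) * (\<integral>\<^sup>+x. U i x \<partial>\<rho>)) = ennreal (1 - t) * (\<integral>\<^sup>+x. (SUP i. U i) x \<partial>\<rho>)"
      unfolding SUP_apply using seq.hyps(1,3)
      by (subst nn_integral_monotone_convergence_SUP) (auto simp: M SUP_mult_left_ennreal)
    also have "(SUP i. ennreal t * U i a) = ennreal t * (SUP i. U i) a"
      unfolding SUP_apply by (simp add: SUP_mult_left_ennreal)
    finally show ?case .
  qed
qed

lemma mix_dirac_prob:
  assumes \<rho>: "\<rho> \<in> prob_on_frontier \<Omega>" and a: "a \<in> frontier \<Omega>" and t: "0 \<le> t" "t \<le> 1"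
  shows "mix_dirac t \<rho> a \<in> prob_on_frontier \<Omega>"
proof -
  note \<rho>' = prob_on_frontierD[OF \<rho>]
  have null: "emeasure \<rho> (- frontier \<Omega>) = 0" using \<rho> unfolding prob_on_frontier_def by auto
  have "emeasure (mix_dirac t \<rho> a) (- frontier \<Omega>) = 0"
    by (subst emeasure_mix_dirac[OF \<rho>'(1)]) (use null a in auto)
  moreover have "emeasure (mix_dirac t \<rho> a) (frontier \<Omega>) = 1"
    by (subst emeasure_mix_dirac[OF \<rho>'(1)]) (use \<rho>'(3) a t in \<open>auto simp flip: ennreal_plus\<close>)
  ultimately show ?thesis unfolding prob_on_frontier_def by (simp add: sets_mix_dirac)
qed

lemma pairing_mix_dirac:
  fixes \<phi> :: "'a::euclidean_space \<Rightarrow> real"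
  assumes \<rho>: "\<rho> \<in> prob_on_frontier \<Omega>" and \<Omega>: "bounded \<Omega>" and a: "a \<in> frontier \<Omega>" and t: "0 \<le> t" "t \<le> 1"
    and \<phi>: "continuous_on UNIV \<phi>"
  shows "pairing \<Omega> (mix_dirac t \<rho> a) \<phi> = (1 - t) * pairing \<Omega> \<rho> \<phi> + t * \<phi> a"
proof -
  define f where "f x = indicator (frontier \<Omega>) x *\<^sub>R \<phi> x" for x
  have i: "integrable \<rho> f" unfolding f_def[abs_def] by (rule pairing_integrable[OF \<rho> \<Omega> \<phi>])
  have j: "integrable (mix_dirac t \<rho> a) f" unfolding f_def[abs_def] by (rule pairing_integrable[OF mix_dirac_prob[OF \<rho> a t] \<Omega> \<phi>])
  have [measurable]: "f \<in> borel_measurable borel"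
    using borel_measurable_integrable[OF i] measurable_cong_sets[OF prob_on_frontierD(1)[OF \<rho>] refl] by blast
  have fa: "f a = \<phi> a" using a by (simp add: f_def)
  \<comment> \<open>Applied to f and to - f, since the integral is defined through positive and
    negative parts; \<open>max 0\<close> reflects that \<open>ennreal\<close> truncates negative
    values.\<close>
  have split: "enn2real (\<integral>\<^sup>+x. ennreal (h x) \<partial>mix_dirac t \<rho> a) = (1 - t) * enn2real (\<integral>\<^sup>+x. ennreal (h x) \<partial>\<rho>) + t * max 0 (h a)"
    if h: "integrable \<rho> h" "h \<in> borel_measurable borel" for h
  proof -
    have fin: "(\<integral>\<^sup>+x. ennreal (h x) \<partial>\<rho>) < \<infinity>"
    proof -
      have "(\<integral>\<^sup>+x. ennreal (h x) \<partial>\<rho>) \<le> (\<integral>\<^sup>+x. ennreal (norm (h x)) \<partial>\<rho>)"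
        by (intro nn_integral_mono ennreal_leI) simp
      also have "\<dots> < \<infinity>" using integrable_iff_bounded h(1) by blast
      finally show ?thesis .
    qed
    then obtain c where c: "(\<integral>\<^sup>+x. ennreal (h x) \<partial>\<rho>) = ennreal c" "0 \<le> c"
      by (cases "\<integral>\<^sup>+x. ennreal (h x) \<partial>\<rho>") auto
    have "(\<integral>\<^sup>+x. ennreal (h x) \<partial>mix_dirac t \<rho> a) = ennreal (1 - t) * ennreal c + ennreal t * ennreal (max 0 (h a))"
      using nn_integral_mix_dirac[OF prob_on_frontierD(1)[OF \<rho>], of "\<lambda>x. ennreal (h x)" t a] h(2) c
      by (simp add: max_def ennreal_neg)
    also have "\<dots> = ennreal ((1 - t) * c + t * max 0 (h a))"
      using t c(2) by (simp flip: ennreal_mult ennreal_plus)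
    finally have E: "(\<integral>\<^sup>+x. ennreal (h x) \<partial>mix_dirac t \<rho> a) = ennreal ((1 - t) * c + t * max 0 (h a))" .
    have "0 \<le> (1 - t) * c + t * max 0 (h a)" using t c(2) by simp
    then show ?thesis unfolding E c(1) by (simp only: enn2real_ennreal c(2))
  qed
  have "pairing \<Omega> (mix_dirac t \<rho> a) \<phi> = (LINT x|mix_dirac t \<rho> a. f x)"
    unfolding pairing_def set_lebesgue_integral_def f_def ..
  also have "\<dots> = enn2real (\<integral>\<^sup>+x. ennreal (f x) \<partial>mix_dirac t \<rho> a) - enn2real (\<integral>\<^sup>+x. ennreal (- f x) \<partial>mix_dirac t \<rho> a)"
    by (rule real_lebesgue_integral_def[OF j])
  also have "\<dots> = (1 - t) * (enn2real (\<integral>\<^sup>+x. ennreal (f x) \<partial>\<rho>) - enn2real (\<integral>\<^sup>+x. ennreal (- f x) \<partial>\<rho>)) + t * f a"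
    using split[of f] split[of "\<lambda>x. - f x"] i by (simp add: algebra_simps max_def)
  also have "enn2real (\<integral>\<^sup>+x. ennreal (f x) \<partial>\<rho>) - enn2real (\<integral>\<^sup>+x. ennreal (- f x) \<partial>\<rho>) = (LINT x|\<rho>. f x)"
    by (rule real_lebesgue_integral_def[OF i, symmetric])
  also have "\<dots> = pairing \<Omega> \<rho> \<phi>"
    unfolding pairing_def set_lebesgue_integral_def f_def ..
  finally show ?thesis by (simp only: fa)
qed

text \<open>Comparing \<open>\<rho>\<close> with \<open>(1 - t) \<rho> + t \<delta>\<^sub>a\<close> and letting \<open>t\<close> tend to 0.\<close>

lemma equilibrium_potential_ge:
  fixes \<Omega> :: "'a::euclidean_space set"
  assumes dim: "DIM('a) \<ge> 3" and \<Omega>: "bounded \<Omega>" and eq: "equilibrium_measure \<Omega> \<rho>" and a: "a \<in> frontier \<Omega>"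
  shows "pairing \<Omega> \<rho> (potential \<Omega> \<rho>) \<le> potential \<Omega> \<rho> a"
proof (rule field_le_epsilon)
  fix e :: real assume e: "e > 0"
  have \<rho>: "\<rho> \<in> prob_on_frontier \<Omega>" and inf: "energy \<Omega> \<rho> = (INF \<sigma>\<in>prob_on_frontier \<Omega>. energy \<Omega> \<sigma>)"
    using eq unfolding equilibrium_measure_def by auto
  obtain C where C: "C > 0"
    "\<And>(u :: 'a \<Rightarrow> real) v g h x. Xg u g \<Longrightarrow> Xg v h \<Longrightarrow> \<bar>u x - v x\<bar> ^ DIM('a) \<le> C * sqnorm (\<lambda>x. g x - h x)"
    by (rule Xg_diff_bound[OF dim]) (rule that)
  define d where "d = e / 2"
  have d: "d > 0" using e by (simp add: d_def)
  \<comment> \<open>The bound 1 / (16 * C) makes the S on the right of the estimate below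
    absorbable, giving S <= 16 t; the last bound then makes C * S smaller than d^N, so the
    potentials differ by at most d. The 1/2 keeps t a valid weight.\<close>
  define t where "t = min (1 / 2) (min (1 / (16 * C)) (d ^ DIM('a) / (32 * C)))"
  have t: "0 < t" "t \<le> 1" "t \<le> 1 / (16 * C)" "t \<le> d ^ DIM('a) / (32 * C)"
    using C(1) d by (auto simp: t_def)
  have tC: "16 * (t * C) \<le> 1" using t(3) C(1) by (simp add: field_simps)
  have tC': "16 * (t * C) < d ^ DIM('a)"
  proof -
    have "32 * (t * C) \<le> d ^ DIM('a)" using t(4) C(1) by (simp add: field_simps)
    moreover have "0 < t * C" using t C by simp
    ultimately show ?thesis by linarith
  qed
  define \<sigma> where "\<sigma> = mix_dirac t \<rho> a"
  have \<sigma>: "\<sigma> \<in> prob_on_frontier \<Omega>" unfolding \<sigma>_def using t by (intro mix_dirac_prob \<rho> a) auto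
  define \<phi> \<psi> where "\<phi> = potential \<Omega> \<rho>" and "\<psi> = potential \<Omega> \<sigma>"
  note \<phi>min = potential_minimizer[OF dim \<rho> \<Omega>, folded \<phi>_def] and \<psi>min = potential_minimizer[OF dim \<sigma> \<Omega>, folded \<psi>_def]
  obtain g where g: "Xg \<phi> g" by (rule X_space_Xg[OF \<phi>min(1)]) (rule that)
  obtain h where h: "Xg \<psi> h" by (rule X_space_Xg[OF \<psi>min(1)]) (rule that)
  have pair\<sigma>: "pairing \<Omega> \<sigma> v = (1 - t) * pairing \<Omega> \<rho> v + t * v a" if "continuous_on UNIV v" for v
    unfolding \<sigma>_def using t that by (intro pairing_mix_dirac[OF \<rho> \<Omega> a]) auto
  have I\<sigma>: "BI_functional \<Omega> \<sigma> v = BI_functional \<Omega> \<rho> v + t * (pairing \<Omega> \<rho> v - v a)" if "Xg v k" for v k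
    unfolding BI_functional_Xg[OF that] pair\<sigma>[OF XgD(4)[OF that]] by (simp add: algebra_simps)
  \<comment> \<open>The zero function is a competitor of value 0. Nonnegativity bounds the set of
    energies below, so that its real infimum is a lower bound.\<close>
  have energy_nonneg: "0 \<le> energy \<Omega> \<tau>" if "\<tau> \<in> prob_on_frontier \<Omega>" for \<tau>
    unfolding energy_def using potential_minimizer(2)[OF dim that \<Omega> Xg_X_space[OF Xg_zero]] BI_zero[of \<Omega> \<tau>] by simp
  have "energy \<Omega> \<rho> \<le> energy \<Omega> \<sigma>"
    unfolding inf by (rule cINF_lower[OF bdd_belowI2 \<sigma>]) (rule energy_nonneg)
  then have e1: "BI_functional \<Omega> \<sigma> \<psi> \<le> BI_functional \<Omega> \<rho> \<phi>" unfolding energy_def \<phi>_def \<psi>_def by simp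
  have e2: "BI_functional \<Omega> \<rho> \<phi> \<le> BI_functional \<Omega> \<rho> \<psi>" by (rule \<phi>min(2)[OF \<psi>min(1)])
  have e3: "BI_functional \<Omega> \<sigma> \<psi> \<le> BI_functional \<Omega> \<sigma> \<phi>" by (rule \<psi>min(2)[OF \<phi>min(1)])
  \<comment> \<open>The inequality holds exactly for the perturbed potential: the values of \<psi>
    under the two functionals differ by t * (pairing - \<psi> a), and \<open>e1\<close> with
    \<open>e2\<close> gives this difference its sign.\<close>
  have "t * (pairing \<Omega> \<rho> \<psi> - \<psi> a) \<le> 0" using e1 e2 I\<sigma>[OF h] by linarith
  then have key: "pairing \<Omega> \<rho> \<psi> \<le> \<psi> a" using t(1) by (simp add: mult_le_0_iff)
  define u where "u x = \<psi> x - \<phi> x" for x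
  define S where "S = sqnorm (\<lambda>x. h x - g x)"
  have S: "S \<ge> 0" unfolding S_def by (rule sqnorm_nonneg)
  have u_le: "\<bar>u x\<bar> ^ DIM('a) \<le> C * S" for x unfolding u_def S_def by (rule C(2)[OF h g])
  have u_cont: "continuous_on UNIV u" unfolding u_def[abs_def] by (intro continuous_on_diff XgD(4)[OF h] XgD(4)[OF g])
  have pu: "pairing \<Omega> \<rho> u = pairing \<Omega> \<rho> \<psi> - pairing \<Omega> \<rho> \<phi>"
    unfolding u_def[abs_def] by (rule pairing_diff[OF \<rho> \<Omega> XgD(4)[OF h] XgD(4)[OF g]])
  have u1: "\<bar>u x\<bar> \<le> 1 + C * S" for x
    using power_dim_bound[of "DIM('a)" "\<bar>u x\<bar>"] dim u_le[of x] by linarith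
  \<comment> \<open>Stability: since \<phi> minimizes for \<rho>, S is bounded by the excess of
    \<psi>; since \<psi> minimizes for \<sigma>, that excess is at most t times a quantity linear in
    u.\<close>
  have "S / 4 + 2 * BI_functional \<Omega> \<rho> (\<lambda>x. 1/2 * \<psi> x + 1/2 * \<phi> x) \<le> BI_functional \<Omega> \<rho> \<psi> + BI_functional \<Omega> \<rho> \<phi>"
    unfolding S_def by (rule BI_convex[OF h g \<rho> \<Omega>])
  moreover have "BI_functional \<Omega> \<rho> \<phi> \<le> BI_functional \<Omega> \<rho> (\<lambda>x. 1/2 * \<psi> x + 1/2 * \<phi> x)"
    by (rule \<phi>min(2)[OF Xg_X_space[OF Xg_midpoint[OF h g]]])
  ultimately have "S / 4 \<le> BI_functional \<Omega> \<rho> \<psi> - BI_functional \<Omega> \<rho> \<phi>" by linarith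
  also have "\<dots> \<le> t * (u a - pairing \<Omega> \<rho> u)"
    using e3 unfolding I\<sigma>[OF h] I\<sigma>[OF g] pu u_def by (simp add: algebra_simps)
  also have "\<dots> \<le> t * (2 * (1 + C * S))"
    using pairing_bound[OF \<rho> \<Omega> u_cont u1] u1[of a] t(1) by (intro mult_left_mono) auto
  finally have "S / 4 \<le> 2 * t + 2 * (t * C) * S" by (simp add: algebra_simps)
  moreover have "16 * (t * C) * S \<le> 1 * S" using tC S by (rule mult_right_mono)
  ultimately have "S \<le> 16 * t" by linarith
  then have "C * S \<le> C * (16 * t)" using C(1) by (intro mult_left_mono) auto
  then have CS: "C * S < d ^ DIM('a)" using tC' by (simp add: mult_ac)
  have u2: "\<bar>u x\<bar> \<le> d" for x
  proof -
    have "\<bar>u x\<bar> ^ DIM('a) < d ^ DIM('a)" using u_le[of x] CS by linarith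
    then have "\<bar>u x\<bar> < d" by (rule power_less_imp_less_base) (use d in simp)
    then show ?thesis by simp
  qed
  have "\<bar>pairing \<Omega> \<rho> u\<bar> \<le> d" by (rule pairing_bound[OF \<rho> \<Omega> u_cont u2])
  then have "pairing \<Omega> \<rho> \<phi> \<le> pairing \<Omega> \<rho> \<psi> + d" using pu by linarith
  also have "\<dots> \<le> \<psi> a + d" using key by simp
  also have "\<dots> \<le> \<phi> a + e" using u2[of a] unfolding u_def d_def by linarith
  finally show "pairing \<Omega> \<rho> (potential \<Omega> \<rho>) \<le> potential \<Omega> \<rho> a + e" unfolding \<phi>_def .
qed

section \<open>Truncation\<close>

text \<open>Mollifying w gives test functions whose gradients are mollifications of g. Both have
  components bounded by 1, so a squared difference is at most twice its absolute value, and the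
  $L^1$ convergence of \<open>conv_L1\<close> becomes $L^2$ convergence.\<close>

lemma D12g_compact_support:
  fixes w :: "'a::euclidean_space \<Rightarrow> real"
  assumes g: "is_weak_grad w g" and w: "continuous_on UNIV w" "\<And>x. R < norm x \<Longrightarrow> w x = 0"
    and g_bound: "\<And>x. norm (g x) \<le> 1" and g_supp: "\<And>x. R < norm x \<Longrightarrow> g x = 0"
  shows "D12g w g"
proof -
  have lw: "loc_integrable w" and lg: "loc_integrable g" using weak_grad_loc_integrable[OF g] by auto
  have [measurable]: "w \<in> borel_measurable borel" "g \<in> borel_measurable borel"
    using lw lg by (auto intro: loc_integrable_measurable)
  have supp_int: "integrable lborel f" if "loc_integrable f" "\<And>x. R < norm x \<Longrightarrow> f x = 0" for f :: "'a \<Rightarrow> real"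
  proof -
    have "integrable lborel (\<lambda>x. indicator (cball 0 R) x *\<^sub>R f x)"
      using that(1) unfolding loc_integrable_def set_integrable_def by auto
    moreover have "(\<lambda>x. indicator (cball 0 R) x *\<^sub>R f x) = f"
      using that(2) by (auto simp: indicator_def fun_eq_iff not_le)
    ultimately show ?thesis by simp
  qed
  have iw: "integrable lborel w" by (rule supp_int[OF lw w(2)])
  have ig: "integrable lborel (\<lambda>x. g x \<bullet> b)" for b by (rule supp_int[OF loc_integrable_inner[OF lg]]) (simp add: g_supp)
  define \<psi> where "\<psi> n = conv w (mollifier n)" for n
  have \<psi>: "\<psi> n \<in> test_functions" for n unfolding \<psi>_def by (rule conv_test[OF lw mollifier_test w(2)])
  have [measurable]: "gradient (\<psi> n) \<in> borel_measurable borel" for n by (rule gradient_measurable[OF \<psi>])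
  have gb: "\<bar>g x \<bullet> b\<bar> \<le> 1" if "b \<in> Basis" for x b
    using Basis_le_norm[OF that, of "g x"] g_bound[of x] by linarith
  have cb: "\<bar>conv (\<lambda>x. g x \<bullet> b) (mollifier n) y\<bar> \<le> 1" if b: "b \<in> Basis" for b n y
  proof -
    have m: "(\<lambda>x. mollifier n (x - y)) \<in> test_functions" by (intro test_shift mollifier_test)
    have "\<bar>conv (\<lambda>x. g x \<bullet> b) (mollifier n) y\<bar> \<le> (LINT x|lborel. \<bar>(g x \<bullet> b) * mollifier n (x - y)\<bar>)"
      unfolding conv_def by (rule integral_abs_bound)
    also have "\<dots> \<le> (LINT x|lborel. mollifier n (x - y))"
    proof (rule integral_mono)
      show "integrable lborel (\<lambda>x. \<bar>(g x \<bullet> b) * mollifier n (x - y)\<bar>)"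
        by (intro integrable_abs integrable_mult_test loc_integrable_inner lg m)
      show "integrable lborel (\<lambda>x. mollifier n (x - y))" by (rule integrable_test[OF m])
      show "\<bar>(g x \<bullet> b) * mollifier n (x - y)\<bar> \<le> mollifier n (x - y)" for x
        using mult_right_mono[OF gb[OF b, of x] mollifier_nonneg[of n "x - y"]]
        by (simp add: abs_mult mollifier_nonneg)
    qed
    also have "\<dots> = 1"
      using integral_shift[OF test_measurable[OF mollifier_test], of n "- y"] by (simp add: mollifier_integral)
    finally show ?thesis .
  qed
  define E where "E b n = (\<integral>\<^sup>+y. ennreal \<bar>conv (\<lambda>x. g x \<bullet> b) (mollifier n) y - g y \<bullet> b\<bar> \<partial>lborel)" for b n
  have E: "E b \<longlonglongrightarrow> 0" for b unfolding E_def by (rule conv_L1[OF ig])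
  have sq: "sqdist (gradient (\<psi> n)) g \<le> (\<Sum>b\<in>Basis. ennreal 2 * E b n)" for n
  proof -
    have mb [measurable]: "conv (\<lambda>x. g x \<bullet> b) (mollifier n) \<in> borel_measurable borel" for b
      by (intro test_measurable conv_test[where R = R] loc_integrable_inner lg mollifier_test) (simp add: g_supp)
    have "sqdist (gradient (\<psi> n)) g \<le>
        (\<integral>\<^sup>+y. (\<Sum>b\<in>Basis. ennreal 2 * ennreal \<bar>conv (\<lambda>x. g x \<bullet> b) (mollifier n) y - g y \<bullet> b\<bar>) \<partial>lborel)"
      unfolding sqdist_def
    proof (rule nn_integral_mono)
      fix y
      have "(norm (gradient (\<psi> n) y - g y))\<^sup>2 = (\<Sum>b\<in>Basis. ((gradient (\<psi> n) y - g y) \<bullet> b)\<^sup>2)"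
        unfolding power2_norm_eq_inner by (subst euclidean_inner) (simp add: power2_eq_square)
      also have "\<dots> \<le> (\<Sum>b\<in>Basis. 2 * \<bar>conv (\<lambda>x. g x \<bullet> b) (mollifier n) y - g y \<bullet> b\<bar>)"
      proof (rule sum_mono)
        fix b :: 'a assume b: "b \<in> Basis"
        define D where "D = \<bar>conv (\<lambda>x. g x \<bullet> b) (mollifier n) y - g y \<bullet> b\<bar>"
        have "(gradient (\<psi> n) y - g y) \<bullet> b = conv (\<lambda>x. g x \<bullet> b) (mollifier n) y - g y \<bullet> b"
          unfolding \<psi>_def inner_diff_left gradient_conv_weak[OF g mollifier_test b] ..
        then have "((gradient (\<psi> n) y - g y) \<bullet> b)\<^sup>2 = D * D" unfolding D_def by (simp add: power2_eq_square)
        moreover have "D \<le> 2" using cb[OF b, of n y] gb[OF b, of y] unfolding D_def by linarith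
        moreover have "D \<ge> 0" by (simp add: D_def)
        ultimately show "((gradient (\<psi> n) y - g y) \<bullet> b)\<^sup>2 \<le> 2 * \<bar>conv (\<lambda>x. g x \<bullet> b) (mollifier n) y - g y \<bullet> b\<bar>"
          unfolding D_def[symmetric] using mult_right_mono[of D 2 D] by simp
      qed
      finally have "ennreal ((norm (gradient (\<psi> n) y - g y))\<^sup>2) \<le> ennreal (\<Sum>b\<in>Basis. 2 * \<bar>conv (\<lambda>x. g x \<bullet> b) (mollifier n) y - g y \<bullet> b\<bar>)"
        by (rule ennreal_leI)
      then show "ennreal ((norm (gradient (\<psi> n) y - g y))\<^sup>2) \<le> (\<Sum>b\<in>Basis. ennreal 2 * ennreal \<bar>conv (\<lambda>x. g x \<bullet> b) (mollifier n) y - g y \<bullet> b\<bar>)"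
        by (simp add: sum_ennreal[symmetric] ennreal_mult)
    qed
    also have "\<dots> = (\<Sum>b\<in>Basis. ennreal 2 * E b n)"
      unfolding E_def by (subst nn_integral_sum) (auto simp: nn_integral_cmult)
    finally show ?thesis .
  qed
  have "(\<lambda>n. \<Sum>b\<in>(Basis::'a set). ennreal 2 * E b n) \<longlonglongrightarrow> (\<Sum>b\<in>(Basis::'a set). ennreal 2 * 0)"
    by (intro tendsto_sum ennreal_tendsto_cmult E) simp
  then have lim: "(\<lambda>n. \<Sum>b\<in>(Basis::'a set). ennreal 2 * E b n) \<longlonglongrightarrow> 0" by simp
  have "(\<lambda>n. sqdist (gradient (\<psi> n)) g) \<longlonglongrightarrow> 0"
  proof (rule tendsto_sandwich[OF _ _ tendsto_const lim])
    show "\<forall>\<^sub>F n in sequentially. sqdist (gradient (\<psi> n)) g \<le> (\<Sum>b\<in>Basis. ennreal 2 * E b n)"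
      by (rule eventually_sequentiallyI[of 0]) (rule sq)
  qed simp
  moreover have "(\<lambda>n. \<integral>\<^sup>+x\<in>cball 0 S. ennreal \<bar>\<psi> n x - w x\<bar> \<partial>lborel) \<longlonglongrightarrow> 0" for S
    unfolding \<psi>_def
  proof (rule tendsto_sandwich[OF _ _ tendsto_const conv_L1[OF iw]])
    show "\<forall>\<^sub>F n in sequentially. (\<integral>\<^sup>+x\<in>cball 0 S. ennreal \<bar>conv w (mollifier n) x - w x\<bar> \<partial>lborel) \<le>
        (\<integral>\<^sup>+x. ennreal \<bar>conv w (mollifier n) x - w x\<bar> \<partial>lborel)"
      by (rule eventually_sequentiallyI[of 0]) (rule nn_set_integral_le)
  qed simp
  ultimately show ?thesis unfolding D12g_def using \<psi> by (intro conjI exI[of _ \<psi>]) auto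
qed

section \<open>Difference quotients and weak gradients\<close>

lemma GDERIV_quotient:
  fixes F :: "'a::euclidean_space \<Rightarrow> real"
  assumes "GDERIV F 0 :> D"
  shows "(\<lambda>n. (F (inverse (real (Suc n)) *\<^sub>R v) - F 0) / inverse (real (Suc n))) \<longlonglongrightarrow> v \<bullet> D"
proof -
  have "((\<lambda>s. F (s *\<^sub>R v)) has_derivative (\<lambda>s. (s *\<^sub>R v) \<bullet> D)) (at 0)"
    by (rule has_derivative_compose[of "\<lambda>s. s *\<^sub>R v" "\<lambda>s. s *\<^sub>R v"])
      (use assms in \<open>auto simp: gderiv_def intro!: derivative_eq_intros\<close>)
  then have "DERIV (\<lambda>s. F (s *\<^sub>R v)) 0 :> v \<bullet> D"
    unfolding has_field_derivative_def by (rule has_derivative_subst) (auto simp: mult.commute)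
  then have "((\<lambda>s. (F (s *\<^sub>R v) - F 0) / s) \<longlongrightarrow> v \<bullet> D) (at 0)"
    unfolding DERIV_def by simp
  moreover have "filterlim (\<lambda>n. inverse (real (Suc n))) (at 0) sequentially"
    unfolding filterlim_at using LIMSEQ_inverse_real_of_nat by auto
  ultimately show ?thesis by (rule filterlim_compose)
qed

text \<open>Moving the shift onto \<theta> turns the integral into a difference quotient of
  \<open>conv f \<theta>\<close> at 0 in direction - b. This sign cancels the one in
  \<open>gradient_conv\<close>.\<close>

lemma quotient_test:
  fixes f :: "'a::euclidean_space \<Rightarrow> real"
  assumes f: "loc_integrable f" and \<theta>: "\<theta> \<in> test_functions" and b: "b \<in> Basis"
  shows "(\<lambda>n. LINT x|lborel. (f (x - inverse (real (Suc n)) *\<^sub>R b) - f x) / inverse (real (Suc n)) * \<theta> x)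
    \<longlonglongrightarrow> (LINT x|lborel. f x * (gradient \<theta> x \<bullet> b))"
proof -
  have G: "GDERIV (conv f \<theta>) 0 :> gradient (conv f \<theta>) 0"
    using conv_GDERIV[OF f \<theta>, of 0] GDERIV_gradient by metis
  have lim: "(- b) \<bullet> gradient (conv f \<theta>) 0 = (LINT x|lborel. f x * (gradient \<theta> x \<bullet> b))"
    using gradient_conv[OF f \<theta> b, of 0] by (simp add: inner_commute conv_def)
  have [measurable]: "f \<in> borel_measurable borel" "\<theta> \<in> borel_measurable borel"
    using f \<theta> by (auto intro: loc_integrable_measurable test_measurable)
  have "(conv f \<theta> (inverse (real (Suc n)) *\<^sub>R (- b)) - conv f \<theta> 0) / inverse (real (Suc n)) =
      (LINT x|lborel. (f (x - inverse (real (Suc n)) *\<^sub>R b) - f x) / inverse (real (Suc n)) * \<theta> x)" for n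
  proof -
    define s where "s = inverse (real (Suc n))"
    have i0: "integrable lborel (\<lambda>x. f x * \<theta> x)" by (rule integrable_mult_test[OF f \<theta>])
    have "integrable lborel (\<lambda>x. f x * \<theta> (x - (- s *\<^sub>R b)))" by (rule integrable_mult_test[OF f test_shift[OF \<theta>]])
    from integrable_shift[OF this, of "- s *\<^sub>R b"]
    have i1: "integrable lborel (\<lambda>x. f (x - s *\<^sub>R b) * \<theta> x)" by simp
    have e1: "conv f \<theta> (s *\<^sub>R (- b)) = (LINT x|lborel. f (x - s *\<^sub>R b) * \<theta> x)"
      unfolding conv_def using integral_shift[of "\<lambda>x. f x * \<theta> (x - (- s *\<^sub>R b))" "- s *\<^sub>R b"] by simp
    have e2: "conv f \<theta> 0 = (LINT x|lborel. f x * \<theta> x)" by (simp add: conv_def)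
    have e3: "(LINT x|lborel. (f (x - s *\<^sub>R b) - f x) / s * \<theta> x) = (LINT x|lborel. (f (x - s *\<^sub>R b) * \<theta> x - f x * \<theta> x) / s)"
      by (intro Bochner_Integration.integral_cong) (auto simp: left_diff_distrib)
    have e4: "(LINT x|lborel. (f (x - s *\<^sub>R b) * \<theta> x - f x * \<theta> x) / s) = ((LINT x|lborel. f (x - s *\<^sub>R b) * \<theta> x) - (LINT x|lborel. f x * \<theta> x)) / s"
      by (simp only: integral_divide_zero Bochner_Integration.integral_diff[OF i1 i0])
    show ?thesis unfolding s_def[symmetric] by (simp only: e1 e2 e3 e4)
  qed
  then show ?thesis using GDERIV_quotient[OF G, of "- b"] unfolding lim by simp
qed

lemma quotient_bound:
  fixes f :: "'a::euclidean_space \<Rightarrow> real"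
  assumes "1-lipschitz_on UNIV f" "b \<in> Basis"
  shows "\<bar>(f (x - inverse (real (Suc n)) *\<^sub>R b) - f x) / inverse (real (Suc n))\<bar> \<le> 1"
proof -
  define s where "s = inverse (real (Suc n))"
  have s: "s > 0" by (simp add: s_def)
  have "\<bar>f (x - s *\<^sub>R b) - f x\<bar> \<le> s"
    using lipschitz_onD[OF assms(1), of "x - s *\<^sub>R b" x] s assms(2) by (simp add: dist_norm)
  then show ?thesis unfolding s_def[symmetric] abs_divide using s by simp
qed

text \<open>Extends \<open>quotient_test\<close> from test functions to integrable \<theta>, as
  needed for a test function cut off by an indicator. Approximating \<theta> in $L^1$ works because
  the quotients and the components of g are bounded by 1.\<close>

lemma quotient_L1:
  fixes \<phi> :: "'a::euclidean_space \<Rightarrow> real"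
  assumes g: "is_weak_grad \<phi> g" and L: "1-lipschitz_on UNIV \<phi>" and bound: "\<And>x. norm (g x) \<le> 1"
    and \<theta>: "integrable lborel \<theta>" "\<And>x. R < norm x \<Longrightarrow> \<theta> x = 0" and b: "b \<in> Basis"
  shows "(\<lambda>n. LINT x|lborel. (\<phi> (x - inverse (real (Suc n)) *\<^sub>R b) - \<phi> x) / inverse (real (Suc n)) * \<theta> x)
    \<longlonglongrightarrow> - (LINT x|lborel. (g x \<bullet> b) * \<theta> x)"
proof -
  have l\<phi>: "loc_integrable \<phi>" and lg: "loc_integrable g" using weak_grad_loc_integrable[OF g] by auto
  have [measurable]: "\<phi> \<in> borel_measurable borel" "g \<in> borel_measurable borel" "\<theta> \<in> borel_measurable borel"
    using l\<phi> lg \<theta>(1) by (auto intro: loc_integrable_measurable)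
  define Q where "Q n x = (\<phi> (x - inverse (real (Suc n)) *\<^sub>R b) - \<phi> x) / inverse (real (Suc n))" for n x
  have Q: "\<bar>Q n x\<bar> \<le> 1" for n x unfolding Q_def by (rule quotient_bound[OF L b])
  have [measurable]: "Q n \<in> borel_measurable borel" for n unfolding Q_def[abs_def] by measurable
  have gb: "\<bar>g x \<bullet> b\<bar> \<le> 1" for x using Basis_le_norm[OF b, of "g x"] bound[of x] by linarith
  have bmul: "integrable lborel (\<lambda>x. q x * f x)" "\<bar>LINT x|lborel. q x * f x\<bar> \<le> (LINT x|lborel. \<bar>f x\<bar>)"
    if q: "q \<in> borel_measurable borel" "\<And>x. \<bar>q x\<bar> \<le> 1" and f: "integrable lborel f" for q f :: "'a \<Rightarrow> real"
  proof -
    have le: "\<bar>q x * f x\<bar> \<le> \<bar>f x\<bar>" for x using mult_right_mono[OF q(2)[of x], of "\<bar>f x\<bar>"] by (simp add: abs_mult)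
    show i: "integrable lborel (\<lambda>x. q x * f x)"
      by (rule Bochner_Integration.integrable_bound[OF f]) (use q f le in auto)
    have "\<bar>LINT x|lborel. q x * f x\<bar> \<le> (LINT x|lborel. \<bar>q x * f x\<bar>)" by (rule integral_abs_bound)
    also have "\<dots> \<le> (LINT x|lborel. \<bar>f x\<bar>)" by (intro integral_mono integrable_abs i f le)
    finally show "\<bar>LINT x|lborel. q x * f x\<bar> \<le> (LINT x|lborel. \<bar>f x\<bar>)" .
  qed
  have "(\<lambda>n. LINT x|lborel. Q n x * \<theta> x) \<longlonglongrightarrow> - (LINT x|lborel. (g x \<bullet> b) * \<theta> x)"
  proof (rule LIMSEQ_I)
    fix e :: real assume "e > 0"
    then have e3: "e / 3 > 0" by simp
    obtain k where k0: "(\<integral>\<^sup>+y. ennreal \<bar>conv \<theta> (mollifier k) y - \<theta> y\<bar> \<partial>lborel) < ennreal (e / 3)"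
      by (rule ennreal_tendsto_zeroD[OF conv_L1[OF \<theta>(1)] e3]) blast
    define \<zeta> where "\<zeta> = conv \<theta> (mollifier k)"
    have \<zeta>: "\<zeta> \<in> test_functions"
      unfolding \<zeta>_def by (rule conv_test[OF loc_integrable_integrable[OF \<theta>(1)] mollifier_test \<theta>(2)])
    have id: "integrable lborel (\<lambda>x. \<zeta> x - \<theta> x)" by (intro Bochner_Integration.integrable_diff integrable_test \<zeta> \<theta>(1))
    have k: "(LINT x|lborel. \<bar>\<zeta> x - \<theta> x\<bar>) < e / 3"
    proof -
      have eq: "ennreal (LINT x|lborel. \<bar>\<zeta> x - \<theta> x\<bar>) = (\<integral>\<^sup>+y. ennreal \<bar>\<zeta> y - \<theta> y\<bar> \<partial>lborel)"
        by (rule nn_integral_eq_integral[OF integrable_abs[OF id], symmetric]) simp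
      show ?thesis using k0 unfolding \<zeta>_def[symmetric] eq[symmetric]
        by (subst (asm) ennreal_less_iff) auto
    qed
    have "(\<lambda>n. LINT x|lborel. Q n x * \<zeta> x) \<longlonglongrightarrow> - (LINT x|lborel. (g x \<bullet> b) * \<zeta> x)"
      unfolding Q_def weak_gradD[OF g \<zeta> b, symmetric] by (rule quotient_test[OF l\<phi> \<zeta> b])
    from LIMSEQ_D[OF this e3] obtain N where N: "\<And>n. n \<ge> N \<Longrightarrow>
        \<bar>(LINT x|lborel. Q n x * \<zeta> x) - - (LINT x|lborel. (g x \<bullet> b) * \<zeta> x)\<bar> < e / 3" by auto
    have "\<bar>(LINT x|lborel. Q n x * \<theta> x) - - (LINT x|lborel. (g x \<bullet> b) * \<theta> x)\<bar> < e" if "n \<ge> N" for n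
    proof -
      have d: "(LINT x|lborel. q x * \<zeta> x) - (LINT x|lborel. q x * \<theta> x) = (LINT x|lborel. q x * (\<zeta> x - \<theta> x))"
        if "q \<in> borel_measurable borel" "\<And>x. \<bar>q x\<bar> \<le> 1" for q
        using Bochner_Integration.integral_diff[OF bmul(1)[OF that integrable_test[OF \<zeta>]] bmul(1)[OF that \<theta>(1)]]
        by (simp add: right_diff_distrib)
      have "\<bar>(LINT x|lborel. Q n x * \<zeta> x) - (LINT x|lborel. Q n x * \<theta> x)\<bar> < e / 3"
        unfolding d[of "Q n", OF _ Q, simplified] using bmul(2)[of "Q n", OF _ Q id] k by simp
      moreover have "\<bar>(LINT x|lborel. (g x \<bullet> b) * \<zeta> x) - (LINT x|lborel. (g x \<bullet> b) * \<theta> x)\<bar> < e / 3"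
        unfolding d[of "\<lambda>x. g x \<bullet> b", OF _ gb, simplified] using bmul(2)[of "\<lambda>x. g x \<bullet> b", OF _ gb id] k by simp
      ultimately show ?thesis using N[OF that] by argo
    qed
    then show "\<exists>N. \<forall>n\<ge>N. norm ((LINT x|lborel. Q n x * \<theta> x) - - (LINT x|lborel. (g x \<bullet> b) * \<theta> x)) < e"
      unfolding real_norm_def by blast
  qed
  then show ?thesis unfolding Q_def .
qed

text \<open>The difference quotients of \<open>w\<close> and of \<open>1\<^sub>A \<phi>\<close> differ only where exactly one of \<open>x\<close> and the
  shifted point lies in \<open>A\<close>, and the measure of that set tends to 0.\<close>

lemma weak_grad_cutoff:
  fixes \<phi> w :: "'a::euclidean_space \<Rightarrow> real"
  assumes g: "is_weak_grad \<phi> g" and L: "1-lipschitz_on UNIV \<phi>" and bound: "\<And>x. norm (g x) \<le> 1"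
    and A: "open A" "A \<subseteq> cball 0 R" and w: "1-lipschitz_on UNIV w" "\<And>x. w x = (if x \<in> A then \<phi> x - c else 0)"
  shows "is_weak_grad w (\<lambda>x. indicator A x *\<^sub>R g x)"
proof -
  have lg: "loc_integrable g" using weak_grad_loc_integrable[OF g] by auto
  have [measurable]: "g \<in> borel_measurable borel" using lg by (rule loc_integrable_measurable)
  have [measurable]: "A \<in> sets borel" using A by simp
  have wc: "continuous_on UNIV w" using w(1) by (rule lipschitz_on_continuous_on)
  have lw: "loc_integrable w" by (rule loc_integrable_continuous[OF wc])
  have [measurable]: "w \<in> borel_measurable borel" "\<phi> \<in> borel_measurable borel"
    using wc lipschitz_on_continuous_on[OF L] by (auto intro: borel_measurable_continuous_onI)
  have finA: "emeasure lborel A < \<infinity>"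
  proof -
    have "emeasure lborel A \<le> emeasure lborel (cball (0::'a) R)" using A(2) by (intro emeasure_mono) auto
    also have "\<dots> < \<infinity>" using emeasure_compact_finite[of "cball (0::'a) R"] by simp
    finally show ?thesis .
  qed
  have lAg: "loc_integrable (\<lambda>x. indicator A x *\<^sub>R g x)"
    by (rule loc_integrable_bounded[where B = 1]) (use bound in \<open>auto simp: indicator_def\<close>)
  have "(LINT x|lborel. w x * (gradient \<psi> x \<bullet> b)) = - (LINT x|lborel. ((indicator A x *\<^sub>R g x) \<bullet> b) * \<psi> x)"
    if \<psi>: "\<psi> \<in> test_functions" and b: "b \<in> Basis" for \<psi> b
  proof -
    define s where "s n = inverse (real (Suc n))" for n
    define Qw where "Qw n x = (w (x - s n *\<^sub>R b) - w x) / s n" for n x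
    define Q where "Q n x = (\<phi> (x - s n *\<^sub>R b) - \<phi> x) / s n" for n x
    obtain B where B: "B \<ge> 0" "\<And>x. \<bar>\<psi> x\<bar> \<le> B" by (rule test_bounded[OF \<psi>]) (rule that)
    have [measurable]: "Qw n \<in> borel_measurable borel" "Q n \<in> borel_measurable borel" for n
      unfolding Qw_def[abs_def] Q_def[abs_def] by measurable
    have [measurable]: "\<psi> \<in> borel_measurable borel" by (rule test_measurable[OF \<psi>])
    have Q1: "\<bar>Q n x\<bar> \<le> 1" and Qw1: "\<bar>Qw n x\<bar> \<le> 1" for n x
      unfolding Q_def Qw_def s_def by (rule quotient_bound[OF L b], rule quotient_bound[OF w(1) b])
    define \<theta> where "\<theta> x = indicator A x * \<psi> x" for x
    have i\<psi>: "integrable lborel \<psi>" by (rule integrable_test[OF \<psi>])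
    have \<theta>: "integrable lborel \<theta>"
      unfolding \<theta>_def[abs_def] using integrable_mult_indicator[of A lborel \<psi>] i\<psi> by simp
    have \<theta>0: "\<theta> x = 0" if "R < norm x" for x
      using A(2) that by (auto simp: \<theta>_def indicator_def)
    have lim1: "(\<lambda>n. LINT x|lborel. Qw n x * \<psi> x) \<longlonglongrightarrow> (LINT x|lborel. w x * (gradient \<psi> x \<bullet> b))"
      unfolding Qw_def s_def by (rule quotient_test[OF lw \<psi> b])
    have lim2: "(\<lambda>n. LINT x|lborel. Q n x * \<theta> x) \<longlonglongrightarrow> - (LINT x|lborel. (g x \<bullet> b) * \<theta> x)"
      unfolding Q_def s_def by (rule quotient_L1[OF g L bound \<theta> \<theta>0 b])
    have iw: "integrable lborel (\<lambda>x. Qw n x * \<psi> x)" for n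
      by (intro integrable_mult_test \<psi> loc_integrable_bounded[where B = 1]) (auto simp: Qw1)
    have iq: "integrable lborel (\<lambda>x. Q n x * \<theta> x)" for n
    proof (rule Bochner_Integration.integrable_bound[OF \<theta>])
      show "(\<lambda>x. Q n x * \<theta> x) \<in> borel_measurable lborel" unfolding \<theta>_def by measurable
      have "\<bar>Q n x * \<theta> x\<bar> \<le> \<bar>\<theta> x\<bar>" for x using mult_right_mono[OF Q1[of n x], of "\<bar>\<theta> x\<bar>"] by (simp add: abs_mult)
      then show "AE x in lborel. norm (Q n x * \<theta> x) \<le> norm (\<theta> x)" by simp
    qed
    have shift: "(\<lambda>n. - (s n *\<^sub>R b)) \<longlonglongrightarrow> 0"
      unfolding s_def using tendsto_minus[OF tendsto_scaleR[OF LIMSEQ_inverse_real_of_nat tendsto_const[of b]]] by simp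
    define T where "T n = (\<integral>\<^sup>+x. ennreal \<bar>indicat_real A (x + - (s n *\<^sub>R b)) - indicat_real A x\<bar> \<partial>lborel)" for n
    have T: "T \<longlonglongrightarrow> 0" unfolding T_def by (rule translation_open[OF A(1) finA shift])
    have "(\<lambda>n. \<integral>\<^sup>+x. ennreal \<bar>Qw n x * \<psi> x - Q n x * \<theta> x\<bar> \<partial>lborel) \<longlonglongrightarrow> 0"
    proof (rule tendsto_ennreal_lincomb_zero[OF T T, of _ "2 * B" 0])
      fix n
      have "(\<integral>\<^sup>+x. ennreal \<bar>Qw n x * \<psi> x - Q n x * \<theta> x\<bar> \<partial>lborel) \<le>
          (\<integral>\<^sup>+x. ennreal (2 * B) * ennreal \<bar>indicat_real A (x + - (s n *\<^sub>R b)) - indicat_real A x\<bar> \<partial>lborel)"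
      proof (rule nn_integral_mono)
        fix x
        have s: "s n > 0" by (simp add: s_def)
        have eq: "Qw n x * \<psi> x - Q n x * \<theta> x = (Qw n x - Q n x * indicator A x) * \<psi> x"
          by (simp add: \<theta>_def algebra_simps)
        \<comment> \<open>If x and the shifted point both lie in A, the constant c cancels and the
          quotients agree; if both lie outside, both terms vanish. Otherwise two quantities bounded
          by 1 differ by at most 2.\<close>
        have "\<bar>Qw n x - Q n x * indicator A x\<bar> \<le> 2 * \<bar>indicat_real A (x + - (s n *\<^sub>R b)) - indicat_real A x\<bar>"
        proof (cases "x \<in> A \<longleftrightarrow> x - s n *\<^sub>R b \<in> A")
          case True
          then have "Qw n x = Q n x * indicator A x"
            unfolding Qw_def Q_def by (simp add: w(2) indicator_def)
          then show ?thesis by simp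
        next
          case False
          then have one: "\<bar>indicat_real A (x + - (s n *\<^sub>R b)) - indicat_real A x\<bar> = 1" by (auto simp: indicator_def)
          have "\<bar>Q n x * indicator A x\<bar> \<le> 1" using Q1[of n x] by (simp add: indicator_def)
          then show ?thesis unfolding one using Qw1[of n x] by linarith
        qed
        then have "\<bar>Qw n x - Q n x * indicator A x\<bar> * \<bar>\<psi> x\<bar> \<le> (2 * \<bar>indicat_real A (x + - (s n *\<^sub>R b)) - indicat_real A x\<bar>) * B"
          using B by (intro mult_mono) auto
        then have "\<bar>Qw n x * \<psi> x - Q n x * \<theta> x\<bar> \<le> (2 * B) * \<bar>indicat_real A (x + - (s n *\<^sub>R b)) - indicat_real A x\<bar>"
          unfolding eq abs_mult by (simp add: mult_ac)
        from ennreal_leI[OF this]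
        show "ennreal \<bar>Qw n x * \<psi> x - Q n x * \<theta> x\<bar> \<le> ennreal (2 * B) * ennreal \<bar>indicat_real A (x + - (s n *\<^sub>R b)) - indicat_real A x\<bar>"
          using B(1) by (subst (asm) ennreal_mult) auto
      qed
      also have "\<dots> = ennreal (2 * B) * T n" unfolding T_def by (rule nn_integral_cmult) measurable
      finally show "(\<integral>\<^sup>+x. ennreal \<bar>Qw n x * \<psi> x - Q n x * \<theta> x\<bar> \<partial>lborel) \<le> ennreal (2 * B) * T n + ennreal 0 * T n" by simp
    qed
    then have "(\<lambda>n. \<integral>\<^sup>+x. ennreal (norm ((Qw n x * \<psi> x - Q n x * \<theta> x) - 0)) \<partial>lborel) \<longlonglongrightarrow> 0" by simp
    from tendsto_L1_int[OF Bochner_Integration.integrable_diff[OF iw iq] integrable_zero this]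
    have "(\<lambda>n. (LINT x|lborel. Qw n x * \<psi> x) - (LINT x|lborel. Q n x * \<theta> x)) \<longlonglongrightarrow> 0"
      unfolding Bochner_Integration.integral_diff[OF iw iq] by simp
    from tendsto_add[OF this lim2]
    have "(\<lambda>n. LINT x|lborel. Qw n x * \<psi> x) \<longlonglongrightarrow> - (LINT x|lborel. (g x \<bullet> b) * \<theta> x)" by simp
    from LIMSEQ_unique[OF lim1 this] show ?thesis by (simp add: \<theta>_def mult_ac)
  qed
  then show ?thesis using lw lAg unfolding is_weak_grad_def loc_integrable_def by blast
qed

text \<open>The critical case is x in A and y outside. The segment between them meets the frontier
  of A at some z, where \<phi> takes the value c, so the difference is |\<phi> x - \<phi> z| with z
  no farther from x than y.\<close>

lemma cutoff_lipschitz: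
  fixes \<phi> w :: "'a::euclidean_space \<Rightarrow> real"
  assumes L: "1-lipschitz_on UNIV \<phi>" and A: "open A" and fr: "\<And>z. z \<in> frontier A \<Longrightarrow> \<phi> z = c"
    and w: "\<And>x. w x = (if x \<in> A then \<phi> x - c else 0)"
  shows "1-lipschitz_on UNIV w"
proof (rule lipschitz_onI)
  have mixed: "dist (w x) (w y) \<le> dist x y" if "x \<in> A" "y \<notin> A" for x y
  proof -
    have "closed_segment x y \<inter> frontier A \<noteq> {}"
      by (rule connected_Int_frontier[OF connected_segment(1)]) (use that in auto)
    then obtain z where z: "z \<in> closed_segment x y" "z \<in> frontier A" by blast
    have "dist (w x) (w y) = dist (\<phi> x) (\<phi> z)" using that by (simp add: w fr[OF z(2)] dist_real_def)
    also have "\<dots> \<le> dist x z" using lipschitz_onD[OF L, of x z] by simp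
    also have "\<dots> \<le> dist x y" using dist_in_closed_segment[OF z(1)] by (simp add: dist_commute)
    finally show ?thesis .
  qed
  fix x y
  consider "x \<in> A" "y \<in> A" | "x \<in> A" "y \<notin> A" | "x \<notin> A" "y \<in> A" | "x \<notin> A" "y \<notin> A" by blast
  then show "dist (w x) (w y) \<le> 1 * dist x y"
  proof cases
    case 1
    then show ?thesis using lipschitz_onD[OF L, of x y] by (simp add: w dist_real_def)
  next
    case 2
    then show ?thesis using mixed[of x y] by simp
  next
    case 3
    then show ?thesis using mixed[of y x] by (simp add: dist_commute)
  next
    case 4
    then show ?thesis by (simp add: w)
  qed
qed simp

text \<open>Along small multiples s of a bump positive on the frontier the energy is of order s^2
  and the pairing of order s, so the minimum is negative. As the energy part is nonnegative, the
  pairing must be positive.\<close>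

lemma pairing_potential_pos:
  fixes \<Omega> :: "'a::euclidean_space set"
  assumes dim: "DIM('a) \<ge> 3" and \<rho>: "\<rho> \<in> prob_on_frontier \<Omega>" and \<Omega>: "bounded \<Omega>"
  shows "pairing \<Omega> \<rho> (potential \<Omega> \<rho>) > 0"
proof -
  have K: "compact (frontier \<Omega>)" by (rule compact_frontier_bounded[OF \<Omega>])
  have ne: "frontier \<Omega> \<noteq> {}" using prob_on_frontierD(3)[OF \<rho>] by auto
  obtain r where r: "\<forall>x\<in>frontier \<Omega>. norm x \<le> r" using compact_imp_bounded[OF K] bounded_iff by metis
  define \<beta> where "\<beta> = (bump (r + 1) :: 'a \<Rightarrow> real)"
  have \<beta>: "\<beta> \<in> test_functions" unfolding \<beta>_def by (rule bump_test)
  have \<beta>c: "continuous_on UNIV \<beta>" by (rule test_continuous[OF \<beta>])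
  obtain x0 where x0: "x0 \<in> frontier \<Omega>" "\<forall>x\<in>frontier \<Omega>. \<beta> x0 \<le> \<beta> x"
    using continuous_attains_inf[OF K ne continuous_on_subset[OF \<beta>c]] by blast
  have "norm x0 < r + 1" using r x0(1) by fastforce
  then have pos: "\<beta> x0 > 0" unfolding \<beta>_def by (rule bump_pos)
  have "\<beta> x0 \<le> pairing \<Omega> \<rho> \<beta>"
    using pairing_mono[OF \<rho> \<Omega> continuous_on_const \<beta>c, of "\<beta> x0"] x0(2) pairing_const[OF \<rho>] by simp
  then have p: "pairing \<Omega> \<rho> \<beta> > 0" using pos by linarith
  obtain B where B: "B \<ge> 0" "\<And>x. norm (gradient \<beta> x) \<le> B" by (rule test_bounded[OF \<beta>]) (rule that)
  define G where "G = sqnorm (gradient \<beta>)"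
  have G: "G \<ge> 0" unfolding G_def by (rule sqnorm_nonneg)
  \<comment> \<open>The first bound keeps the gradient of s times the bump within the unit ball, the
    second makes the linear term win. The summands 1 guard against zero denominators and make the
    second comparison strict.\<close>
  define s where "s = min (1 / (B + 1)) (pairing \<Omega> \<rho> \<beta> / (G + 1))"
  have s: "s > 0" "s \<le> 1 / (B + 1)" "s \<le> pairing \<Omega> \<rho> \<beta> / (G + 1)" using B(1) G p by (auto simp: s_def)
  have sB: "s * B \<le> 1"
  proof -
    have "s * B \<le> 1 / (B + 1) * (B + 1)" using s B(1) by (intro mult_mono) auto
    then show ?thesis using B(1) by simp
  qed
  have sG: "s * G < pairing \<Omega> \<rho> \<beta>"
  proof -
    have "s * (G + 1) \<le> pairing \<Omega> \<rho> \<beta>" using s(3) G by (simp add: field_simps)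
    then show ?thesis using s(1) by (simp add: distrib_left)
  qed
  have D: "D12g (\<lambda>x. s * \<beta> x) (\<lambda>x. s *\<^sub>R gradient \<beta> x)"
    using D12g_lincomb[OF D12g_test[OF \<beta>] D12g_test[OF \<beta>], of s 0] by simp
  have nb: "norm (s *\<^sub>R gradient \<beta> x) \<le> 1" for x
  proof -
    have "s * norm (gradient \<beta> x) \<le> s * B" using B(2) s(1) by (intro mult_left_mono) auto
    then have "s * norm (gradient \<beta> x) \<le> 1" using sB by linarith
    then show ?thesis using s(1) by simp
  qed
  have X: "Xg (\<lambda>x. s * \<beta> x) (\<lambda>x. s *\<^sub>R gradient \<beta> x)"
    unfolding Xg_def using D nb
    by (intro conjI weak_grad_bounded_lipschitz[OF D12g_is_weak_grad[OF D]] continuous_intros \<beta>c) auto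
  have "sqnorm (\<lambda>x. s *\<^sub>R gradient \<beta> x) = s\<^sup>2 * G"
    unfolding G_def D12g_integrable_sq(2)[OF D, symmetric] D12g_integrable_sq(2)[OF D12g_test[OF \<beta>], symmetric]
    by (simp add: power_mult_distrib)
  then have "BI_functional \<Omega> \<rho> (\<lambda>x. s * \<beta> x) \<le> s\<^sup>2 * G - s * pairing \<Omega> \<rho> \<beta>"
    using bi_energy_bounds(2)[OF X] pairing_lincomb[OF \<rho> \<Omega> \<beta>c \<beta>c, of s 0] unfolding BI_functional_Xg[OF X] by simp
  also have "\<dots> = s * (s * G - pairing \<Omega> \<rho> \<beta>)" by (simp add: power2_eq_square algebra_simps)
  also have "\<dots> < 0" using s(1) sG by (simp add: mult_less_0_iff)
  finally have neg: "BI_functional \<Omega> \<rho> (\<lambda>x. s * \<beta> x) < 0" .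
  note pm = potential_minimizer[OF dim \<rho> \<Omega>]
  obtain g where g: "Xg (potential \<Omega> \<rho>) g" by (rule X_space_Xg[OF pm(1)]) (rule that)
  have "BI_functional \<Omega> \<rho> (potential \<Omega> \<rho>) < 0" using pm(2)[OF Xg_X_space[OF X]] neg by linarith
  then show ?thesis
    unfolding BI_functional_Xg[OF g] using bi_energy_bounds(1)[OF g] sqnorm_nonneg[of g] by linarith
qed

section \<open>The truncated competitor and the conclusion\<close>

theorem theorem4p4:
  fixes \<Omega> :: "(real ^ 'n) set" and \<rho> :: "(real ^ 'n) measure" and lam :: real
  assumes "CARD('n) \<ge> 3"
    and "open \<Omega>" and "connected \<Omega>" and "\<Omega> \<noteq> {}" and "bounded \<Omega>"
    and "equilibrium_measure \<Omega> \<rho>"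
    and "lam = pairing \<Omega> \<rho> (potential \<Omega> \<rho>)"
  shows "\<forall>x\<in>closure \<Omega>. potential \<Omega> \<rho> x = lam"
proof -
  have dim: "DIM(real ^ 'n) \<ge> 3" using assms(1) by simp
  have \<rho>: "\<rho> \<in> prob_on_frontier \<Omega>" using assms(6) unfolding equilibrium_measure_def by simp
  define \<phi> where "\<phi> = potential \<Omega> \<rho>"
  note min = potential_minimizer[OF dim \<rho> assms(5), folded \<phi>_def]
  obtain g where g: "Xg \<phi> g" by (rule X_space_Xg[OF min(1)]) (rule that)
  have lam: "lam = pairing \<Omega> \<rho> \<phi>" unfolding \<phi>_def by (rule assms(7))
  have pos: "lam > 0" unfolding assms(7) by (rule pairing_potential_pos[OF dim \<rho> assms(5)])
  have ge: "lam \<le> \<phi> x" if "x \<in> frontier \<Omega>" for x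
    unfolding assms(7) \<phi>_def by (rule equilibrium_potential_ge[OF dim assms(5,6) that])
  have cont: "continuous_on UNIV \<phi>" by (rule XgD(4)[OF g])
  \<comment> \<open>The set where truncation changes \<phi>: values below the level are raised
    inside \<Omega> only, values above it are lowered everywhere.\<close>
  define A where "A = (\<Omega> \<inter> {x. \<phi> x \<noteq> lam}) \<union> {x. lam < \<phi> x}"
  have openA: "open A"
    unfolding A_def using assms(2) cont
    by (intro open_Un open_Int open_Collect_neq open_Collect_less continuous_on_const) auto
  \<comment> \<open>Positivity of the level enters here: decay at infinity then confines the points
    above the level to a ball.\<close>
  obtain R1 where R1: "\<And>x. R1 < norm x \<Longrightarrow> \<bar>\<phi> x\<bar> < lam"
    by (rule D12g_decay[OF XgD(1)[OF g] dim XgD(3)[OF g] pos]) (rule that)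
  obtain R2 where R2: "\<forall>x\<in>\<Omega>. norm x \<le> R2" using assms(5) bounded_iff by blast
  define R where "R = max R1 R2"
  have A_sub: "A \<subseteq> cball 0 R"
  proof
    fix x assume "x \<in> A"
    then consider "x \<in> \<Omega>" | "lam < \<phi> x" unfolding A_def by blast
    then have "norm x \<le> R"
    proof cases
      case 2
      then have "\<not> R1 < norm x" using R1[of x] by linarith
      then show ?thesis by (simp add: R_def)
    qed (use R2 in \<open>auto simp: R_def intro: le_max_iff_disj[THEN iffD2]\<close>)
    then show "x \<in> cball 0 R" by simp
  qed
  \<comment> \<open>A frontier point lies outside the open set A, which gives the upper bound. For
    the lower one it is above the level, or in \<Omega> but not in A, or on the frontier of
    \<Omega>, where \<open>ge\<close> applies.\<close>
  have fr: "\<phi> z = lam" if z: "z \<in> frontier A" for z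
  proof (rule antisym)
    have zA: "z \<notin> A" using z openA by (simp add: frontier_def interior_open)
    then show "\<phi> z \<le> lam" unfolding A_def by auto
    have "z \<in> closure A" using z by (simp add: frontier_def)
    also have "closure A \<subseteq> closure \<Omega> \<union> {x. lam \<le> \<phi> x}"
    proof (rule closure_minimal)
      show "A \<subseteq> closure \<Omega> \<union> {x. lam \<le> \<phi> x}" unfolding A_def using closure_subset by fastforce
      show "closed (closure \<Omega> \<union> {x. lam \<le> \<phi> x})"
        by (intro closed_Un closed_closure closed_Collect_le continuous_on_const cont)
    qed
    finally have "z \<in> closure \<Omega> \<or> lam \<le> \<phi> z" by blast
    then show "lam \<le> \<phi> z"
    proof
      assume "z \<in> closure \<Omega>"
      show ?thesis
      proof (cases "z \<in> \<Omega>")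
        case True
        then show ?thesis using zA unfolding A_def by auto
      next
        case False
        then have "z \<in> frontier \<Omega>" using \<open>z \<in> closure \<Omega>\<close> assms(2) by (simp add: frontier_def interior_open)
        then show ?thesis by (rule ge)
      qed
    qed
  qed
  define w where "w x = (if x \<in> A then \<phi> x - lam else 0)" for x
  define gA where "gA x = indicator A x *\<^sub>R g x" for x
  have w_lip: "1-lipschitz_on UNIV w" by (rule cutoff_lipschitz[OF XgD(3)[OF g] openA fr w_def])
  have w_grad: "is_weak_grad w gA"
    unfolding gA_def[abs_def]
    by (rule weak_grad_cutoff[OF D12g_is_weak_grad[OF XgD(1)[OF g]] XgD(3)[OF g] XgD(2)[OF g] openA A_sub w_lip w_def])
  have w_out: "w x = 0" "gA x = 0" if "R < norm x" for x
    using A_sub that by (auto simp: w_def gA_def indicator_def)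
  have Dw: "D12g w gA"
    by (rule D12g_compact_support[OF w_grad lipschitz_on_continuous_on[OF w_lip] w_out(1) _ w_out(2)])
      (auto simp: gA_def indicator_def XgD(2)[OF g])
  \<comment> \<open>This is the level on \<Omega> and the minimum of \<phi> and the level elsewhere.
    Writing it as a difference yields membership and gradient by linearity.\<close>
  define \<phi>' where "\<phi>' x = \<phi> x - w x" for x
  have D': "D12g \<phi>' (\<lambda>x. g x - gA x)" unfolding \<phi>'_def[abs_def] by (rule D12g_diff[OF XgD(1)[OF g] Dw])
  have g'le: "norm (g x - gA x) \<le> 1" for x using XgD(2)[OF g, of x] by (simp add: gA_def indicator_def)
  have cont': "continuous_on UNIV \<phi>'"
    unfolding \<phi>'_def[abs_def] by (intro continuous_on_diff cont lipschitz_on_continuous_on[OF w_lip])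
  have X': "Xg \<phi>' (\<lambda>x. g x - gA x)"
    unfolding Xg_def
    by (intro conjI allI D' g'le weak_grad_bounded_lipschitz[OF D12g_is_weak_grad[OF D'] cont']) (simp add: g'le)
  \<comment> \<open>The new gradient is 0 on A and g elsewhere, so the density drops
    pointwise.\<close>
  have "bi_energy (\<lambda>x. g x - gA x) \<le> bi_energy g"
    unfolding bi_energy_def
  proof (rule integral_mono[OF Xg_bi_integrable[OF X'] Xg_bi_integrable[OF g]])
    show "bi (g x - gA x) \<le> bi (g x)" for x
      using bi_bounds(3)[OF XgD(2)[OF g, of x]] by (auto simp: gA_def indicator_def bi_def)
  qed
  moreover have "pairing \<Omega> \<rho> \<phi>' = lam"
  proof -
    \<comment> \<open>Frontier points lie outside the open set \<Omega> and have values at or above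
      the level, so truncation gives exactly the level.\<close>
    have eq: "\<phi>' x = lam" if x: "x \<in> frontier \<Omega>" for x
    proof -
      have "x \<notin> \<Omega>" using x assms(2) by (simp add: frontier_def interior_open)
      then show ?thesis using ge[OF x] by (auto simp: \<phi>'_def w_def A_def)
    qed
    have "pairing \<Omega> \<rho> \<phi>' \<le> pairing \<Omega> \<rho> (\<lambda>x. lam)" "pairing \<Omega> \<rho> (\<lambda>x. lam) \<le> pairing \<Omega> \<rho> \<phi>'"
      by (intro pairing_mono \<rho> assms(5) cont' continuous_on_const; simp add: eq)+
    then show ?thesis by (simp add: pairing_const[OF \<rho>])
  qed
  ultimately have le: "BI_functional \<Omega> \<rho> \<phi>' \<le> BI_functional \<Omega> \<rho> \<phi>"
    unfolding BI_functional_Xg[OF X'] BI_functional_Xg[OF g] using lam by linarith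
  have "\<phi> = \<phi>'"
    by (rule minimizer_unique[OF dim \<rho> assms(5) min(1) _ Xg_X_space[OF X'] le]) (erule min(2))
  \<comment> \<open>A point of \<Omega> with a value other than the level would lie in A, where w is
    the nonzero difference.\<close>
  then have "w x = 0" for x unfolding \<phi>'_def[abs_def] by (metis diff_eq_eq add_cancel_left_right)
  then have in\<Omega>: "\<phi> x = lam" if "x \<in> \<Omega>" for x
    using that unfolding w_def A_def by (metis (mono_tags, lifting) Int_iff UnI1 eq_iff_diff_eq_0 mem_Collect_eq)
  have "closure \<Omega> \<subseteq> {x. \<phi> x = lam}"
    by (rule closure_minimal) (use in\<Omega> cont in \<open>auto intro!: closed_Collect_eq continuous_on_const\<close>)
  then show ?thesis unfolding \<phi>_def by blast
qed

end
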